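(* Let $(M,\Psi)$ be a balanced $Spin(7)$ manifold, i.e. its Lee form vanishes, $\theta=0$. Let $\nabla$ be its torsion connection, with torsion 3-form $T$ and curvature $R$. Then $R$ is a $Spin(7)$-instanton and $d^{\nabla}T=0$ (equivalently, $dT=2\sigma^T$) if and only if the torsion 3-form is parallel with respect to the torsion connection, $\nabla T=0$.
   Context: Manifolds are smooth. A $Spin(7)$ manifold $(M,\Psi)$ is an 8-manifold with a 4-form $\Psi$ that near each point can be written, in a local coframe $e_0,\dots,e_7$, as $\Psi=-e_{0127}+e_{0236}-e_{0347}-e_{0567}+e_{0146}+e_{0245}-e_{0135}-e_{3456}-e_{1457}-e_{1256}-e_{1234}-e_{2357}-e_{1367}+e_{2467}$, where $e_{ijkl}=e_i\wedge e_j\wedge e_k\wedge e_l$. It induces the metric $g$ and orientation for which such coframes are oriented orthonormal; $*$ is the Hodge star and $\delta=-*d*$ the codifferential. Indices refer to a local orthonormal frame, and repeated indices are summed. The Lee form is $\theta=-\frac17*( *d\Psi\wedge\Psi)$, i.e. $\theta_a=\frac1{42}(\delta\Psi)_{ijk}\Psi_{ijka}$. There is a unique linear connection $\nabla$ (the torsion connection) with $\nabla g=0$, $\nabla\Psi=0$ and totally skew-symmetric torsion, i.e. $T(X,Y,Z)=g(\nabla_XY-\nabla_YX-[X,Y],Z)$ is a 3-form. Curvature: $R(X,Y)Z=[\nabla_X,\nabla_Y]Z-\nabla_{[X,Y]}Z$, $R(X,Y,Z,V)=g(R(X,Y)Z,V)$. $R$ is a $Spin(7)$-instanton if $R_{abij}\Psi_{abkl}=2R_{klij}$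 for all $i,j,k,l$, i.e. the curvature 2-form lies in $\mathfrak{spin}(7)\cong\{\alpha\in\Lambda^2:\alpha_{ij}\Psi_{ijkl}=2\alpha_{kl}\}$; equivalently (since $\nabla\Psi=0$) $R\in\mathfrak{spin}(7)\otimes\mathfrak{spin}(7)$. The 4-form $d^\nabla T$ is $d^{\nabla}T(X,Y,Z,V)=(\nabla_XT)(Y,Z,V)+(\nabla_YT)(Z,X,V)+(\nabla_ZT)(X,Y,V)-(\nabla_VT)(X,Y,Z)$, and $\sigma^T=\frac12\sum_j(e_j\lrcorner T)\wedge(e_j\lrcorner T)$ for an orthonormal frame, where $(e_j\lrcorner T)(X,Y)=T(e_j,X,Y)$. One always has $dT=d^{\nabla}T+2\sigma^T$. *)

theory Defs
  imports "HOL-Analysis.Analysis"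
begin

section \<open>Smooth manifolds of dimension 8\<close>

text \<open>\<open>Ck_on k S f\<close> (used for open \<open>S\<close>): all iterated directional derivatives of \<open>f\<close> of order
  at most \<open>k\<close> exist and are continuous on \<open>S\<close>, those of order less than \<open>k\<close> being differentiable.\<close>

primrec Ck_on ::
  "nat \<Rightarrow> 'a::real_normed_vector set \<Rightarrow> ('a \<Rightarrow> 'b::real_normed_vector) \<Rightarrow> bool" where
  "Ck_on 0 S f \<longleftrightarrow> continuous_on S f"
| "Ck_on (Suc k) S f \<longleftrightarrow>
     (\<forall>x\<in>S. f differentiable (at x)) \<and> (\<forall>v. Ck_on k S (\<lambda>x. frechet_derivative f (at x) v))"

definition Cinf_on :: "'a::real_normed_vector set \<Rightarrow> ('a \<Rightarrow> 'b::real_normed_vector) \<Rightarrow> bool" where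
  "Cinf_on S f \<longleftrightarrow> (\<forall>k. Ck_on k S f)"

text \<open>The manifold is the whole type \<open>'m\<close>, whose class provides a Hausdorff second countable
  topology. A chart is a domain together with a map that is only meaningful on this domain.\<close>

type_synonym 'm chart = "'m set \<times> ('m \<Rightarrow> real^8)"

definition smooth_atlas :: "'m::{t2_space,second_countable_topology} chart set \<Rightarrow> bool" where
  "smooth_atlas A \<longleftrightarrow>
     (\<Union>(U, \<phi>)\<in>A. U) = UNIV \<and>
     (\<forall>(U, \<phi>)\<in>A. open U \<and> open (\<phi> ` U) \<and> homeomorphism U (\<phi> ` U) \<phi> (inv_into U \<phi>)) \<and>
     (\<forall>(U, \<phi>)\<in>A. \<forall>(V, \<psi>)\<in>A. Cinf_on (\<phi> ` (U \<inter> V)) (\<psi> \<circ> inv_into U \<phi>))"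

text \<open>Smooth real functions on an open set \<open>W\<close> of the manifold.\<close>

definition smooth_fun_on ::
  "'m::{t2_space,second_countable_topology} chart set \<Rightarrow> 'm set \<Rightarrow> ('m \<Rightarrow> real) \<Rightarrow> bool" where
  "smooth_fun_on A W f \<longleftrightarrow> (\<forall>(U, \<phi>)\<in>A. Cinf_on (\<phi> ` (U \<inter> W)) (f \<circ> inv_into U \<phi>))"

abbreviation smooth_fun ::
  "'m::{t2_space,second_countable_topology} chart set \<Rightarrow> ('m \<Rightarrow> real) \<Rightarrow> bool" where
  "smooth_fun A \<equiv> smooth_fun_on A UNIV"

section \<open>Vector fields\<close>

text \<open>Smooth vector fields are the derivations of the algebra of smooth functions. Their value at
  functions that are not smooth is fixed to be 0, so that equality of vector fields is HOL equality.\<close>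

type_synonym 'm vfield = "('m \<Rightarrow> real) \<Rightarrow> 'm \<Rightarrow> real"

definition vector_fields :: "'m::{t2_space,second_countable_topology} chart set \<Rightarrow> 'm vfield set" where
  "vector_fields A = {X.
     (\<forall>f. smooth_fun A f \<longrightarrow> smooth_fun A (X f)) \<and>
     (\<forall>f h a b. smooth_fun A f \<longrightarrow> smooth_fun A h \<longrightarrow>
        X (\<lambda>p. a * f p + b * h p) = (\<lambda>p. a * X f p + b * X h p)) \<and>
     (\<forall>f h. smooth_fun A f \<longrightarrow> smooth_fun A h \<longrightarrow>
        X (\<lambda>p. f p * h p) = (\<lambda>p. f p * X h p + h p * X f p)) \<and>
     (\<forall>f. \<not> smooth_fun A f \<longrightarrow> X f = (\<lambda>p. 0))}"

definition vf_add :: "'m vfield \<Rightarrow> 'm vfield \<Rightarrow> 'm vfield" where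
  "vf_add X Y = (\<lambda>f p. X f p + Y f p)"

definition vf_diff :: "'m vfield \<Rightarrow> 'm vfield \<Rightarrow> 'm vfield" where
  "vf_diff X Y = (\<lambda>f p. X f p - Y f p)"

definition vf_scale :: "('m \<Rightarrow> real) \<Rightarrow> 'm vfield \<Rightarrow> 'm vfield" where
  "vf_scale h X = (\<lambda>f p. h p * X f p)"

definition lie_bracket :: "'m vfield \<Rightarrow> 'm vfield \<Rightarrow> 'm vfield" where
  "lie_bracket X Y = (\<lambda>f p. X (Y f) p - Y (X f) p)"

text \<open>The tangent vector \<open>X\<^sub>p\<close> vanishes.\<close>

definition vf_zero_at ::
  "'m::{t2_space,second_countable_topology} chart set \<Rightarrow> 'm vfield \<Rightarrow> 'm \<Rightarrow> bool" where
  "vf_zero_at A X p \<longleftrightarrow> (\<forall>f. smooth_fun A f \<longrightarrow> X f p = 0)"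

section \<open>Covariant tensor fields and differential forms\<close>

text \<open>A covariant tensor field of rank \<open>k\<close> takes a list of \<open>k\<close> vector fields to a function and is
  multilinear over the smooth functions; its values on other lists are irrelevant.
  A tensor field on an open set \<open>U\<close> is described by its values, at the points of \<open>U\<close>, on globally
  defined vector fields; these represent all tangent vectors at all points of \<open>U\<close>.\<close>

type_synonym 'm tensor = "'m vfield list \<Rightarrow> 'm \<Rightarrow> real"

definition field_lists ::
  "'m::{t2_space,second_countable_topology} chart set \<Rightarrow> nat \<Rightarrow> 'm vfield list set" where
  "field_lists A k = {Xs. length Xs = k \<and> set Xs \<subseteq> vector_fields A}"

definition tensor_on ::
  "'m::{t2_space,second_countable_topology} chart set \<Rightarrow> 'm set \<Rightarrow> nat \<Rightarrow> 'm tensor \<Rightarrow> bool" where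
  "tensor_on A U k \<alpha> \<longleftrightarrow>
     (\<forall>Xs \<in> field_lists A k. smooth_fun_on A U (\<alpha> Xs)) \<and>
     (\<forall>Xs \<in> field_lists A k. \<forall>i<k. \<forall>Y \<in> vector_fields A. \<forall>Z \<in> vector_fields A. \<forall>f h.
        smooth_fun A f \<longrightarrow> smooth_fun A h \<longrightarrow>
        (\<forall>p\<in>U. \<alpha> (Xs[i := vf_add (vf_scale f Y) (vf_scale h Z)]) p
                = f p * \<alpha> (Xs[i := Y]) p + h p * \<alpha> (Xs[i := Z]) p))"

definition form_on ::
  "'m::{t2_space,second_countable_topology} chart set \<Rightarrow> 'm set \<Rightarrow> nat \<Rightarrow> 'm tensor \<Rightarrow> bool" where
  "form_on A U k \<alpha> \<longleftrightarrow> tensor_on A U k \<alpha> \<and>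
     (\<forall>Xs \<in> field_lists A k. \<forall>i j. i < j \<and> j < k \<and> Xs ! i = Xs ! j \<longrightarrow> (\<forall>p\<in>U. \<alpha> Xs p = 0))"

definition tensor_eq ::
  "'m::{t2_space,second_countable_topology} chart set \<Rightarrow> nat \<Rightarrow> 'm tensor \<Rightarrow> 'm tensor \<Rightarrow> bool" where
  "tensor_eq A k \<alpha> \<beta> \<longleftrightarrow> (\<forall>Xs \<in> field_lists A k. \<alpha> Xs = \<beta> Xs)"

abbreviation tensor_zero ::
  "'m::{t2_space,second_countable_topology} chart set \<Rightarrow> nat \<Rightarrow> 'm tensor \<Rightarrow> bool" where
  "tensor_zero A k \<alpha> \<equiv> tensor_eq A k \<alpha> (\<lambda>Xs p. 0)"

text \<open>The wedge product of a \<open>k\<close>-form and an \<open>l\<close>-form (\<open>k + l\<close> is the number of arguments), as the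
  signed sum over \<open>(k,l)\<close>-shuffles: \<open>S\<close> is the set of positions of the arguments that are passed,
  in increasing order, to \<open>\<alpha>\<close>. This is the normalization in which
  \<open>\<alpha> \<and> \<beta> = \<alpha> \<otimes> \<beta> - \<beta> \<otimes> \<alpha>\<close> for 1-forms.\<close>

definition shuffle_sign :: "nat set \<Rightarrow> real" where
  "shuffle_sign S = (- 1) ^ card {(i, j). i \<in> S \<and> j \<notin> S \<and> j < i}"

definition wedge :: "nat \<Rightarrow> 'm tensor \<Rightarrow> 'm tensor \<Rightarrow> 'm tensor" where
  "wedge k \<alpha> \<beta> = (\<lambda>Xs p. \<Sum>S | S \<subseteq> {..<length Xs} \<and> card S = k.
      shuffle_sign S * \<alpha> (nths Xs S) p * \<beta> (nths Xs (- S)) p)"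

text \<open>The exterior derivative, by the invariant formula
  \<open>d\<alpha>(X\<^sub>0,\<dots>,X\<^sub>k) = \<Sum>\<^sub>i (-1)\<^sup>i X\<^sub>i(\<alpha>(\<dots>,omit X\<^sub>i,\<dots>))
    + \<Sum>\<^sub>i\<^sub><\<^sub>j (-1)\<^sup>i\<^sup>+\<^sup>j \<alpha>([X\<^sub>i,X\<^sub>j],\<dots>,omit X\<^sub>i,\<dots>,omit X\<^sub>j,\<dots>)\<close>.\<close>

definition ext_deriv :: "'m tensor \<Rightarrow> 'm tensor" where
  "ext_deriv \<alpha> = (\<lambda>Xs p.
     (\<Sum>i<length Xs. (- 1) ^ i * (Xs ! i) (\<alpha> (nths Xs (- {i}))) p) +
     (\<Sum>j<length Xs. \<Sum>i<j. (- 1) ^ (i + j) *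
         \<alpha> (lie_bracket (Xs ! i) (Xs ! j) # nths Xs (- {i, j})) p))"

definition interior_product :: "'m vfield \<Rightarrow> 'm tensor \<Rightarrow> 'm tensor" where
  "interior_product X \<alpha> = (\<lambda>Xs. \<alpha> (X # Xs))"

section \<open>Riemannian metrics and the Hodge star\<close>

definition riemannian_metric ::
  "'m::{t2_space,second_countable_topology} chart set \<Rightarrow> 'm tensor \<Rightarrow> bool" where
  "riemannian_metric A g \<longleftrightarrow> tensor_on A UNIV 2 g \<and>
     (\<forall>X \<in> vector_fields A. \<forall>Y \<in> vector_fields A. g [X, Y] = g [Y, X]) \<and>
     (\<forall>X \<in> vector_fields A. \<forall>p. \<not> vf_zero_at A X p \<longrightarrow> g [X, X] p > 0)"

text \<open>Vector fields whose values at the point \<open>p\<close> are an orthonormal basis of the tangent space.\<close>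

definition orthonormal_at ::
  "'m::{t2_space,second_countable_topology} chart set \<Rightarrow> 'm tensor \<Rightarrow> 'm \<Rightarrow> 'm vfield list \<Rightarrow> bool" where
  "orthonormal_at A g p E \<longleftrightarrow> E \<in> field_lists A 8 \<and>
     (\<forall>i<8. \<forall>j<8. g [E ! i, E ! j] p = (if i = j then 1 else 0))"

text \<open>A choice of such a frame at each point; it is only used in contractions that do not
  depend on the frame.\<close>

definition orthonormal_choice ::
  "'m::{t2_space,second_countable_topology} chart set \<Rightarrow> 'm tensor \<Rightarrow> 'm \<Rightarrow> 'm vfield list" where
  "orthonormal_choice A g p = (SOME E. orthonormal_at A g p E)"

text \<open>The Hodge star of a \<open>k\<close>-form for the metric \<open>g\<close> and the Riemannian volume form \<open>vol\<close>:
  \<open>(*\<alpha>)(Y\<^sub>1,\<dots>) = 1/k! \<alpha>\<^sub>i\<^sub>1\<^sub>\<dots>\<^sub>i\<^sub>k vol(e\<^sub>i\<^sub>1,\<dots>,e\<^sub>i\<^sub>k,Y\<^sub>1,\<dots>)\<close>, so that \<open>\<alpha> \<and> *\<beta> = <\<alpha>,\<beta>> vol\<close>.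
  The sum is taken over increasing indices, which absorbs the factor \<open>1/k!\<close>.\<close>

definition hodge ::
  "'m::{t2_space,second_countable_topology} chart set \<Rightarrow> 'm tensor \<Rightarrow> 'm tensor \<Rightarrow> nat \<Rightarrow> 'm tensor \<Rightarrow> 'm tensor"
  where
  "hodge A g vol k \<alpha> = (\<lambda>Ys p. let E = orthonormal_choice A g p in
     \<Sum>S | S \<subseteq> {..<8} \<and> card S = k. \<alpha> (nths E S) p * vol (nths E S @ Ys) p)"

section \<open>Spin(7) structures\<close>

definition local_coframe ::
  "'m::{t2_space,second_countable_topology} chart set \<Rightarrow> 'm set \<Rightarrow> (nat \<Rightarrow> 'm tensor) \<Rightarrow> bool" where
  "local_coframe A U e \<longleftrightarrow> open U \<and> (\<forall>i<8. form_on A U 1 (e i)) \<and>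
     (\<forall>p\<in>U. \<forall>c :: nat \<Rightarrow> real.
        (\<forall>X \<in> vector_fields A. (\<Sum>i<8. c i * e i [X] p) = 0) \<longrightarrow> (\<forall>i<8. c i = 0))"

text \<open>\<open>wedges e [i, j, k, l]\<close> is \<open>e\<^sub>i \<and> e\<^sub>j \<and> e\<^sub>k \<and> e\<^sub>l\<close>.\<close>

definition wedges :: "(nat \<Rightarrow> 'm tensor) \<Rightarrow> nat list \<Rightarrow> 'm tensor" where
  "wedges e is = foldr (\<lambda>i \<beta>. wedge 1 (e i) \<beta>) is (\<lambda>Xs p. 1)"

definition spin7_model :: "(nat \<Rightarrow> 'm tensor) \<Rightarrow> 'm tensor" where
  "spin7_model e = (\<lambda>Xs p.
     - wedges e [0,1,2,7] Xs p + wedges e [0,2,3,6] Xs p - wedges e [0,3,4,7] Xs p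
     - wedges e [0,5,6,7] Xs p + wedges e [0,1,4,6] Xs p + wedges e [0,2,4,5] Xs p
     - wedges e [0,1,3,5] Xs p - wedges e [3,4,5,6] Xs p - wedges e [1,4,5,7] Xs p
     - wedges e [1,2,5,6] Xs p - wedges e [1,2,3,4] Xs p - wedges e [2,3,5,7] Xs p
     - wedges e [1,3,6,7] Xs p + wedges e [2,4,6,7] Xs p)"

definition spin7_coframe ::
  "'m::{t2_space,second_countable_topology} chart set \<Rightarrow> 'm tensor \<Rightarrow> 'm set \<Rightarrow> (nat \<Rightarrow> 'm tensor) \<Rightarrow> bool"
  where
  "spin7_coframe A \<Psi> U e \<longleftrightarrow> local_coframe A U e \<and>
     (\<forall>Xs \<in> field_lists A 4. \<forall>p\<in>U. \<Psi> Xs p = spin7_model e Xs p)"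

definition spin7_structure ::
  "'m::{t2_space,second_countable_topology} chart set \<Rightarrow> 'm tensor \<Rightarrow> bool" where
  "spin7_structure A \<Psi> \<longleftrightarrow> form_on A UNIV 4 \<Psi> \<and> (\<forall>p. \<exists>U e. p \<in> U \<and> spin7_coframe A \<Psi> U e)"

text \<open>The metric \<open>g\<close> and, via the Riemannian volume form, the orientation for which the coframes
  adapted to \<open>\<Psi>\<close> are oriented orthonormal.\<close>

definition induced_metric ::
  "'m::{t2_space,second_countable_topology} chart set \<Rightarrow> 'm tensor \<Rightarrow> 'm tensor \<Rightarrow> bool" where
  "induced_metric A \<Psi> g \<longleftrightarrow> riemannian_metric A g \<and>
     (\<forall>U e. spin7_coframe A \<Psi> U e \<longrightarrow>
        (\<forall>X \<in> vector_fields A. \<forall>Y \<in> vector_fields A. \<forall>p\<in>U.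
           g [X, Y] p = (\<Sum>i<8. e i [X] p * e i [Y] p)))"

definition induced_volume_form ::
  "'m::{t2_space,second_countable_topology} chart set \<Rightarrow> 'm tensor \<Rightarrow> 'm tensor \<Rightarrow> bool" where
  "induced_volume_form A \<Psi> vol \<longleftrightarrow> form_on A UNIV 8 vol \<and>
     (\<forall>U e. spin7_coframe A \<Psi> U e \<longrightarrow>
        (\<forall>Xs \<in> field_lists A 8. \<forall>p\<in>U. vol Xs p = wedges e [0,1,2,3,4,5,6,7] Xs p))"

text \<open>\<open>\<theta> = -1/7 *(*d\<Psi> \<and> \<Psi>)\<close>\<close>

definition lee_form ::
  "'m::{t2_space,second_countable_topology} chart set \<Rightarrow> 'm tensor \<Rightarrow> 'm tensor \<Rightarrow> 'm tensor \<Rightarrow> 'm tensor"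
  where
  "lee_form A g vol \<Psi> = (\<lambda>Xs p.
     - (1 / 7) * hodge A g vol 7 (wedge 3 (hodge A g vol 5 (ext_deriv \<Psi>)) \<Psi>) Xs p)"

definition balanced ::
  "'m::{t2_space,second_countable_topology} chart set \<Rightarrow> 'm tensor \<Rightarrow> 'm tensor \<Rightarrow> 'm tensor \<Rightarrow> bool"
  where
  "balanced A g vol \<Psi> \<longleftrightarrow> tensor_zero A 1 (lee_form A g vol \<Psi>)"

section \<open>The torsion connection\<close>

definition linear_connection ::
  "'m::{t2_space,second_countable_topology} chart set \<Rightarrow> ('m vfield \<Rightarrow> 'm vfield \<Rightarrow> 'm vfield) \<Rightarrow> bool"
  where
  "linear_connection A D \<longleftrightarrow>
     (\<forall>X \<in> vector_fields A. \<forall>Y \<in> vector_fields A. D X Y \<in> vector_fields A) \<and>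
     (\<forall>X \<in> vector_fields A. \<forall>Y \<in> vector_fields A. \<forall>Z \<in> vector_fields A.
        D (vf_add X Y) Z = vf_add (D X Z) (D Y Z) \<and>
        D X (vf_add Y Z) = vf_add (D X Y) (D X Z)) \<and>
     (\<forall>X \<in> vector_fields A. \<forall>Y \<in> vector_fields A. \<forall>f. smooth_fun A f \<longrightarrow>
        D (vf_scale f X) Y = vf_scale f (D X Y) \<and>
        D X (vf_scale f Y) = vf_add (vf_scale (X f) Y) (vf_scale f (D X Y)))"

text \<open>\<open>(\<nabla>\<^sub>X \<alpha>)(Y\<^sub>1,\<dots>,Y\<^sub>k) = X(\<alpha>(Y\<^sub>1,\<dots>,Y\<^sub>k)) - \<Sum>\<^sub>i \<alpha>(Y\<^sub>1,\<dots>,\<nabla>\<^sub>X Y\<^sub>i,\<dots>,Y\<^sub>k)\<close>\<close>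

definition cov_deriv ::
  "('m vfield \<Rightarrow> 'm vfield \<Rightarrow> 'm vfield) \<Rightarrow> 'm vfield \<Rightarrow> 'm tensor \<Rightarrow> 'm tensor" where
  "cov_deriv D X \<alpha> = (\<lambda>Ys p. X (\<alpha> Ys) p - (\<Sum>i<length Ys. \<alpha> (Ys[i := D X (Ys ! i)]) p))"

definition parallel ::
  "'m::{t2_space,second_countable_topology} chart set \<Rightarrow> ('m vfield \<Rightarrow> 'm vfield \<Rightarrow> 'm vfield) \<Rightarrow> nat \<Rightarrow> 'm tensor \<Rightarrow> bool"
  where
  "parallel A D k \<alpha> \<longleftrightarrow> (\<forall>X \<in> vector_fields A. tensor_zero A k (cov_deriv D X \<alpha>))"

definition torsion_form :: "'m tensor \<Rightarrow> ('m vfield \<Rightarrow> 'm vfield \<Rightarrow> 'm vfield) \<Rightarrow> 'm tensor" where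
  "torsion_form g D = (\<lambda>Xs. let X = Xs ! 0; Y = Xs ! 1; Z = Xs ! 2 in
     g [vf_diff (vf_diff (D X Y) (D Y X)) (lie_bracket X Y), Z])"

definition torsion_connection ::
  "'m::{t2_space,second_countable_topology} chart set \<Rightarrow> 'm tensor \<Rightarrow> 'm tensor \<Rightarrow>
     ('m vfield \<Rightarrow> 'm vfield \<Rightarrow> 'm vfield) \<Rightarrow> bool" where
  "torsion_connection A \<Psi> g D \<longleftrightarrow> linear_connection A D \<and>
     parallel A D 2 g \<and> parallel A D 4 \<Psi> \<and> form_on A UNIV 3 (torsion_form g D)"

definition curvature_op ::
  "('m vfield \<Rightarrow> 'm vfield \<Rightarrow> 'm vfield) \<Rightarrow> 'm vfield \<Rightarrow> 'm vfield \<Rightarrow> 'm vfield \<Rightarrow> 'm vfield" where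
  "curvature_op D X Y Z = vf_diff (vf_diff (D X (D Y Z)) (D Y (D X Z))) (D (lie_bracket X Y) Z)"

definition curvature :: "'m tensor \<Rightarrow> ('m vfield \<Rightarrow> 'm vfield \<Rightarrow> 'm vfield) \<Rightarrow> 'm tensor" where
  "curvature g D = (\<lambda>Xs. g [curvature_op D (Xs ! 0) (Xs ! 1) (Xs ! 2), Xs ! 3])"

definition spin7_instanton ::
  "'m::{t2_space,second_countable_topology} chart set \<Rightarrow> 'm tensor \<Rightarrow> 'm tensor \<Rightarrow> 'm tensor \<Rightarrow> bool"
  where
  "spin7_instanton A \<Psi> g R \<longleftrightarrow> (\<forall>p E. orthonormal_at A g p E \<longrightarrow>
     (\<forall>i<8. \<forall>j<8. \<forall>k<8. \<forall>l<8.
        (\<Sum>a<8. \<Sum>b<8. R [E ! a, E ! b, E ! i, E ! j] p * \<Psi> [E ! a, E ! b, E ! k, E ! l] p)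
          = 2 * R [E ! k, E ! l, E ! i, E ! j] p))"

definition cov_ext_deriv :: "('m vfield \<Rightarrow> 'm vfield \<Rightarrow> 'm vfield) \<Rightarrow> 'm tensor \<Rightarrow> 'm tensor" where
  "cov_ext_deriv D T = (\<lambda>Xs p. let X = Xs ! 0; Y = Xs ! 1; Z = Xs ! 2; V = Xs ! 3 in
     cov_deriv D X T [Y, Z, V] p + cov_deriv D Y T [Z, X, V] p +
     cov_deriv D Z T [X, Y, V] p - cov_deriv D V T [X, Y, Z] p)"

text \<open>\<open>\<sigma>\<^sup>T = 1/2 \<Sum>\<^sub>j (e\<^sub>j \<lrcorner> T) \<and> (e\<^sub>j \<lrcorner> T)\<close>\<close>

definition sigma_form ::
  "'m::{t2_space,second_countable_topology} chart set \<Rightarrow> 'm tensor \<Rightarrow> 'm tensor \<Rightarrow> 'm tensor" where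
  "sigma_form A g T = (\<lambda>Xs p. let E = orthonormal_choice A g p in
     (1 / 2) * (\<Sum>j<8. wedge 2 (interior_product (E ! j) T) (interior_product (E ! j) T) Xs p))"

end

theory Submission
  imports Defs "HOL-Combinatorics.Multiset_Permutations"
begin

text \<open>Balancedness says that the torsion has type 48, i.e. \<open>T\<^sub>a\<^sub>b\<^sub>c\<Psi>\<^sub>a\<^sub>b\<^sub>c\<^sub>d = 0\<close>, and then \<open>T\<^sub>a\<^sub>b\<^sub>s\<Psi>\<^sub>a\<^sub>b\<^sub>i\<^sub>m\<close> is
  orthogonal to spin(7) in \<open>i, s\<close>. Contracting the second Bianchi identity with \<open>\<Psi>\<close> therefore shows that the
  curvature of an instanton is divergence free. The first Bianchi identity with \<open>d\<^sup>\<nabla>T = 0\<close>, contracted with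
  \<open>\<Psi>\<close>, gives a symmetric Ricci tensor and a scalar curvature proportional to \<open>|T|\<^sup>2\<close>; the twice contracted
  second Bianchi identity then yields \<open>T\<^sub>j\<^sub>k\<^sub>l\<nabla>\<^sub>mT\<^sub>j\<^sub>k\<^sub>l = 0\<close>, hence \<open>T\<^sub>j\<^sub>k\<^sub>lR\<^sub>m\<^sub>j\<^sub>k\<^sub>l = 0\<close> everywhere. The divergence of this
  1-form is \<open>\<nabla>\<^sub>mT\<^sub>j\<^sub>k\<^sub>lR\<^sub>m\<^sub>j\<^sub>k\<^sub>l\<close>, which by the first Bianchi identity is a multiple of \<open>|\<nabla>T|\<^sup>2\<close>. Conversely, if
  \<open>\<nabla>T = 0\<close> then the first Bianchi identity makes \<open>R\<close> symmetric under exchange of the pairs, one of which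
  is spin(7)-valued because \<open>\<nabla>\<Psi> = 0\<close>.\<close>

section \<open>Smooth functions\<close>

text \<open>The twice contracted second Bianchi identity is conclusive because its constants differ.
  With X_i = T_sjk (nabla_i T)_sjk, the scalar curvature formula makes its trace term 2/3 X_i, while
  the first Bianchi identity makes T_sjk R_isjk equal to 1/3 X_i. Symmetry of the Ricci tensor and
  the vanishing divergence remove the rest, so X_i = 0. The argument is pointwise: the divergence is
  taken of a 1-form that is identically zero, so nothing is integrated. The formal obstacle is that
  fields are derivations of global functions and that an adapted coframe is dualised by global
  fields at one point only. There is no smooth adapted frame in which an identity could be
  differentiated. Each such identity is therefore encoded as an iterated contraction
  \<open>ctr\<close> of a tensor, verified in adapted frames, where the values of \<Psi> are
  explicit, and differentiated by moving the derivative under the contraction with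
  \<open>cov_ctr\<close>. The algebra in a frame is done separately, in locales of real
  arrays.\<close>

lemma Ck_on_cong:
  assumes "open S" "\<And>x. x \<in> S \<Longrightarrow> f x = g x" "Ck_on k S f"
  shows "Ck_on k S g"
  using assms(2,3)
proof (induction k arbitrary: f g)
  case 0
  show ?case using 0(2) unfolding Ck_on.simps by (rule continuous_on_eq) (rule 0(1))
next
  case (Suc k)
  have *: "(g has_derivative frechet_derivative f (at x)) (at x)" if "x \<in> S" for x
  proof -
    have "(f has_derivative frechet_derivative f (at x)) (at x)"
      using Suc.prems(2) that unfolding frechet_derivative_works[symmetric] Ck_on.simps by blast
    then show ?thesis
      by (rule has_derivative_transform_within_open[OF _ assms(1) that Suc.prems(1)])
  qed
  have "Ck_on k S (\<lambda>x. frechet_derivative g (at x) v)" for v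
  proof (rule Suc.IH)
    show "frechet_derivative f (at x) v = frechet_derivative g (at x) v" if "x \<in> S" for x
      by (rule fun_cong[OF frechet_derivative_at[OF *[OF that]]])
    show "Ck_on k S (\<lambda>x. frechet_derivative f (at x) v)"
      using Suc.prems(2) unfolding Ck_on.simps by blast
  qed
  then show ?case
    unfolding Ck_on.simps differentiable_def using * by blast
qed

lemma Ck_on_mono: "Ck_on k S f \<Longrightarrow> S' \<subseteq> S \<Longrightarrow> Ck_on k S' f"
  by (induction k arbitrary: f) (auto intro: continuous_on_subset)

lemma Ck_on_Suc_imp: "Ck_on (Suc k) S f \<Longrightarrow> Ck_on k S f"
proof (induction k arbitrary: f)
  case 0
  then show ?case
    by (auto intro!: continuous_at_imp_continuous_on differentiable_imp_continuous_within)
qed auto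

lemma Ck_on_const: "Ck_on k S (\<lambda>x. c)"
  by (induction k arbitrary: c) (auto simp: frechet_derivative_const)

text \<open>Needed because the quotients below are known to be smooth only near each point.
  Derivatives see only the germ of f, so the induction on k passes to the directional derivatives on
  the same neighbourhoods.\<close>

lemma Ck_on_local:
  assumes "open S" "\<And>x. x \<in> S \<Longrightarrow> \<exists>U. open U \<and> x \<in> U \<and> Ck_on k (S \<inter> U) f"
  shows "Ck_on k S f"
  using assms(2)
proof (induction k arbitrary: f)
  case 0
  show ?case unfolding Ck_on.simps
  proof (rule continuous_at_imp_continuous_on, intro ballI)
    fix x assume "x \<in> S"
    then obtain U where "open U" "x \<in> U" "continuous_on (S \<inter> U) f" using 0 by auto
    then show "isCont f x" using assms(1) \<open>x \<in> S\<close>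
      by (meson IntI continuous_on_eq_continuous_at open_Int)
  qed
next
  case (Suc k)
  have "Ck_on k S (\<lambda>x. frechet_derivative f (at x) v)" for v
    using Suc.prems by (intro Suc.IH) (fastforce simp: Ck_on.simps(2))
  moreover have "f differentiable (at x)" if "x \<in> S" for x
    using Suc.prems[OF that] that by auto
  ultimately show ?case unfolding Ck_on.simps by blast
qed

lemma Ck_on_add:
  "open S \<Longrightarrow> Ck_on k S f \<Longrightarrow> Ck_on k S g \<Longrightarrow> Ck_on k S (\<lambda>x. f x + g x)"
proof (induction k arbitrary: f g)
  case (Suc k)
  have "Ck_on k S (\<lambda>x. frechet_derivative (\<lambda>x. f x + g x) (at x) v)" for v
  proof (rule Ck_on_cong[OF Suc.prems(1)])
    show "Ck_on k S (\<lambda>x. frechet_derivative f (at x) v + frechet_derivative g (at x) v)"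
      using Suc.prems by (intro Suc.IH) (simp_all only: Ck_on.simps)
    show "frechet_derivative f (at x) v + frechet_derivative g (at x) v
        = frechet_derivative (\<lambda>x. f x + g x) (at x) v" if "x \<in> S" for x
    proof -
      have "((\<lambda>x. f x + g x) has_derivative
         (\<lambda>h. frechet_derivative f (at x) h + frechet_derivative g (at x) h)) (at x)"
        using Suc.prems that
        by (intro has_derivative_add) (simp_all only: Ck_on.simps flip: frechet_derivative_works)
      from fun_cong[OF frechet_derivative_at[OF this]] show ?thesis .
    qed
  qed
  moreover have "(\<lambda>x. f x + g x) differentiable at x" if "x \<in> S" for x
    using Suc.prems that by (intro differentiable_add) (simp_all only: Ck_on.simps)
  ultimately show ?case unfolding Ck_on.simps by blast
next
  case 0
  then show ?case unfolding Ck_on.simps by (intro continuous_on_add)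
qed

lemma Ck_on_mult:
  fixes f g :: "'a::real_normed_vector \<Rightarrow> real"
  shows "open S \<Longrightarrow> Ck_on k S f \<Longrightarrow> Ck_on k S g \<Longrightarrow> Ck_on k S (\<lambda>x. f x * g x)"
proof (induction k arbitrary: f g)
  case (Suc k)
  have "Ck_on k S (\<lambda>x. frechet_derivative (\<lambda>x. f x * g x) (at x) v)" for v
  proof (rule Ck_on_cong[OF Suc.prems(1)])
    show "Ck_on k S (\<lambda>x. f x * frechet_derivative g (at x) v + frechet_derivative f (at x) v * g x)"
    proof (rule Ck_on_add[OF Suc.prems(1)])
      show "Ck_on k S (\<lambda>x. f x * frechet_derivative g (at x) v)"
        using Suc.prems by (intro Suc.IH Ck_on_Suc_imp[OF Suc.prems(2)]) (simp_all only: Ck_on.simps)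
      show "Ck_on k S (\<lambda>x. frechet_derivative f (at x) v * g x)"
        using Suc.prems by (intro Suc.IH Ck_on_Suc_imp[OF Suc.prems(3)]) (simp_all only: Ck_on.simps)
    qed
    show "f x * frechet_derivative g (at x) v + frechet_derivative f (at x) v * g x
        = frechet_derivative (\<lambda>x. f x * g x) (at x) v" if "x \<in> S" for x
    proof -
      have "((\<lambda>x. f x * g x) has_derivative
         (\<lambda>h. f x * frechet_derivative g (at x) h + frechet_derivative f (at x) h * g x)) (at x)"
        using Suc.prems that
        by (intro has_derivative_mult) (simp_all only: Ck_on.simps flip: frechet_derivative_works)
      from fun_cong[OF frechet_derivative_at[OF this]] show ?thesis .
    qed
  qed
  moreover have "(\<lambda>x. f x * g x) differentiable at x" if "x \<in> S" for x
    using Suc.prems that by (intro differentiable_mult) (simp_all only: Ck_on.simps)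
  ultimately show ?case unfolding Ck_on.simps by blast
next
  case 0
  then show ?case unfolding Ck_on.simps by (intro continuous_on_mult)
qed

lemma Ck_on_inverse:
  fixes f :: "'a::real_normed_vector \<Rightarrow> real"
  assumes "open S" "\<And>x. x \<in> S \<Longrightarrow> f x \<noteq> 0"
  shows "Ck_on k S f \<Longrightarrow> Ck_on k S (\<lambda>x. inverse (f x))"
proof (induction k)
  case (Suc k)
  have d: "((\<lambda>x. inverse (f x)) has_derivative
         (\<lambda>h. - (inverse (f x) * frechet_derivative f (at x) h * inverse (f x)))) (at x)"
    if "x \<in> S" for x
    using Suc.prems that assms(2)
    by (intro Deriv.has_derivative_inverse) (simp_all add: frechet_derivative_works[symmetric])
  have "Ck_on k S (\<lambda>x. frechet_derivative (\<lambda>x. inverse (f x)) (at x) v)" for v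
  proof (rule Ck_on_cong[OF assms(1)])
    show "Ck_on k S (\<lambda>x. (- 1) * (inverse (f x) * frechet_derivative f (at x) v * inverse (f x)))"
      by (intro Ck_on_mult Ck_on_const Suc.IH Ck_on_Suc_imp[OF Suc.prems] assms(1))
        (use Suc.prems in \<open>simp only: Ck_on.simps\<close>)
    show "(- 1) * (inverse (f x) * frechet_derivative f (at x) v * inverse (f x))
        = frechet_derivative (\<lambda>x. inverse (f x)) (at x) v" if "x \<in> S" for x
      using fun_cong[OF frechet_derivative_at[OF d[OF that]], of v] by simp
  qed
  then show ?case using d by (auto simp: differentiable_def)
next
  case 0
  then show ?case unfolding Ck_on.simps using assms(2) by (intro continuous_on_inverse) auto
qed

section \<open>Smooth functions on the manifold and their local quotients\<close>

lemma smooth_atlas_open: "smooth_atlas A \<Longrightarrow> (U, \<phi>) \<in> A \<Longrightarrow> open (\<phi> ` U)"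
  unfolding smooth_atlas_def by auto

lemma smooth_funD:
  assumes "smooth_fun A f" "(U, \<phi>) \<in> A"
  shows "Ck_on k (\<phi> ` U) (\<lambda>x. f (inv_into U \<phi> x))"
  using bspec[OF assms(1)[unfolded smooth_fun_on_def] assms(2)]
  by (simp only: case_prod_conv Int_UNIV_right Cinf_on_def comp_def)

lemma smooth_funI:
  assumes "\<And>U \<phi> k. (U, \<phi>) \<in> A \<Longrightarrow> Ck_on k (\<phi> ` U) (\<lambda>x. f (inv_into U \<phi> x))"
  shows "smooth_fun A f"
  unfolding smooth_fun_on_def Cinf_on_def comp_def Int_UNIV_right
  using assms by auto

lemma smooth_fun_const [simp]: "smooth_fun A (\<lambda>p. c)"
  by (rule smooth_funI) (rule Ck_on_const)

lemma smooth_fun_add: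
  "smooth_atlas A \<Longrightarrow> smooth_fun A f \<Longrightarrow> smooth_fun A h \<Longrightarrow> smooth_fun A (\<lambda>p. f p + h p)"
  by (rule smooth_funI) (rule Ck_on_add[OF smooth_atlas_open smooth_funD smooth_funD])

lemma smooth_fun_mult:
  "smooth_atlas A \<Longrightarrow> smooth_fun A f \<Longrightarrow> smooth_fun A h \<Longrightarrow> smooth_fun A (\<lambda>p. f p * h p)"
  by (rule smooth_funI) (rule Ck_on_mult[OF smooth_atlas_open smooth_funD smooth_funD])

text \<open>Metric contractions are defined through a pointwise choice of frame, which hides their
  smoothness. Multiplied by the squared volume h of an orthogonal frame they become visibly smooth.
  Since h is nonzero on a neighbourhood of p, c = s / h there.\<close>

lemma smooth_fun_quotient:
  assumes A: "smooth_atlas A"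
    and loc: "\<And>p. \<exists>h s. smooth_fun A h \<and> smooth_fun A s \<and> h p \<noteq> 0 \<and> (\<forall>q. h q * c q = s q)"
  shows "smooth_fun A c"
proof -
  have "Ck_on k (\<phi> ` U) (\<lambda>x. c (inv_into U \<phi> x))" if U: "(U, \<phi>) \<in> A" for U \<phi> k
  proof (rule Ck_on_local[OF smooth_atlas_open[OF A U]])
    fix x assume x: "x \<in> \<phi> ` U"
    define V where "V = \<phi> ` U"
    have oV: "open V" using smooth_atlas_open[OF A U] V_def by simp
    obtain h s where h: "smooth_fun A h" and s: "smooth_fun A s" and hx: "h (inv_into U \<phi> x) \<noteq> 0"
      and eq: "\<And>q. h q * c q = s q" using loc[of "inv_into U \<phi> x"] by blast
    define H where "H = (\<lambda>y. h (inv_into U \<phi> y))"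
    have H: "Ck_on k V H" for k
      using smooth_funD[OF h U] by (simp only: H_def V_def)
    have s: "Ck_on k V (\<lambda>x. s (inv_into U \<phi> x))" for k
      using smooth_funD[OF s U] by (simp only: V_def)
    define W where "W = {y \<in> V. H y \<noteq> 0}"
    have WV: "W \<subseteq> V" and nz: "\<And>y. y \<in> W \<Longrightarrow> H y \<noteq> 0" unfolding W_def by auto
    have W: "open W"
    proof -
      have "continuous_on V H" using H[of 0] by simp
      then have "open (H -` (- {0}) \<inter> V)"
        using continuous_on_open_vimage[OF oV] by blast
      moreover have "H -` (- {0}) \<inter> V = W" unfolding W_def by auto
      ultimately show ?thesis by simp
    qed
    have "Ck_on k W (\<lambda>x. c (inv_into U \<phi> x))"
    proof (rule Ck_on_cong[OF W])
      show "Ck_on k W (\<lambda>x. s (inv_into U \<phi> x) * inverse (H x))"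
        by (rule Ck_on_mult[OF W Ck_on_mono[OF s WV] Ck_on_inverse[OF W nz Ck_on_mono[OF H WV]]])
      show "s (inv_into U \<phi> x) * inverse (H x) = c (inv_into U \<phi> x)" if "x \<in> W" for x
        using nz[OF that] unfolding H_def eq[symmetric] by simp
    qed
    then show "\<exists>W. open W \<and> x \<in> W \<and> Ck_on k (\<phi> ` U \<inter> W) (\<lambda>x. c (inv_into U \<phi> x))"
      using W x hx by (intro exI[of _ W]) (auto simp: W_def V_def H_def elim: Ck_on_mono)
  qed
  then show ?thesis by (rule smooth_funI)
qed

section \<open>Vector fields and tensors\<close>

definition vf_comb :: "nat \<Rightarrow> (nat \<Rightarrow> 'm \<Rightarrow> real) \<Rightarrow> (nat \<Rightarrow> 'm vfield) \<Rightarrow> 'm vfield" where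
  "vf_comb n c F = (\<lambda>f p. \<Sum>j<n. c j p * F j f p)"

text \<open>The zero field is written as a multiple of an arbitrary field X, so that the rules for
  sums and multiples also cover the start of an induction on n.\<close>

lemma vf_comb_0: "vf_comb 0 c F = vf_scale (\<lambda>p. 0) X"
  by (simp add: vf_comb_def vf_scale_def)

lemma vf_comb_Suc: "vf_comb (Suc n) c F = vf_add (vf_comb n c F) (vf_scale (c n) (F n))"
  by (simp add: vf_comb_def vf_scale_def vf_add_def)

lemma vf_scale_1 [simp]: "vf_scale (\<lambda>p. 1) X = X"
  by (simp add: vf_scale_def)

lemma vf_diff_conv: "vf_diff X Y = vf_add X (vf_scale (\<lambda>p. - 1) Y)"
  by (simp add: vf_diff_def vf_add_def vf_scale_def)

lemma field_lists_update:
  "Xs \<in> field_lists A k \<Longrightarrow> Y \<in> vector_fields A \<Longrightarrow> Xs[i := Y] \<in> field_lists A k"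
  using set_update_subset_insert[of Xs i Y] by (auto simp: field_lists_def)

lemma field_lists_nth: "Xs \<in> field_lists A k \<Longrightarrow> i < k \<Longrightarrow> Xs ! i \<in> vector_fields A"
  by (auto simp: field_lists_def)

lemma field_lists_length: "Xs \<in> field_lists A k \<Longrightarrow> length Xs = k"
  by (auto simp: field_lists_def)

lemma field_lists_Nil [simp]: "[] \<in> field_lists A k \<longleftrightarrow> k = 0"
  by (auto simp: field_lists_def)

lemma field_lists_Cons [simp]:
  "X # Xs \<in> field_lists A k \<longleftrightarrow> (\<exists>n. k = Suc n \<and> X \<in> vector_fields A \<and> Xs \<in> field_lists A n)"
  by (auto simp: field_lists_def)

locale smooth_manifold =
  fixes A :: "'m::{t2_space,second_countable_topology} chart set"
  assumes atlas: "smooth_atlas A"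
begin

abbreviation "VF \<equiv> vector_fields A"
abbreviation "tens k \<alpha> \<equiv> tensor_on A UNIV k \<alpha>"

lemmas smooth_add = smooth_fun_add[OF atlas] and smooth_mult = smooth_fun_mult[OF atlas]

lemma smooth_uminus: "smooth_fun A f \<Longrightarrow> smooth_fun A (\<lambda>p. - f p)"
  using smooth_mult[OF smooth_fun_const, of f "- 1"] by simp

lemma smooth_diff: "smooth_fun A f \<Longrightarrow> smooth_fun A h \<Longrightarrow> smooth_fun A (\<lambda>p. f p - h p)"
  using smooth_add[OF _ smooth_uminus, of f h] by simp

lemma smooth_sum: "(\<And>i. i \<in> I \<Longrightarrow> smooth_fun A (f i)) \<Longrightarrow> smooth_fun A (\<lambda>p. \<Sum>i\<in>I. f i p)"
  by (induction I rule: infinite_finite_induct) (auto intro: smooth_add)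

lemma smooth_prod: "(\<And>i. i \<in> I \<Longrightarrow> smooth_fun A (f i)) \<Longrightarrow> smooth_fun A (\<lambda>p. \<Prod>i\<in>I. f i p)"
  by (induction I rule: infinite_finite_induct) (auto intro: smooth_mult)

lemma vf_smooth: "X \<in> VF \<Longrightarrow> smooth_fun A f \<Longrightarrow> smooth_fun A (X f)"
  by (simp add: vector_fields_def)

lemma vf_lin: "X \<in> VF \<Longrightarrow> smooth_fun A f \<Longrightarrow> smooth_fun A h \<Longrightarrow>
    X (\<lambda>p. a * f p + b * h p) = (\<lambda>p. a * X f p + b * X h p)"
  by (simp add: vector_fields_def)

lemma vf_mult: "X \<in> VF \<Longrightarrow> smooth_fun A f \<Longrightarrow> smooth_fun A h \<Longrightarrow>
    X (\<lambda>p. f p * h p) = (\<lambda>p. f p * X h p + h p * X f p)"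
  by (simp add: vector_fields_def)

lemma vf_nonsmooth: "X \<in> VF \<Longrightarrow> \<not> smooth_fun A f \<Longrightarrow> X f = (\<lambda>p. 0)"
  by (simp add: vector_fields_def)

lemma vf_plus: "X \<in> VF \<Longrightarrow> smooth_fun A f \<Longrightarrow> smooth_fun A h \<Longrightarrow>
    X (\<lambda>p. f p + h p) = (\<lambda>p. X f p + X h p)"
  using vf_lin[of X f h 1 1] by simp

lemma vf_minus: "X \<in> VF \<Longrightarrow> smooth_fun A f \<Longrightarrow> smooth_fun A h \<Longrightarrow>
    X (\<lambda>p. f p - h p) = (\<lambda>p. X f p - X h p)"
  using vf_lin[of X f h 1 "- 1"] by simp

lemma vf_const: "X \<in> VF \<Longrightarrow> X (\<lambda>p. c) = (\<lambda>p. 0)"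
  using vf_lin[of X "\<lambda>p. 1" "\<lambda>p. 1" c 0] vf_mult[of X "\<lambda>p. 1" "\<lambda>p. 1"] by (auto simp: fun_eq_iff)

lemma vf_cmult: "X \<in> VF \<Longrightarrow> smooth_fun A f \<Longrightarrow> X (\<lambda>p. c * f p) = (\<lambda>p. c * X f p)"
  using vf_lin[of X f f c 0] by simp

lemma vf_uminus: "X \<in> VF \<Longrightarrow> smooth_fun A f \<Longrightarrow> X (\<lambda>p. - f p) = (\<lambda>p. - X f p)"
  using vf_cmult[of X f "- 1"] by simp

lemma vf_sum: "X \<in> VF \<Longrightarrow> (\<And>i. i \<in> I \<Longrightarrow> smooth_fun A (f i)) \<Longrightarrow>
    X (\<lambda>p. \<Sum>i\<in>I. f i p) = (\<lambda>p. \<Sum>i\<in>I. X (f i) p)"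
  by (induction I rule: infinite_finite_induct) (auto simp: vf_const vf_plus[where X = X] smooth_sum)

lemma vf_eqI: "X \<in> VF \<Longrightarrow> Y \<in> VF \<Longrightarrow> (\<And>f p. smooth_fun A f \<Longrightarrow> X f p = Y f p) \<Longrightarrow> X = Y"
  by (metis ext vf_nonsmooth)

lemma vf_add_in [simp]: "X \<in> VF \<Longrightarrow> Y \<in> VF \<Longrightarrow> vf_add X Y \<in> VF"
  unfolding vector_fields_def[of A] vf_add_def
  by (auto simp: algebra_simps smooth_add vf_smooth vf_lin vf_mult vf_nonsmooth)

lemma vf_scale_in [simp]: "X \<in> VF \<Longrightarrow> smooth_fun A h \<Longrightarrow> vf_scale h X \<in> VF"
  unfolding vector_fields_def[of A] vf_scale_def
  by (auto simp: algebra_simps smooth_mult vf_smooth vf_lin vf_mult vf_nonsmooth)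

lemma vf_diff_in [simp]: "X \<in> VF \<Longrightarrow> Y \<in> VF \<Longrightarrow> vf_diff X Y \<in> VF"
  by (simp add: vf_diff_conv)

lemma lie_bracket_in [simp]: assumes "X \<in> VF" "Y \<in> VF" shows "lie_bracket X Y \<in> VF"
  unfolding vector_fields_def[of A] lie_bracket_def using assms
  by (auto simp: smooth_diff vf_smooth vf_lin vf_mult vf_nonsmooth vf_plus[of X] vf_plus[of Y] vf_const
        vf_mult[of X] vf_mult[of Y] vf_lin[of X] vf_lin[of Y] smooth_mult)
    (auto simp: fun_eq_iff algebra_simps)

lemma vf_comb_in [simp]:
  "(\<And>j. j < n \<Longrightarrow> F j \<in> VF) \<Longrightarrow> (\<And>j. j < n \<Longrightarrow> smooth_fun A (c j)) \<Longrightarrow> X \<in> VF \<Longrightarrow> vf_comb n c F \<in> VF"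
  by (induction n) (auto simp: vf_comb_Suc vf_comb_0[where X = X])

lemma tens_smooth: "tens k \<alpha> \<Longrightarrow> Xs \<in> field_lists A k \<Longrightarrow> smooth_fun A (\<alpha> Xs)"
  by (simp add: tensor_on_def)

lemma tens_lin:
  "tens k \<alpha> \<Longrightarrow> Xs \<in> field_lists A k \<Longrightarrow> i < k \<Longrightarrow> Y \<in> VF \<Longrightarrow> Z \<in> VF \<Longrightarrow> smooth_fun A f \<Longrightarrow> smooth_fun A h \<Longrightarrow>
    \<alpha> (Xs[i := vf_add (vf_scale f Y) (vf_scale h Z)]) p = f p * \<alpha> (Xs[i := Y]) p + h p * \<alpha> (Xs[i := Z]) p"
  by (simp add: tensor_on_def)

lemma tens_add:
  "tens k \<alpha> \<Longrightarrow> Xs \<in> field_lists A k \<Longrightarrow> i < k \<Longrightarrow> Y \<in> VF \<Longrightarrow> Z \<in> VF \<Longrightarrow>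
    \<alpha> (Xs[i := vf_add Y Z]) p = \<alpha> (Xs[i := Y]) p + \<alpha> (Xs[i := Z]) p"
  using tens_lin[of k \<alpha> Xs i Y Z "\<lambda>p. 1" "\<lambda>p. 1"] by simp

lemma tens_scale:
  assumes "tens k \<alpha>" "Xs \<in> field_lists A k" "i < k" "Y \<in> VF" "smooth_fun A f"
  shows "\<alpha> (Xs[i := vf_scale f Y]) p = f p * \<alpha> (Xs[i := Y]) p"
proof -
  have "vf_add (vf_scale f Y) (vf_scale (\<lambda>p. 0) Y) = vf_scale f Y"
    by (simp add: vf_add_def vf_scale_def)
  then show ?thesis using tens_lin[of k \<alpha> Xs i Y Y f "\<lambda>p. 0" p] assms by simp
qed

lemma tens_diff:
  "tens k \<alpha> \<Longrightarrow> Xs \<in> field_lists A k \<Longrightarrow> i < k \<Longrightarrow> Y \<in> VF \<Longrightarrow> Z \<in> VF \<Longrightarrow>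
    \<alpha> (Xs[i := vf_diff Y Z]) p = \<alpha> (Xs[i := Y]) p - \<alpha> (Xs[i := Z]) p"
  unfolding vf_diff_conv by (simp add: tens_add tens_scale)

lemma tens_comb:
  assumes "tens k \<alpha>" "Xs \<in> field_lists A k" "i < k"
  shows "(\<And>j. j < n \<Longrightarrow> F j \<in> VF) \<Longrightarrow> (\<And>j. j < n \<Longrightarrow> smooth_fun A (c j)) \<Longrightarrow>
    \<alpha> (Xs[i := vf_comb n c F]) p = (\<Sum>j<n. c j p * \<alpha> (Xs[i := F j]) p)"
proof (induction n)
  case 0
  have "Xs ! i \<in> VF" using assms field_lists_nth by blast
  with tens_scale[OF assms this, of "\<lambda>p. 0" p] show ?case
    by (simp add: vf_comb_0[where X = "Xs ! i"])
next
  case (Suc n)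
  have "Xs ! i \<in> VF" using assms field_lists_nth by blast
  then have "vf_comb n c F \<in> VF" using Suc.prems by (intro vf_comb_in) auto
  then show ?case using Suc assms by (simp add: vf_comb_Suc tens_add tens_scale)
qed

end

subsection \<open>Adapted frames\<close>

text \<open>Since the dual frame is built from the values of global vector fields, no partition of unity
  is needed.\<close>

lemma dual_basis_exists:
  fixes l :: "nat \<Rightarrow> ('a \<Rightarrow> 'b \<Rightarrow> real) \<Rightarrow> real"
  assumes V: "\<And>X Y a b. X \<in> V \<Longrightarrow> Y \<in> V \<Longrightarrow> (\<lambda>f p. a * X f p + b * Y f p) \<in> V"
    and lin: "\<And>i X Y a b. i < n \<Longrightarrow> X \<in> V \<Longrightarrow> Y \<in> V \<Longrightarrow>
      l i (\<lambda>f p. a * X f p + b * Y f p) = a * l i X + b * l i Y"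
    and ind: "\<And>c. (\<And>X. X \<in> V \<Longrightarrow> (\<Sum>i<n. c i * l i X) = 0) \<Longrightarrow> \<forall>i<n. c i = 0"
  shows "\<exists>F. (\<forall>i<n. F i \<in> V) \<and> (\<forall>i<n. \<forall>j<n. l i (F j) = (if i = j then 1 else 0))"
  using lin ind
proof (induction n)
  case (Suc n)
  have "\<exists>F. (\<forall>i<n. F i \<in> V) \<and> (\<forall>i<n. \<forall>j<n. l i (F j) = (if i = j then 1 else 0))"
  proof (rule Suc.IH)
    fix c assume c: "\<And>X. X \<in> V \<Longrightarrow> (\<Sum>i<n. c i * l i X) = 0"
    have "\<forall>i<Suc n. (c(n := 0)) i = 0"
    proof (rule Suc.prems(2))
      fix X assume "X \<in> V"
      then show "(\<Sum>i<Suc n. (c(n := 0)) i * l i X) = 0"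
        using c[of X] by simp
    qed
    then show "\<forall>i<n. c i = 0" by (metis fun_upd_other less_SucI nat_neq_iff)
  qed (use Suc.prems(1) in auto)
  then obtain F where F: "\<And>i. i < n \<Longrightarrow> F i \<in> V"
    and lF: "\<And>i j. i < n \<Longrightarrow> j < n \<Longrightarrow> l i (F j) = (if i = j then 1 else 0)" by blast
  \<comment> \<open>Otherwise \<open>l n\<close> would be a combination of the earlier functionals,
    against their independence.\<close>
  have "\<exists>X\<in>V. l n X - (\<Sum>i<n. l n (F i) * l i X) \<noteq> 0"
  proof (rule ccontr)
    assume "\<not> ?thesis"
    then have *: "l n X - (\<Sum>i<n. l n (F i) * l i X) = 0" if "X \<in> V" for X using that by blast
    have "\<forall>i<Suc n. (\<lambda>i. if i = n then 1 else - l n (F i)) i = (0::real)"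
    proof (rule Suc.prems(2))
      fix X assume "X \<in> V"
      have "(\<Sum>i<n. (if i = n then 1 else - l n (F i)) * l i X) = (\<Sum>i<n. - (l n (F i) * l i X))"
        by (intro sum.cong) auto
      then show "(\<Sum>i<Suc n. (if i = n then 1 else - l n (F i)) * l i X) = 0"
        using *[OF \<open>X \<in> V\<close>] by (simp add: sum_negf)
    qed
    from this[rule_format, of n] show False by simp
  qed
  then obtain X where X: "X \<in> V" and nz: "l n X - (\<Sum>i<n. l n (F i) * l i X) \<noteq> 0" by blast
  note lin' = Suc.prems(1)
  \<comment> \<open>V is only closed under binary combinations, so membership in V and the values of
    the functionals are carried through the partial sums.\<close>
  have comb: "m \<le> n \<Longrightarrow> (\<lambda>f p. X f p - (\<Sum>i<m. l i X * F i f p)) \<in> V \<and>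
     (\<forall>k<Suc n. l k (\<lambda>f p. X f p - (\<Sum>i<m. l i X * F i f p)) = l k X - (\<Sum>i<m. l i X * l k (F i)))" for m
  proof (induction m)
    case 0
    then show ?case using X by simp
  next
    case (Suc m)
    let ?Z = "\<lambda>f p. X f p - (\<Sum>i<m. l i X * F i f p)"
    have eq: "(\<lambda>f p. X f p - (\<Sum>i<Suc m. l i X * F i f p)) = (\<lambda>f p. 1 * ?Z f p + (- l m X) * F m f p)"
      by (auto simp: fun_eq_iff)
    have Z: "?Z \<in> V" "F m \<in> V" using Suc F by auto
    have "l k (\<lambda>f p. 1 * ?Z f p + (- l m X) * F m f p) = l k X - (\<Sum>i<Suc m. l i X * l k (F i))"
      if "k < Suc n" for k
      using lin'[OF that Z, of 1 "- l m X"] Suc that by simp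
    then show ?case unfolding eq using V[OF Z, of 1 "- l m X"] by blast
  qed
  \<comment> \<open>Y is X minus its projection to the span of the fields found so far. It is killed
    by the first n functionals but not by \<open>l n\<close>.\<close>
  define Y where "Y = (\<lambda>f p. X f p - (\<Sum>i<n. l i X * F i f p))"
  have Y: "Y \<in> V" using comb[of n] Y_def by simp
  have lY: "l i Y = 0" if "i < n" for i
  proof -
    have "(\<Sum>j<n. l j X * l i (F j)) = (\<Sum>j<n. if j = i then l j X else 0)"
      using lF that by (intro sum.cong) auto
    then show ?thesis using comb[of n] that by (simp add: Y_def)
  qed
  define d where "d = l n Y"
  have d: "d \<noteq> 0"
    using comb[of n] nz by (simp add: Y_def d_def mult.commute)
  have scal: "(\<lambda>f p. a * X f p) \<in> V \<and> (\<forall>i<Suc n. l i (\<lambda>f p. a * X f p) = a * l i X)" if "X \<in> V" for X a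
    using V[OF that that, of a 0] Suc.prems(1)[OF _ that that, of _ a 0] by simp
  \<comment> \<open>Y is normalised against \<open>l n\<close>, and its multiples are subtracted
    from the old fields to make these vanish on \<open>l n\<close> as well.\<close>
  define G where "G j = (if j = n then (\<lambda>f p. inverse d * Y f p)
     else (\<lambda>f p. 1 * F j f p + (- l n (F j) * inverse d) * Y f p))" for j
  have "G j \<in> V" if "j < Suc n" for j
    using scal[OF Y, of "inverse d"] V[OF F Y, of j 1 "- l n (F j) * inverse d"] that by (auto simp: G_def)
  moreover have "l i (G j) = (if i = j then 1 else 0)" if "i < Suc n" "j < Suc n" for i j
  proof (cases "j = n")
    case True
    then have "l i (G j) = inverse d * l i Y" using scal[OF Y] that by (simp add: G_def)
    then show ?thesis using True lY d that by (auto simp: d_def less_Suc_eq)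
  next
    case False
    then have j: "j < n" using that by simp
    have "l i (G j) = l i (F j) + (- l n (F j) * inverse d) * l i Y"
      using False Suc.prems(1)[OF that(1) F[OF j] Y, of 1 "- l n (F j) * inverse d"] by (simp add: G_def)
    then show ?thesis using lY lF[OF _ j] d that j by (cases "i = n") (auto simp: d_def[symmetric])
  qed
  ultimately show ?case by (intro exI[of _ G]) auto
qed simp

text \<open>If y were nonzero, then y and the eight v i would be nine nonzero pairwise orthogonal
  vectors in an 8-dimensional space. The bijection b transfers indices below 8 to the index type of
  \<open>real^8\<close>.\<close>

lemma orthogonal_complete_8:
  fixes v :: "nat \<Rightarrow> nat \<Rightarrow> real" and y :: "nat \<Rightarrow> real"
  assumes orth: "\<And>i j. i < 8 \<Longrightarrow> j < 8 \<Longrightarrow> i \<noteq> j \<Longrightarrow> (\<Sum>k<8. v i k * v j k) = 0"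
    and nz: "\<And>i. i < 8 \<Longrightarrow> (\<Sum>k<8. v i k * v i k) \<noteq> 0"
    and y: "\<And>i. i < 8 \<Longrightarrow> (\<Sum>k<8. y k * v i k) = 0"
  shows "(\<Sum>k<8. y k * y k) = 0"
proof (rule ccontr)
  assume ny: "(\<Sum>k<8. y k * y k) \<noteq> 0"
  obtain b :: "8 \<Rightarrow> nat" where b: "bij_betw b UNIV {..<8}"
    using finite_same_card_bij[of "UNIV :: 8 set" "{..<8::nat}"] by auto
  define w where "w i = (if i < 8 then v i else y)" for i
  define V :: "nat \<Rightarrow> real^8" where "V i = (\<chi> a. w i (b a))" for i
  have ip: "V i \<bullet> V j = (\<Sum>k<8. w i k * w j k)" for i j
    unfolding V_def inner_vec_def using sum.reindex_bij_betw[OF b, of "\<lambda>k. w i k * w j k"] by simp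
  have o: "V i \<bullet> V j = 0" if "i < 9" "j < 9" "i \<noteq> j" for i j
  proof -
    have "i < 8 \<and> j < 8 \<or> i = 8 \<and> j < 8 \<or> i < 8 \<and> j = 8" using that by auto
    then show ?thesis
      using that orth[of i j] y[of i] y[of j] by (auto simp: ip w_def mult.commute)
  qed
  have n: "V i \<bullet> V i \<noteq> 0" if "i < 9" for i
    using that nz[of i] ny by (cases "i < 8") (auto simp: ip w_def)
  have inj: "inj_on V {..<9}"
    by (rule inj_onI) (metis lessThan_iff n o)
  have "pairwise orthogonal (V ` {..<9})"
    unfolding pairwise_def orthogonal_def using o by auto
  moreover have "0 \<notin> V ` {..<9}" using n by fastforce
  ultimately have "independent (V ` {..<9})" by (rule pairwise_orthogonal_independent)
  then have "card (V ` {..<9}) \<le> DIM(real^8)" using independent_bound by blast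
  then show False using inj by (simp add: card_image)
qed

section \<open>The induced metric and orthogonal families of global fields\<close>

locale spin7_torsion = smooth_manifold A
  for A :: "'m::{t2_space,second_countable_topology} chart set" +
  fixes \<Psi> g :: "'m tensor" and D :: "'m vfield \<Rightarrow> 'm vfield \<Rightarrow> 'm vfield"
  assumes spin7: "spin7_structure A \<Psi>"
    and metric: "induced_metric A \<Psi> g"
    and connection: "torsion_connection A \<Psi> g D"
begin

lemma g_tens: "tens 2 g"
  using metric by (simp add: induced_metric_def riemannian_metric_def)

lemma g_sym: "X \<in> VF \<Longrightarrow> Y \<in> VF \<Longrightarrow> g [X, Y] = g [Y, X]"
  using metric by (simp add: induced_metric_def riemannian_metric_def)

lemma g_smooth [simp]: "X \<in> VF \<Longrightarrow> Y \<in> VF \<Longrightarrow> smooth_fun A (g [X, Y])"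
  by (rule tens_smooth[OF g_tens]) (simp add: numeral_2_eq_2)

lemma g_add:
  assumes "X \<in> VF" "Y \<in> VF" "Z \<in> VF"
  shows "g [vf_add X Y, Z] p = g [X, Z] p + g [Y, Z] p"
    and "g [Z, vf_add X Y] p = g [Z, X] p + g [Z, Y] p"
  using tens_add[OF g_tens, of "[X, Z]" 0 X Y p] tens_add[OF g_tens, of "[Z, X]" 1 X Y p] assms
  by (simp_all add: numeral_2_eq_2)

lemma g_diff:
  assumes "X \<in> VF" "Y \<in> VF" "Z \<in> VF"
  shows "g [vf_diff X Y, Z] p = g [X, Z] p - g [Y, Z] p"
    and "g [Z, vf_diff X Y] p = g [Z, X] p - g [Z, Y] p"
  using tens_diff[OF g_tens, of "[X, Z]" 0 X Y p] tens_diff[OF g_tens, of "[Z, X]" 1 X Y p] assms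
  by (simp_all add: numeral_2_eq_2)

lemma g_scale:
  assumes "X \<in> VF" "smooth_fun A f" "Z \<in> VF"
  shows "g [vf_scale f X, Z] p = f p * g [X, Z] p"
    and "g [Z, vf_scale f X] p = f p * g [Z, X] p"
  using tens_scale[OF g_tens, of "[X, Z]" 0 X f p] tens_scale[OF g_tens, of "[Z, X]" 1 X f p] assms
  by (simp_all add: numeral_2_eq_2)

lemma g_comb:
  assumes "\<And>j. j < n \<Longrightarrow> F j \<in> VF" "\<And>j. j < n \<Longrightarrow> smooth_fun A (c j)" "Z \<in> VF"
  shows "g [vf_comb n c F, Z] p = (\<Sum>j<n. c j p * g [F j, Z] p)"
  using tens_comb[OF g_tens, of "[Z, Z]" 0 n F c p] assms by (simp add: numeral_2_eq_2)

text \<open>The coframe e is adapted on a neighbourhood of p, but the global fields F are dual to it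
  at p alone.\<close>

definition adapted :: "'m \<Rightarrow> (nat \<Rightarrow> 'm tensor) \<Rightarrow> 'm vfield list \<Rightarrow> bool" where
  "adapted p e F \<longleftrightarrow> (\<exists>U. p \<in> U \<and> spin7_coframe A \<Psi> U e) \<and> F \<in> field_lists A 8 \<and>
     (\<forall>i<8. \<forall>j<8. e i [F ! j] p = (if i = j then 1 else 0))"

lemma adapted_exists: "\<exists>e F. adapted p e F"
proof -
  obtain U e where p: "p \<in> U" and U: "spin7_coframe A \<Psi> U e"
    using spin7 unfolding spin7_structure_def by blast
  then have co: "local_coframe A U e" by (simp add: spin7_coframe_def)
  have lin: "e i [\<lambda>f p. a * X f p + b * Y f p] p = a * e i [X] p + b * e i [Y] p"
    if "i < 8" "X \<in> VF" "Y \<in> VF" for i X Y a b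
  proof -
    have "tensor_on A U 1 (e i)" using co that by (simp add: local_coframe_def form_on_def)
    then have "\<forall>p\<in>U. e i ([X][0 := vf_add (vf_scale (\<lambda>p. a) X) (vf_scale (\<lambda>p. b) Y)]) p
       = a * e i ([X][0 := X]) p + b * e i ([X][0 := Y]) p"
      unfolding tensor_on_def using that
      by (elim conjE bspec[of "field_lists A 1" _ "[X]", elim_format]) auto
    then show ?thesis using p by (simp add: vf_add_def vf_scale_def)
  qed
  have V: "(\<lambda>f p. a * X f p + b * Y f p) \<in> VF" if "X \<in> VF" "Y \<in> VF" for X Y a b
    using vf_add_in[OF vf_scale_in[of X "\<lambda>p. a"] vf_scale_in[of Y "\<lambda>p. b"]] that
    by (simp add: vf_add_def vf_scale_def)
  have "\<exists>F. (\<forall>i<8. F i \<in> VF) \<and> (\<forall>i<8. \<forall>j<8. e i [F j] p = (if i = j then 1 else 0))"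
  proof (rule dual_basis_exists[of VF 8 "\<lambda>i X. e i [X] p"])
    show "\<forall>i<8. c i = 0" if "\<And>X. X \<in> VF \<Longrightarrow> (\<Sum>i<8. c i * e i [X] p) = 0" for c :: "nat \<Rightarrow> real"
      using co p that unfolding local_coframe_def by blast
  qed (use V lin in auto)
  then obtain F where F: "\<And>i. i < 8 \<Longrightarrow> F i \<in> VF"
    "\<And>i j. i < 8 \<Longrightarrow> j < 8 \<Longrightarrow> e i [F j] p = (if i = j then 1 else 0)" by blast
  have "adapted p e (map F [0..<8])"
    unfolding adapted_def using p U F by (auto simp: field_lists_def simp del: upt_rec_numeral)
  then show ?thesis by blast
qed

lemma adapted_g:
  assumes "adapted p e F" "X \<in> VF" "Y \<in> VF"
  shows "g [X, Y] p = (\<Sum>i<8. e i [X] p * e i [Y] p)"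
  using assms metric unfolding adapted_def induced_metric_def by blast

lemma adapted_orthonormal:
  assumes "adapted p e F" shows "orthonormal_at A g p F"
proof -
  have "g [F ! i, F ! j] p = (if i = j then 1 else 0)" if "i < 8" "j < 8" for i j
  proof -
    have F: "F ! i \<in> VF" "F ! j \<in> VF" and d: "\<And>k l. k < 8 \<Longrightarrow> l < 8 \<Longrightarrow> e k [F ! l] p = (if k = l then 1 else 0)"
      using assms that unfolding adapted_def by (auto intro: field_lists_nth)
    have "g [F ! i, F ! j] p = (\<Sum>k<8. if k = i then (if k = j then 1 else 0) else 0)"
      unfolding adapted_g[OF assms F] using d that by (intro sum.cong) auto
    then show ?thesis using that by simp
  qed
  then show ?thesis using assms unfolding adapted_def orthonormal_at_def by blast
qed

lemma g_nonneg: "X \<in> VF \<Longrightarrow> g [X, X] p \<ge> 0"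
  using adapted_exists[of p] adapted_g by (metis (no_types, lifting) sum_nonneg zero_le_square)

lemma g_null: assumes "X \<in> VF" "Y \<in> VF" "g [X, X] p = 0" shows "g [X, Y] p = 0"
proof -
  obtain e F where a: "adapted p e F" using adapted_exists by blast
  have "\<forall>i\<in>{..<8}. e i [X] p * e i [X] p = 0"
    using assms(3) unfolding adapted_g[OF a assms(1,1)] by (subst (asm) sum_nonneg_eq_0_iff) auto
  then show ?thesis unfolding adapted_g[OF a assms(1,2)] by (auto intro: sum.neutral)
qed

lemma vf_null: assumes "X \<in> VF" "g [X, X] p = 0" shows "X f p = 0"
proof (cases "smooth_fun A f")
  case True
  have "vf_zero_at A X p"
    using metric assms unfolding induced_metric_def riemannian_metric_def by (metis less_irrefl)
  with True show ?thesis by (simp add: vf_zero_at_def)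
qed (use assms vf_nonsmooth in simp)

lemma g_complete:
  fixes F :: "nat \<Rightarrow> 'm vfield"
  assumes "\<And>i. i < 8 \<Longrightarrow> F i \<in> VF" "\<And>i j. i < 8 \<Longrightarrow> j < 8 \<Longrightarrow> i \<noteq> j \<Longrightarrow> g [F i, F j] p = 0"
    and "\<And>i. i < 8 \<Longrightarrow> g [F i, F i] p \<noteq> 0"
    and "Y \<in> VF" "\<And>i. i < 8 \<Longrightarrow> g [Y, F i] p = 0"
  shows "g [Y, Y] p = 0"
proof -
  obtain e E where a: "adapted p e E" using adapted_exists by blast
  show ?thesis
    using orthogonal_complete_8[of "\<lambda>i k. e k [F i] p" "\<lambda>k. e k [Y] p"] assms
    by (simp add: adapted_g[OF a])
qed

text \<open>Orthogonal on the whole manifold, but not normalised and possibly with zeros: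
  normalising would divide by lengths that vanish somewhere.\<close>

definition ofr :: "(nat \<Rightarrow> 'm vfield) \<Rightarrow> bool" where
  "ofr F \<longleftrightarrow> (\<forall>i<8. F i \<in> VF) \<and> (\<forall>i<8. \<forall>j<8. i \<noteq> j \<longrightarrow> g [F i, F j] = (\<lambda>p. 0))"

text \<open>The division-free substitute for \<open>vol2 F\<close> divided by the squared length of
  F j; being polynomial in the metric coefficients, it is smooth also at the zeros of F j.\<close>

definition wt :: "(nat \<Rightarrow> 'm vfield) \<Rightarrow> nat \<Rightarrow> 'm \<Rightarrow> real" where
  "wt F j = (\<lambda>p. \<Prod>i\<in>{..<8} - {j}. g [F i, F i] p)"

definition vol2 :: "(nat \<Rightarrow> 'm vfield) \<Rightarrow> 'm \<Rightarrow> real" where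
  "vol2 F = (\<lambda>p. \<Prod>i<8. g [F i, F i] p)"

lemma vol2_wt: "j < 8 \<Longrightarrow> vol2 F p = g [F j, F j] p * wt F j p"
  unfolding vol2_def wt_def by (rule prod.remove) auto

lemma ofr_in: "ofr F \<Longrightarrow> i < 8 \<Longrightarrow> F i \<in> VF" by (simp add: ofr_def)

lemma ofr_smooth: "ofr F \<Longrightarrow> smooth_fun A (wt F j)" "ofr F \<Longrightarrow> smooth_fun A (vol2 F)"
  unfolding wt_def vol2_def by (auto intro!: smooth_prod simp: ofr_in)

text \<open>The division-free Gram-Schmidt process keeps the fields globally defined.\<close>

lemma gram_schmidt:
  assumes E: "orthonormal_at A g p E"
  shows "\<exists>F. ofr F \<and> (\<forall>i<8. \<forall>X\<in>VF. g [F i, X] p = g [E ! i, X] p)"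
proof -
  have EV: "E ! i \<in> VF" if "i < 8" for i
    using E that by (auto simp: orthonormal_at_def intro: field_lists_nth)
  have Ed: "g [E ! i, E ! j] p = (if i = j then 1 else 0)" if "i < 8" "j < 8" for i j
    using E that by (auto simp: orthonormal_at_def)
  \<comment> \<open>Equality of tangent vectors at p is expressed by pairing with every field. The
    extension of the vectors to fields is free otherwise.\<close>
  define P where "P n F \<longleftrightarrow> (\<forall>i<n. F i \<in> VF) \<and> (\<forall>i<n. \<forall>j<n. i \<noteq> j \<longrightarrow> g [F i, F j] = (\<lambda>p. 0)) \<and>
      (\<forall>i<n. \<forall>X\<in>VF. g [F i, X] p = g [E ! i, X] p)" for n and F :: "nat \<Rightarrow> 'm vfield"
  have main: "n \<le> 8 \<Longrightarrow> \<exists>F. P n F" for n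
  proof (induction n)
    case (Suc n)
    from Suc.prems have "n \<le> 8" by simp
    from Suc.IH[OF this] obtain F where PF: "P n F" ..
    then have F: "F i \<in> VF" if "i < n" for i using that unfolding P_def by simp
    have o: "g [F i, F j] = (\<lambda>p. 0)" if "i < n" "j < n" "i \<noteq> j" for i j
      using PF that unfolding P_def by simp
    have Fp: "g [F i, X] p = g [E ! i, X] p" if "i < n" "X \<in> VF" for i X
      using PF that unfolding P_def by simp
    have En: "E ! n \<in> VF" using EV Suc.prems by simp
    \<comment> \<open>The usual Gram-Schmidt formula multiplied by the product h of the squared
      lengths, which clears its denominators.\<close>
    define h where "h = (\<lambda>q. \<Prod>i<n. g [F i, F i] q)"
    define c where "c = (\<lambda>j q. (\<Prod>i\<in>{..<n} - {j}. g [F i, F i] q) * g [E ! n, F j] q)"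
    define G where "G = vf_diff (vf_scale h (E ! n)) (vf_comb n c F)"
    have sm: "smooth_fun A h" "j < n \<Longrightarrow> smooth_fun A (c j)" for j
      unfolding h_def c_def using F En by (auto intro!: smooth_prod smooth_mult)
    have cV: "vf_comb n c F \<in> VF" using F sm En by (intro vf_comb_in) auto
    have GV: "G \<in> VF" unfolding G_def using cV En sm by simp
    have gG: "g [G, X] q = h q * g [E ! n, X] q - (\<Sum>j<n. c j q * g [F j, X] q)" if "X \<in> VF" for X q
      unfolding G_def using F sm En cV that by (simp add: g_diff g_scale g_comb)
    have GF: "g [G, F k] = (\<lambda>q. 0)" if k: "k < n" for k
    proof
      fix q
      have "(\<Sum>j<n. c j q * g [F j, F k] q) = (\<Sum>j<n. if j = k then c j q * g [F j, F k] q else 0)"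
        using o k by (intro sum.cong) auto
      also have "\<dots> = c k q * g [F k, F k] q" using k by simp
      also have "\<dots> = h q * g [E ! n, F k] q"
        unfolding c_def h_def using prod.remove[of "{..<n}" k "\<lambda>i. g [F i, F i] q"] k by simp
      finally show "g [G, F k] q = 0" using gG[OF F[OF k]] by simp
    qed
    \<comment> \<open>At p the given vectors are already orthonormal, so there h = 1 and all c j =
      0, and the new field has the value of \<open>E ! n\<close>.\<close>
    have hp: "h p = 1" unfolding h_def
    proof (rule prod.neutral, rule ballI)
      fix i assume "i \<in> {..<n}"
      then have i: "i < n" "i < 8" using Suc.prems by auto
      have "g [F i, F i] p = g [F i, E ! i] p" using Fp[OF i(1) F[OF i(1)]] g_sym F EV i by auto
      then show "g [F i, F i] p = 1" using Fp[OF i(1) EV[OF i(2)]] Ed i by simp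
    qed
    have cp: "c j p = 0" if "j < n" for j
    proof -
      have "g [E ! n, F j] p = g [F j, E ! n] p" using g_sym[OF En F] that by simp
      also have "\<dots> = 0" using Fp[OF that En] Ed that Suc.prems by simp
      finally show ?thesis by (simp add: c_def)
    qed
    have Gp: "g [G, X] p = g [E ! n, X] p" if "X \<in> VF" for X
      using gG[OF that, of p] hp cp by simp
    have FG: "g [F k, G] = (\<lambda>q. 0)" if k: "k < n" for k
      using GF[OF k] g_sym[OF F[OF k] GV] by simp
    have "P (Suc n) (F(n := G))"
      unfolding P_def using F o Fp GV GF FG Gp by (simp add: less_Suc_eq all_conj_distrib imp_conjL)
    then show ?case by (rule exI[of "P (Suc n)"])
  next
    case 0
    have "P 0 (\<lambda>i. E ! i)" by (simp add: P_def)
    then show ?case by (rule exI[of "P 0"])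
  qed
  from main[of 8] obtain F where "P 8 F" by auto
  then show ?thesis unfolding P_def
    by (intro exI[of _ F]) (simp add: ofr_def)
qed

text \<open>The orthogonal expansion of X with denominators cleared. Where some F k vanishes both
  sides are zero: each weight \<open>wt F j\<close> with j other than k contains the squared length
  of F k, and the pairing with F k itself vanishes. The identity thus holds between global fields,
  the only objects a functional L can be applied to.\<close>

lemma ofr_expand:
  assumes F: "ofr F" and X: "X \<in> VF"
  shows "vf_scale (vol2 F) X = vf_comb 8 (\<lambda>j q. wt F j q * g [X, F j] q) F"
proof -
  let ?c = "\<lambda>j q. wt F j q * g [X, F j] q"
  have FV: "j < 8 \<Longrightarrow> F j \<in> VF" for j using ofr_in[OF F] .
  have c: "j < 8 \<Longrightarrow> smooth_fun A (?c j)" for j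
    using ofr_smooth[OF F] X by (intro smooth_mult) (auto simp: FV)
  let ?Y = "vf_diff (vf_scale (vol2 F) X) (vf_comb 8 ?c F)"
  have C: "vf_comb 8 ?c F \<in> VF" using c FV X by (intro vf_comb_in) auto
  have Y: "?Y \<in> VF" using C X ofr_smooth[OF F] by simp
  have gY: "g [?Y, Z] q = vol2 F q * g [X, Z] q - (\<Sum>j<8. ?c j q * g [F j, Z] q)" if "Z \<in> VF" for Z q
    using that X C FV c ofr_smooth[OF F] by (simp add: g_diff g_scale g_comb)
  have "g [?Y, ?Y] q = 0" for q
  proof (cases "\<exists>k<8. g [F k, F k] q = 0")
    case True
    then obtain k where k: "k < 8" "g [F k, F k] q = 0" by blast
    have "?c j q = 0" if "j < 8" for j
    proof (cases "j = k")
      case True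
      have "g [F k, X] q = 0" using g_null[OF FV[OF k(1)] X k(2)] .
      then show ?thesis using True g_sym[OF X FV[OF k(1)]] by simp
    next
      case False
      then have "wt F j q = 0" unfolding wt_def using k by (intro prod_zero) auto
      then show ?thesis by simp
    qed
    moreover have "vol2 F q = 0" using vol2_wt[OF k(1)] k(2) by simp
    ultimately show ?thesis unfolding gY[OF Y] by (simp add: sum.neutral)
  next
    case False
    show ?thesis
    proof (rule g_complete[OF FV _ _ Y])
      fix k :: nat assume k: "k < 8"
      have "(\<Sum>j<8. ?c j q * g [F j, F k] q) = (\<Sum>j<8. if j = k then ?c j q * g [F j, F k] q else 0)"
        using F k by (intro sum.cong) (auto simp: ofr_def)
      also have "\<dots> = vol2 F q * g [X, F k] q" using k by (simp add: vol2_wt[OF k])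
      finally show "g [?Y, F k] q = 0" using gY[OF FV[OF k]] by simp
    qed (use F False in \<open>auto simp: ofr_def\<close>)
  qed
  then have "?Y f q = 0" for f q using vf_null[OF Y] by blast
  then show ?thesis by (auto simp: vf_diff_def fun_eq_iff)
qed

text \<open>Multiplied by \<open>vol2 F\<close>, a vector field is a global combination of the fields of \<open>F\<close>; this gives the
  pointwise dependence on \<open>X\<close> without bump functions.\<close>

lemma expand_functional:
  assumes E: "orthonormal_at A g p E" and X: "X \<in> VF"
    and add: "\<And>X Y. X \<in> VF \<Longrightarrow> Y \<in> VF \<Longrightarrow> L (vf_add X Y) = L X + (L Y :: real)"
    and scale: "\<And>f X. X \<in> VF \<Longrightarrow> smooth_fun A f \<Longrightarrow> L (vf_scale f X) = f p * L X"
  shows "L X = (\<Sum>j<8. g [X, E ! j] p * L (E ! j))"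
proof -
  have EV: "E ! i \<in> VF" if "i < 8" for i
    using E that by (auto simp: orthonormal_at_def intro: field_lists_nth)
  have Ed: "g [E ! i, E ! j] p = (if i = j then 1 else 0)" if "i < 8" "j < 8" for i j
    using E that by (auto simp: orthonormal_at_def)
  obtain F where F: "ofr F" and Fp: "\<And>i X. i < 8 \<Longrightarrow> X \<in> VF \<Longrightarrow> g [F i, X] p = g [E ! i, X] p"
    using gram_schmidt[OF E] by blast
  have FV: "j < 8 \<Longrightarrow> F j \<in> VF" for j using ofr_in[OF F] .
  have gFF: "g [F i, F i] p = 1" if i: "i < 8" for i
    using Fp[OF i FV[OF i]] g_sym[OF EV[OF i] FV[OF i]] Fp[OF i EV[OF i]] Ed[OF i i] by simp
  have comb: "L (vf_comb n c F) = (\<Sum>j<n. c j p * L (F j))"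
    if "n \<le> 8" "\<And>j. j < n \<Longrightarrow> smooth_fun A (c j)" for n c
    using that
  proof (induction n)
    case 0
    show ?case using scale[OF X, of "\<lambda>p. 0"] by (simp add: vf_comb_0[where X = X])
  next
    case (Suc n)
    have "vf_comb n c F \<in> VF" using Suc FV X by (intro vf_comb_in) auto
    then show ?case using Suc FV by (simp add: vf_comb_Suc add scale)
  qed
  have w: "wt F j p = 1" for j unfolding wt_def by (rule prod.neutral) (auto simp: gFF)
  have v: "vol2 F p = 1" unfolding vol2_def by (rule prod.neutral) (auto simp: gFF)
  have ex: "L X = (\<Sum>j<8. g [X, F j] p * L (F j))" if X: "X \<in> VF" for X
  proof -
    have "L X = L (vf_scale (vol2 F) X)" using scale[OF X] ofr_smooth[OF F] v by simp
    also have "\<dots> = (\<Sum>j<8. g [X, F j] p * L (F j))"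
      unfolding ofr_expand[OF F X] using ofr_smooth[OF F] X FV
      by (subst comb) (auto simp: w intro!: smooth_mult)
    finally show ?thesis .
  qed
  \<comment> \<open>F j and \<open>E ! j\<close> have the same pairings at p, and by the expansion
    just proved L depends on these pairings only.\<close>
  have "L (E ! j) = L (F j)" if j: "j < 8" for j
  proof -
    have "g [E ! j, F k] p = (if k = j then 1 else 0)" if k: "k < 8" for k
      using g_sym[OF EV[OF j] FV[OF k]] Fp[OF k EV[OF j]] Ed[OF k j] by simp
    then have "L (E ! j) = (\<Sum>k<8. (if k = j then 1 else 0) * L (F k))"
      unfolding ex[OF EV[OF j]] by (intro sum.cong) auto
    also have "\<dots> = (\<Sum>k<8. if k = j then L (F k) else 0)" by (intro sum.cong) auto
    finally show ?thesis using j by simp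
  qed
  moreover have "g [X, F j] p = g [X, E ! j] p" if "j < 8" for j
    using g_sym[OF X FV[OF that]] g_sym[OF X EV[OF that]] Fp[OF that X] by simp
  ultimately show ?thesis unfolding ex[OF X] by (intro sum.cong) auto
qed

lemma orthonormal_in: "orthonormal_at A g p E \<Longrightarrow> i < 8 \<Longrightarrow> E ! i \<in> VF"
  by (auto simp: orthonormal_at_def intro: field_lists_nth)

lemma orthonormal_g: "orthonormal_at A g p E \<Longrightarrow> i < 8 \<Longrightarrow> j < 8 \<Longrightarrow>
    g [E ! i, E ! j] p = (if i = j then 1 else 0)"
  by (auto simp: orthonormal_at_def)

lemma tens_expand:
  assumes "orthonormal_at A g p E" "tens k \<alpha>" "Xs \<in> field_lists A k" "i < k"
  shows "\<alpha> Xs p = (\<Sum>j<8. g [Xs ! i, E ! j] p * \<alpha> (Xs[i := E ! j]) p)"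
  using expand_functional[OF assms(1), of "Xs ! i" "\<lambda>X. \<alpha> (Xs[i := X]) p"] assms(2-)
  by (auto simp: field_lists_nth tens_add tens_scale)

lemma orthonormal_choice: "orthonormal_at A g p (orthonormal_choice A g p)"
  unfolding orthonormal_choice_def using adapted_exists[of p] adapted_orthonormal by (metis someI)

lemma g_expand:
  assumes "orthonormal_at A g p E" "X \<in> VF" "Y \<in> VF"
  shows "g [X, Y] p = (\<Sum>j<8. g [X, E ! j] p * g [Y, E ! j] p)"
proof -
  have "g [X, Y] p = (\<Sum>j<8. g [X, E ! j] p * g [E ! j, Y] p)"
    using tens_expand[OF assms(1) g_tens, of "[X, Y]" 0] assms by (simp add: numeral_2_eq_2)
  also have "\<dots> = (\<Sum>j<8. g [X, E ! j] p * g [Y, E ! j] p)"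
    using g_sym[OF assms(3)] orthonormal_in[OF assms(1)] by (intro sum.cong) auto
  finally show ?thesis .
qed

text \<open>Expanding both slots in the frame F leaves the sum over i of g(E_i,F_j) g(E_i,F_k),
  which is g(F_j,F_k) because E is orthonormal.\<close>

lemma trace_frame_indep:
  assumes E: "orthonormal_at A g p E" and F: "orthonormal_at A g p F"
    and add1: "\<And>X Y Z. X \<in> VF \<Longrightarrow> Y \<in> VF \<Longrightarrow> Z \<in> VF \<Longrightarrow> B (vf_add X Y) Z = B X Z + (B Y Z :: real)"
    and add2: "\<And>X Y Z. X \<in> VF \<Longrightarrow> Y \<in> VF \<Longrightarrow> Z \<in> VF \<Longrightarrow> B Z (vf_add X Y) = B Z X + B Z Y"
    and sc1: "\<And>X Z f. X \<in> VF \<Longrightarrow> Z \<in> VF \<Longrightarrow> smooth_fun A f \<Longrightarrow> B (vf_scale f X) Z = f p * B X Z"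
    and sc2: "\<And>X Z f. X \<in> VF \<Longrightarrow> Z \<in> VF \<Longrightarrow> smooth_fun A f \<Longrightarrow> B Z (vf_scale f X) = f p * B Z X"
  shows "(\<Sum>i<8. B (E ! i) (E ! i)) = (\<Sum>i<8. B (F ! i) (F ! i))"
proof -
  note V = orthonormal_in[OF E] orthonormal_in[OF F]
  have "(\<Sum>i<8. B (E ! i) (E ! i))
      = (\<Sum>i<8. \<Sum>j<8. \<Sum>k<8. g [E ! i, F ! j] p * g [E ! i, F ! k] p * B (F ! j) (F ! k))"
  proof (rule sum.cong[OF refl])
    fix i :: nat assume "i \<in> {..<8}"
    then have i: "E ! i \<in> VF" using V by simp
    have "B (E ! i) (E ! i) = (\<Sum>j<8. g [E ! i, F ! j] p * B (F ! j) (E ! i))"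
      by (rule expand_functional[OF F i]) (auto simp: add1 sc1 i)
    also have "\<dots> = (\<Sum>j<8. g [E ! i, F ! j] p * (\<Sum>k<8. g [E ! i, F ! k] p * B (F ! j) (F ! k)))"
    proof (rule sum.cong[OF refl])
      fix j :: nat assume "j \<in> {..<8}"
      then have j: "F ! j \<in> VF" using V by simp
      have "B (F ! j) (E ! i) = (\<Sum>k<8. g [E ! i, F ! k] p * B (F ! j) (F ! k))"
        by (rule expand_functional[OF F i]) (auto simp: add2 sc2 j)
      then show "g [E ! i, F ! j] p * B (F ! j) (E ! i)
        = g [E ! i, F ! j] p * (\<Sum>k<8. g [E ! i, F ! k] p * B (F ! j) (F ! k))" by simp
    qed
    finally show "B (E ! i) (E ! i)
      = (\<Sum>j<8. \<Sum>k<8. g [E ! i, F ! j] p * g [E ! i, F ! k] p * B (F ! j) (F ! k))"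
      by (simp add: sum_distrib_left mult.assoc)
  qed
  also have "\<dots> = (\<Sum>j<8. \<Sum>k<8. \<Sum>i<8. g [E ! i, F ! j] p * g [E ! i, F ! k] p * B (F ! j) (F ! k))"
    by (subst sum.swap, rule sum.cong[OF refl], subst sum.swap, rule refl)
  also have "\<dots> = (\<Sum>j<8. \<Sum>k<8. g [F ! j, F ! k] p * B (F ! j) (F ! k))"
  proof (intro sum.cong refl)
    fix j k :: nat assume "j \<in> {..<8}" "k \<in> {..<8}"
    then have jk: "F ! j \<in> VF" "F ! k \<in> VF" using V(2) by auto
    have "g [F ! j, F ! k] p = (\<Sum>i<8. g [E ! i, F ! j] p * g [E ! i, F ! k] p)"
      unfolding g_expand[OF E jk] using g_sym[OF jk(1) V(1)] g_sym[OF jk(2) V(1)]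
      by (intro sum.cong refl) (simp only: lessThan_iff)
    then show "(\<Sum>i<8. g [E ! i, F ! j] p * g [E ! i, F ! k] p * B (F ! j) (F ! k))
      = g [F ! j, F ! k] p * B (F ! j) (F ! k)"
      by (simp only: sum_distrib_right)
  qed
  also have "\<dots> = (\<Sum>j<8. \<Sum>k<8. if k = j then B (F ! j) (F ! k) else 0)"
    using orthonormal_g[OF F] by (intro sum.cong) auto
  finally show ?thesis by simp
qed

end

section \<open>Operations on tensor fields\<close>

lemma sum_lessThan_add: "(\<Sum>i<k + l. f i) = (\<Sum>i<k. f i) + (\<Sum>i<l. f (k + i :: nat) :: 'a::comm_monoid_add)"
  by (induction l) (simp_all add: add.assoc)

definition tprod :: "nat \<Rightarrow> 'm tensor \<Rightarrow> 'm tensor \<Rightarrow> 'm tensor" where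
  "tprod k \<alpha> \<beta> = (\<lambda>Xs p. \<alpha> (take k Xs) p * \<beta> (drop k Xs) p)"

definition reslot :: "nat list \<Rightarrow> 'm tensor \<Rightarrow> 'm tensor" where
  "reslot \<pi> \<alpha> = (\<lambda>Xs. \<alpha> (map ((!) Xs) \<pi>))"

definition tlin :: "real \<Rightarrow> 'm tensor \<Rightarrow> real \<Rightarrow> 'm tensor \<Rightarrow> 'm tensor" where
  "tlin a \<alpha> b \<beta> = (\<lambda>Xs p. a * \<alpha> Xs p + b * \<beta> Xs p)"

context smooth_manifold
begin

lemma tensI:
  assumes "\<And>Xs. Xs \<in> field_lists A k \<Longrightarrow> smooth_fun A (\<alpha> Xs)"
    and "\<And>Xs i Y Z f h p. Xs \<in> field_lists A k \<Longrightarrow> i < k \<Longrightarrow> Y \<in> VF \<Longrightarrow> Z \<in> VF \<Longrightarrow>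
      smooth_fun A f \<Longrightarrow> smooth_fun A h \<Longrightarrow>
      \<alpha> (Xs[i := vf_add (vf_scale f Y) (vf_scale h Z)]) p = f p * \<alpha> (Xs[i := Y]) p + h p * \<alpha> (Xs[i := Z]) p"
  shows "tens k \<alpha>"
  using assms unfolding tensor_on_def by simp

lemma tens_tlin: "tens k \<alpha> \<Longrightarrow> tens k \<beta> \<Longrightarrow> tens k (tlin a \<alpha> b \<beta>)"
  unfolding tlin_def
  by (rule tensI) (simp_all add: tens_smooth tens_lin smooth_add smooth_mult algebra_simps)

lemma cov_tlin:
  assumes "X \<in> VF" "tens k \<alpha>" "tens k \<beta>" "Xs \<in> field_lists A k"
  shows "cov_deriv D X (tlin a \<alpha> b \<beta>) Xs p = a * cov_deriv D X \<alpha> Xs p + b * cov_deriv D X \<beta> Xs p"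
  using vf_lin[OF assms(1) tens_smooth[OF assms(2,4)] tens_smooth[OF assms(3,4)], of a b]
  unfolding cov_deriv_def tlin_def by (simp add: sum.distrib sum_distrib_left algebra_simps)

lemma tens_tprod:
  assumes \<alpha>: "tens k \<alpha>" and \<beta>: "tens l \<beta>"
  shows "tens (k + l) (tprod k \<alpha> \<beta>)"
proof (rule tensI)
  fix Xs assume "Xs \<in> field_lists A (k + l)"
  then have Xs: "take k Xs \<in> field_lists A k" "drop k Xs \<in> field_lists A l"
    unfolding field_lists_def using set_take_subset set_drop_subset by fastforce+
  show "smooth_fun A (tprod k \<alpha> \<beta> Xs)"
    unfolding tprod_def by (rule smooth_mult[OF tens_smooth[OF \<alpha> Xs(1)] tens_smooth[OF \<beta> Xs(2)]])
  fix i Y Z f h p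
  assume i: "i < k + l" and YZ: "Y \<in> VF" "Z \<in> VF" "smooth_fun A f" "smooth_fun A h"
  show "tprod k \<alpha> \<beta> (Xs[i := vf_add (vf_scale f Y) (vf_scale h Z)]) p
      = f p * tprod k \<alpha> \<beta> (Xs[i := Y]) p + h p * tprod k \<alpha> \<beta> (Xs[i := Z]) p"
  proof (cases "i < k")
    case True
    then show ?thesis
      by (simp add: tprod_def take_update_swap drop_update_cancel tens_lin[OF \<alpha> Xs(1) _ YZ] algebra_simps)
  next
    case False
    then have "i - k < l" using i by simp
    from False this show ?thesis
      by (simp add: tprod_def drop_update_swap take_update_cancel tens_lin[OF \<beta> Xs(2) _ YZ] algebra_simps)
  qed
qed

lemma cov_tprod:
  assumes X: "X \<in> VF" and \<alpha>: "tens k \<alpha>" and \<beta>: "tens l \<beta>" and XsF: "Xs \<in> field_lists A (k + l)"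
  shows "cov_deriv D X (tprod k \<alpha> \<beta>) Xs p =
    cov_deriv D X \<alpha> (take k Xs) p * \<beta> (drop k Xs) p + \<alpha> (take k Xs) p * cov_deriv D X \<beta> (drop k Xs) p"
proof -
  have Xs: "take k Xs \<in> field_lists A k" "drop k Xs \<in> field_lists A l" and len: "length Xs = k + l"
    using XsF unfolding field_lists_def using set_take_subset set_drop_subset by fastforce+
  have "(\<Sum>i<k + l. tprod k \<alpha> \<beta> (Xs[i := D X (Xs ! i)]) p) =
     (\<Sum>i<k. \<alpha> ((take k Xs)[i := D X (take k Xs ! i)]) p) * \<beta> (drop k Xs) p
     + \<alpha> (take k Xs) p * (\<Sum>i<l. \<beta> ((drop k Xs)[i := D X (drop k Xs ! i)]) p)"
    unfolding sum_lessThan_add sum_distrib_right sum_distrib_left using len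
    by (intro arg_cong2[of _ _ _ _ "(+)"] sum.cong)
      (auto simp: tprod_def take_update_swap drop_update_swap drop_update_cancel take_update_cancel list_update_beyond)
  moreover have "tprod k \<alpha> \<beta> Xs = (\<lambda>p. \<alpha> (take k Xs) p * \<beta> (drop k Xs) p)"
    by (simp add: tprod_def)
  moreover have "length (take k Xs) = k" "length (drop k Xs) = l" using len by simp_all
  ultimately show ?thesis
    using vf_mult[OF X tens_smooth[OF \<alpha> Xs(1)] tens_smooth[OF \<beta> Xs(2)]]
    unfolding cov_deriv_def len by (simp only:) (simp only: algebra_simps)
qed

lemma reslot_update:
  assumes "distinct \<pi>" "set \<pi> = {..<k}" "j < k" "length Xs = k"
  shows "map ((!) (Xs[\<pi> ! j := Y])) \<pi> = (map ((!) Xs) \<pi>)[j := Y]"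
proof -
  have len: "length \<pi> = k" using assms(2) distinct_card[OF assms(1)] by simp
  have lt: "\<pi> ! i < length Xs" if "i < k" for i
    using nth_mem[of i \<pi>] assms(2,4) len that by simp
  show ?thesis
  proof (rule nth_equalityI)
    fix i assume "i < length (map ((!) (Xs[\<pi> ! j := Y])) \<pi>)"
    then have i: "i < k" using len by simp
    have "\<pi> ! j = \<pi> ! i \<longleftrightarrow> j = i"
      using nth_eq_iff_index_eq[OF assms(1), of j i] i assms(3) len by simp
    then show "map ((!) (Xs[\<pi> ! j := Y])) \<pi> ! i = (map ((!) Xs) \<pi>)[j := Y] ! i"
      using i assms(3) len lt[OF assms(3)] by (simp add: nth_list_update)
  qed simp
qed

lemma reslot_index:
  assumes "distinct \<pi>" "set \<pi> = {..<k}"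
  shows "bij_betw ((!) \<pi>) {..<k} {..<k}"
  by (rule bij_betw_nth[OF assms(1)]) (use assms(2) distinct_card[OF assms(1)] in simp_all)

lemma reslot_in:
  "set \<pi> = {..<k} \<Longrightarrow> distinct \<pi> \<Longrightarrow> Xs \<in> field_lists A k \<Longrightarrow> map ((!) Xs) \<pi> \<in> field_lists A k"
  using distinct_card[of \<pi>] by (auto simp: field_lists_def)

lemma tens_reslot:
  assumes \<alpha>: "tens k \<alpha>" and \<pi>: "distinct \<pi>" "set \<pi> = {..<k}"
  shows "tens k (reslot \<pi> \<alpha>)"
proof (rule tensI)
  fix Xs assume Xs: "Xs \<in> field_lists A k"
  then show "smooth_fun A (reslot \<pi> \<alpha> Xs)"
    unfolding reslot_def using tens_smooth[OF \<alpha>] reslot_in \<pi> by blast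
  fix i Y Z f h p
  assume "i < k" and YZ: "Y \<in> VF" "Z \<in> VF" "smooth_fun A f" "smooth_fun A h"
  then obtain j where j: "j < k" "i = \<pi> ! j"
    using reslot_index[OF \<pi>] unfolding bij_betw_def by blast
  show "reslot \<pi> \<alpha> (Xs[i := vf_add (vf_scale f Y) (vf_scale h Z)]) p
      = f p * reslot \<pi> \<alpha> (Xs[i := Y]) p + h p * reslot \<pi> \<alpha> (Xs[i := Z]) p"
    unfolding reslot_def j(2) reslot_update[OF \<pi> j(1) field_lists_length[OF Xs]]
    by (rule tens_lin[OF \<alpha> reslot_in[OF \<pi>(2,1) Xs] j(1) YZ])
qed

text \<open>The correction terms of \<open>cov_deriv\<close> run over all slots, so a permutation of
  the slots only reindexes their sum.\<close>

lemma cov_reslot: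
  assumes \<pi>: "distinct \<pi>" "set \<pi> = {..<k}" and Xs: "Xs \<in> field_lists A k"
  shows "cov_deriv D X (reslot \<pi> \<alpha>) Xs p = cov_deriv D X \<alpha> (map ((!) Xs) \<pi>) p"
proof -
  have len: "length Xs = k" "length \<pi> = k"
    using field_lists_length[OF Xs] \<pi>(2) distinct_card[OF \<pi>(1)] by simp_all
  have "(\<Sum>i<k. reslot \<pi> \<alpha> (Xs[i := D X (Xs ! i)]) p)
      = (\<Sum>j<k. reslot \<pi> \<alpha> (Xs[\<pi> ! j := D X (Xs ! (\<pi> ! j))]) p)"
    by (rule sum.reindex_bij_betw[OF reslot_index[OF \<pi>], symmetric])
  also have "\<dots> = (\<Sum>j<k. \<alpha> ((map ((!) Xs) \<pi>)[j := D X (map ((!) Xs) \<pi> ! j)]) p)"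
  proof (rule sum.cong[OF refl])
    fix j assume "j \<in> {..<k}"
    then have j: "j < k" by simp
    show "reslot \<pi> \<alpha> (Xs[\<pi> ! j := D X (Xs ! (\<pi> ! j))]) p
        = \<alpha> ((map ((!) Xs) \<pi>)[j := D X (map ((!) Xs) \<pi> ! j)]) p"
      unfolding reslot_def reslot_update[OF \<pi> j len(1)] using j len(2) by simp
  qed
  finally show ?thesis unfolding cov_deriv_def length_map len by (simp only: reslot_def)
qed

text \<open>At a point where all factors are 1 the Leibniz rule loses its coefficients. It serves to
  differentiate \<open>vol2\<close> and \<open>wt\<close> at the point where the orthogonal frame is
  orthonormal.\<close>

lemma vf_prod_unit:
  assumes "X \<in> VF" "finite I" "\<And>i. i \<in> I \<Longrightarrow> smooth_fun A (f i)" "\<And>i. i \<in> I \<Longrightarrow> f i p = 1"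
  shows "X (\<lambda>q. \<Prod>i\<in>I. f i q) p = (\<Sum>i\<in>I. X (f i) p)"
  using assms(2-)
proof (induction I)
  case empty
  then show ?case using vf_const[OF assms(1)] by simp
next
  case (insert i I)
  have "X (\<lambda>q. f i q * (\<Prod>i\<in>I. f i q)) = (\<lambda>q. f i q * X (\<lambda>q. \<Prod>i\<in>I. f i q) q + (\<Prod>i\<in>I. f i q) * X (f i) q)"
    using insert by (intro vf_mult[OF assms(1)] smooth_prod) auto
  moreover have "(\<Prod>i\<in>I. f i p) = 1" using insert by (intro prod.neutral) auto
  ultimately show ?case using insert by simp
qed

end

section \<open>Covariant differentiation of tensor fields\<close>

context spin7_torsion
begin

lemma D_in [simp]: "X \<in> VF \<Longrightarrow> Y \<in> VF \<Longrightarrow> D X Y \<in> VF"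
  using connection by (simp add: torsion_connection_def linear_connection_def)

lemma D_add:
  assumes "X \<in> VF" "Y \<in> VF" "Z \<in> VF"
  shows "D (vf_add X Y) Z = vf_add (D X Z) (D Y Z)" "D X (vf_add Y Z) = vf_add (D X Y) (D X Z)"
  using connection assms by (simp_all add: torsion_connection_def linear_connection_def)

lemma D_scale:
  assumes "X \<in> VF" "Y \<in> VF" "smooth_fun A f"
  shows "D (vf_scale f X) Y = vf_scale f (D X Y)"
    "D X (vf_scale f Y) = vf_add (vf_scale (X f) Y) (vf_scale f (D X Y))"
  using connection assms by (simp_all add: torsion_connection_def linear_connection_def)

lemma D_diff:
  assumes "X \<in> VF" "Y \<in> VF" "Z \<in> VF"
  shows "D (vf_diff X Y) Z = vf_diff (D X Z) (D Y Z)" "D X (vf_diff Y Z) = vf_diff (D X Y) (D X Z)"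
  using assms
  by (simp_all add: vf_diff_conv D_add D_scale vf_const)
    (simp add: vf_add_def vf_scale_def)

lemma g_parallel:
  assumes "X \<in> VF" "Y \<in> VF" "Z \<in> VF"
  shows "X (g [Y, Z]) = (\<lambda>p. g [D X Y, Z] p + g [Y, D X Z] p)"
proof -
  have "cov_deriv D X g [Y, Z] = (\<lambda>p. 0)"
    using connection assms by (auto simp: torsion_connection_def parallel_def tensor_eq_def numeral_2_eq_2)
  then show ?thesis by (simp add: cov_deriv_def fun_eq_iff numeral_2_eq_2)
qed

text \<open>Linearity over functions is not termwise: the terms with X f and X h from
  differentiating the value cancel those from the derivation rule of D in slot i.\<close>

lemma tens_cov:
  assumes X: "X \<in> VF" and \<alpha>: "tens k \<alpha>"
  shows "tens k (cov_deriv D X \<alpha>)"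
proof (rule tensI)
  fix Xs assume Xs: "Xs \<in> field_lists A k"
  have XV: "i < k \<Longrightarrow> Xs ! i \<in> VF" for i using field_lists_nth[OF Xs] .
  have len: "length Xs = k" using field_lists_length[OF Xs] .
  show "smooth_fun A (cov_deriv D X \<alpha> Xs)"
    unfolding cov_deriv_def len
  proof (rule smooth_diff[OF vf_smooth[OF X tens_smooth[OF \<alpha> Xs]] smooth_sum])
    fix i assume "i \<in> {..<k}"
    then show "smooth_fun A (\<lambda>p. \<alpha> (Xs[i := D X (Xs ! i)]) p)"
      using tens_smooth[OF \<alpha> field_lists_update[OF Xs D_in[OF X XV]]] by simp
  qed
  fix i Y Z f h p
  assume i: "i < k" and YZ: "Y \<in> VF" "Z \<in> VF" and fh: "smooth_fun A f" "smooth_fun A h"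
  let ?W = "vf_add (vf_scale f Y) (vf_scale h Z)"
  have W: "?W \<in> VF" using YZ fh by simp
  \<comment> \<open>S collects the correction terms of the slots other than i. In these V is not
    differentiated, so S is already linear over functions.\<close>
  define S where "S V = (\<Sum>j\<in>{..<k} - {i}. \<alpha> (Xs[i := V, j := D X (Xs ! j)]) p)" for V
  have cov: "cov_deriv D X \<alpha> (Xs[i := V]) p = X (\<alpha> (Xs[i := V])) p - \<alpha> (Xs[i := D X V]) p - S V" for V
  proof -
    have "(\<Sum>j<k. \<alpha> ((Xs[i := V])[j := D X (Xs[i := V] ! j)]) p)
        = \<alpha> ((Xs[i := V])[i := D X (Xs[i := V] ! i)]) p
          + (\<Sum>j\<in>{..<k} - {i}. \<alpha> ((Xs[i := V])[j := D X (Xs[i := V] ! j)]) p)"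
      using i by (intro sum.remove) auto
    also have "(\<Sum>j\<in>{..<k} - {i}. \<alpha> ((Xs[i := V])[j := D X (Xs[i := V] ! j)]) p) = S V"
      unfolding S_def by (intro sum.cong) auto
    finally show ?thesis unfolding cov_deriv_def using i len by simp
  qed
  have S: "S ?W = f p * S Y + h p * S Z"
    unfolding S_def sum_distrib_left sum.distrib[symmetric]
  proof (rule sum.cong[OF refl])
    fix j assume j: "j \<in> {..<k} - {i}"
    then have sw: "Xs[i := V, j := D X (Xs ! j)] = Xs[j := D X (Xs ! j), i := V]" for V
      by (intro list_update_swap) auto
    show "\<alpha> (Xs[i := ?W, j := D X (Xs ! j)]) p =
      f p * \<alpha> (Xs[i := Y, j := D X (Xs ! j)]) p + h p * \<alpha> (Xs[i := Z, j := D X (Xs ! j)]) p"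
      unfolding sw using j X XV by (intro tens_lin[OF \<alpha> field_lists_update[OF Xs] i YZ fh]) auto
  qed
  have "\<alpha> (Xs[i := ?W]) = (\<lambda>p. f p * \<alpha> (Xs[i := Y]) p + h p * \<alpha> (Xs[i := Z]) p)"
    using tens_lin[OF \<alpha> Xs i YZ fh] by auto
  moreover have sm: "smooth_fun A (\<alpha> (Xs[i := V]))" if "V \<in> VF" for V
    using tens_smooth[OF \<alpha> field_lists_update[OF Xs that]] .
  ultimately have dX: "X (\<alpha> (Xs[i := ?W])) p = f p * X (\<alpha> (Xs[i := Y])) p + X f p * \<alpha> (Xs[i := Y]) p
      + h p * X (\<alpha> (Xs[i := Z])) p + X h p * \<alpha> (Xs[i := Z]) p"
    using YZ fh by (simp add: vf_plus[OF X] smooth_mult vf_mult[OF X] algebra_simps)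
  have "D X ?W = vf_add (vf_add (vf_scale (X f) Y) (vf_scale f (D X Y))) (vf_add (vf_scale (X h) Z) (vf_scale h (D X Z)))"
    using X YZ fh by (simp add: D_add D_scale)
  then have DW: "\<alpha> (Xs[i := D X ?W]) p = X f p * \<alpha> (Xs[i := Y]) p + f p * \<alpha> (Xs[i := D X Y]) p
      + X h p * \<alpha> (Xs[i := Z]) p + h p * \<alpha> (Xs[i := D X Z]) p"
    using X YZ fh by (simp add: tens_add[OF \<alpha> Xs i] tens_scale[OF \<alpha> Xs i] vf_smooth)
  show "cov_deriv D X \<alpha> (Xs[i := ?W]) p =
      f p * cov_deriv D X \<alpha> (Xs[i := Y]) p + h p * cov_deriv D X \<alpha> (Xs[i := Z]) p"
    unfolding cov dX DW S by (simp add: algebra_simps)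
qed

subsection \<open>Metric contraction\<close>

text \<open>Contraction of the two leading slots with the inverse metric; \<open>ctr_eq\<close>
  removes the dependence on the chosen frame.\<close>

definition ctr :: "'m tensor \<Rightarrow> 'm tensor" where
  "ctr \<alpha> = (\<lambda>Ys p. let E = orthonormal_choice A g p in \<Sum>i<8. \<alpha> (E ! i # E ! i # Ys) p)"

lemma ctr_eq:
  assumes E: "orthonormal_at A g p E" and \<alpha>: "tens (Suc (Suc k)) \<alpha>" and Ys: "Ys \<in> field_lists A k"
  shows "ctr \<alpha> Ys p = (\<Sum>i<8. \<alpha> (E ! i # E ! i # Ys) p)"
proof -
  have in_l: "X # Y # Ys \<in> field_lists A (Suc (Suc k))" if "X \<in> VF" "Y \<in> VF" for X Y using Ys that by simp
  show ?thesis unfolding ctr_def Let_def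
  proof (rule trace_frame_indep[OF orthonormal_choice E, of "\<lambda>X Y. \<alpha> (X # Y # Ys) p"])
    fix X Y Z assume V: "X \<in> VF" "Y \<in> VF" "Z \<in> VF"
    show "\<alpha> (vf_add X Y # Z # Ys) p = \<alpha> (X # Z # Ys) p + \<alpha> (Y # Z # Ys) p"
      using tens_add[OF \<alpha> in_l[OF V(1,3)], of 0 X Y p] V by simp
    show "\<alpha> (Z # vf_add X Y # Ys) p = \<alpha> (Z # X # Ys) p + \<alpha> (Z # Y # Ys) p"
      using tens_add[OF \<alpha> in_l[OF V(3,1)], of 1 X Y p] V by simp
  next
    fix X Z f assume V: "X \<in> VF" "Z \<in> VF" "smooth_fun A f"
    show "\<alpha> (vf_scale f X # Z # Ys) p = f p * \<alpha> (X # Z # Ys) p"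
      using tens_scale[OF \<alpha> in_l[OF V(1,2)], of 0 X f p] V by simp
    show "\<alpha> (Z # vf_scale f X # Ys) p = f p * \<alpha> (Z # X # Ys) p"
      using tens_scale[OF \<alpha> in_l[OF V(2,1)], of 1 X f p] V by simp
  qed
qed

lemma tens_null:
  assumes \<alpha>: "tens k \<alpha>" and Xs: "Xs \<in> field_lists A k" and i: "i < k" and n: "g [Xs ! i, Xs ! i] p = 0"
  shows "\<alpha> Xs p = 0"
  using tens_expand[OF orthonormal_choice \<alpha> Xs i, of p] orthonormal_in[OF orthonormal_choice]
    g_null[OF field_lists_nth[OF Xs i] _ n] by simp

text \<open>The bridge from the pointwise definition of \<open>ctr\<close> to smooth global
  expressions. Where no F i vanishes, normalising F turns the trace into this weighted sum;
  elsewhere both sides are zero, as in \<open>ofr_expand\<close>.\<close>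

lemma ctr_weighted:
  assumes F: "ofr F" and \<alpha>: "tens (Suc (Suc k)) \<alpha>" and Ys: "Ys \<in> field_lists A k"
  shows "vol2 F q * ctr \<alpha> Ys q = (\<Sum>i<8. wt F i q * \<alpha> (F i # F i # Ys) q)"
proof (cases "\<exists>m<8. g [F m, F m] q = 0")
  case True
  then obtain m where m: "m < 8" "g [F m, F m] q = 0" by blast
  have "wt F i q * \<alpha> (F i # F i # Ys) q = 0" if i: "i < 8" for i
  proof (cases "i = m")
    case True
    then show ?thesis using tens_null[OF \<alpha>, of "F i # F i # Ys" 0 q] ofr_in[OF F i] Ys m by simp
  next
    case False
    then have "wt F i q = 0" unfolding wt_def using m by (intro prod_zero) auto
    then show ?thesis by simp
  qed
  then have "(\<Sum>i<8. wt F i q * \<alpha> (F i # F i # Ys) q) = 0" by (intro sum.neutral) auto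
  moreover have "vol2 F q = 0" using vol2_wt[OF m(1)] m(2) by simp
  ultimately show ?thesis by simp
next
  case False
  \<comment> \<open>A real number, the inverse length at the single point q, so the root need not be
    smooth and \<open>E\<close> consists of constant multiples of global fields.\<close>
  define r where "r i = 1 / sqrt (g [F i, F i] q)" for i
  have r: "r i * r i * g [F i, F i] q = 1" if "i < 8" for i
    using False that g_nonneg[OF ofr_in[OF F that], of q] by (simp add: r_def)
  define E where "E = map (\<lambda>i. vf_scale (\<lambda>p. r i) (F i)) [0..<8]"
  have Ei: "E ! i = vf_scale (\<lambda>p. r i) (F i)" if "i < 8" for i
    using that by (simp add: E_def del: upt_rec_numeral)
  have "orthonormal_at A g q E"
    unfolding orthonormal_at_def
  proof (intro conjI allI impI)
    show "E \<in> field_lists A 8"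
      unfolding field_lists_def E_def using ofr_in[OF F] by (auto simp del: upt_rec_numeral)
    fix i j :: nat assume ij: "i < 8" "j < 8"
    then show "g [E ! i, E ! j] q = (if i = j then 1 else 0)"
      using F r[of i] ofr_in[OF F ij(1)] ofr_in[OF F ij(2)] by (auto simp: Ei g_scale ofr_def)
  qed
  then have "vol2 F q * ctr \<alpha> Ys q = (\<Sum>i<8. vol2 F q * \<alpha> (E ! i # E ! i # Ys) q)"
    by (simp add: ctr_eq[OF _ \<alpha> Ys] sum_distrib_left)
  also have "\<dots> = (\<Sum>i<8. wt F i q * \<alpha> (F i # F i # Ys) q)"
  proof (rule sum.cong[OF refl])
    fix i :: nat assume "i \<in> {..<8}"
    then have i: "i < 8" and Fi: "F i \<in> VF" using ofr_in[OF F] by auto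
    have "\<alpha> (vf_scale (\<lambda>p. r i) (F i) # vf_scale (\<lambda>p. r i) (F i) # Ys) q
        = r i * \<alpha> (F i # vf_scale (\<lambda>p. r i) (F i) # Ys) q"
      using tens_scale[OF \<alpha>, of "F i # vf_scale (\<lambda>p. r i) (F i) # Ys" 0 "F i" "\<lambda>p. r i" q] Fi Ys by simp
    also have "\<alpha> (F i # vf_scale (\<lambda>p. r i) (F i) # Ys) q = r i * \<alpha> (F i # F i # Ys) q"
      using tens_scale[OF \<alpha>, of "F i # F i # Ys" 1 "F i" "\<lambda>p. r i" q] Fi Ys by simp
    finally have "vol2 F q * \<alpha> (E ! i # E ! i # Ys) q
      = (r i * r i * g [F i, F i] q) * wt F i q * \<alpha> (F i # F i # Ys) q"
      unfolding Ei[OF i] vol2_wt[OF i] by simp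
    then show "vol2 F q * \<alpha> (E ! i # E ! i # Ys) q = wt F i q * \<alpha> (F i # F i # Ys) q"
      unfolding r[OF i] by simp
  qed
  finally show ?thesis .
qed

lemma ofr_at:
  assumes "orthonormal_at A g p E" "ofr F" "\<And>i X. i < 8 \<Longrightarrow> X \<in> VF \<Longrightarrow> g [F i, X] p = g [E ! i, X] p"
    and "i < 8" "j < 8"
  shows "g [F i, F j] p = (if i = j then 1 else 0)"
proof -
  have V: "F j \<in> VF" "E ! i \<in> VF" using assms ofr_in orthonormal_in by blast+
  have "g [F i, F j] p = g [F j, E ! i] p" using assms(3)[OF assms(4) V(1)] g_sym[OF V(2) V(1)] by simp
  also have "\<dots> = (if i = j then 1 else 0)"
    using assms(3)[OF assms(5) V(2)] orthonormal_g[OF assms(1,5,4)] by simp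
  finally show ?thesis .
qed

lemma unit_weights:
  assumes "\<And>i. i < 8 \<Longrightarrow> g [F i, F i] p = 1"
  shows "wt F j p = 1" "vol2 F p = 1"
  unfolding wt_def vol2_def using assms by (auto intro: prod.neutral)

lemma tens_ctr:
  assumes \<alpha>: "tens (Suc (Suc k)) \<alpha>"
  shows "tens k (ctr \<alpha>)"
proof (rule tensI)
  fix Xs assume Xs: "Xs \<in> field_lists A k"
  show "smooth_fun A (ctr \<alpha> Xs)"
  proof (rule smooth_fun_quotient[OF atlas])
    fix p
    obtain F where F: "ofr F" "\<And>i X. i < 8 \<Longrightarrow> X \<in> VF \<Longrightarrow> g [F i, X] p = g [orthonormal_choice A g p ! i, X] p"
      using gram_schmidt[OF orthonormal_choice, of p] by blast
    have "vol2 F p = 1" using ofr_at[OF orthonormal_choice F] by (intro unit_weights) simp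
    moreover have "smooth_fun A (\<lambda>q. \<Sum>i<8. wt F i q * \<alpha> (F i # F i # Xs) q)"
      using ofr_in[OF F(1)] Xs ofr_smooth[OF F(1)]
      by (intro smooth_sum smooth_mult tens_smooth[OF \<alpha>]) auto
    ultimately show "\<exists>h s. smooth_fun A h \<and> smooth_fun A s \<and> h p \<noteq> 0 \<and> (\<forall>q. h q * ctr \<alpha> Xs q = s q)"
      using ctr_weighted[OF F(1) \<alpha> Xs] ofr_smooth(2)[OF F(1)]
      by (intro exI[of _ "vol2 F"] exI[of _ "\<lambda>q. \<Sum>i<8. wt F i q * \<alpha> (F i # F i # Xs) q"]) auto
  qed
  fix i Y Z f h p
  assume i: "i < k" and YZ: "Y \<in> VF" "Z \<in> VF" "smooth_fun A f" "smooth_fun A h"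
  have "\<alpha> (E # E # Xs[i := vf_add (vf_scale f Y) (vf_scale h Z)]) p
      = f p * \<alpha> (E # E # Xs[i := Y]) p + h p * \<alpha> (E # E # Xs[i := Z]) p" if "E \<in> VF" for E
    using tens_lin[OF \<alpha>, of "E # E # Xs" "Suc (Suc i)"] i Xs YZ that by simp
  then show "ctr \<alpha> (Xs[i := vf_add (vf_scale f Y) (vf_scale h Z)]) p
      = f p * ctr \<alpha> (Xs[i := Y]) p + h p * ctr \<alpha> (Xs[i := Z]) p"
    using orthonormal_in[OF orthonormal_choice, of _ p]
    by (simp add: ctr_def Let_def sum.distrib sum_distrib_left)
qed

lemma cov_Cons2:
  "cov_deriv D X \<alpha> (Y # Z # Ys) p = X (\<alpha> (Y # Z # Ys)) p - \<alpha> (D X Y # Z # Ys) p - \<alpha> (Y # D X Z # Ys) p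
     - (\<Sum>i<length Ys. \<alpha> (Y # Z # Ys[i := D X (Ys ! i)]) p)"
  unfolding cov_deriv_def by (simp add: sum.lessThan_Suc_shift del: sum.lessThan_Suc)

text \<open>Compatibility of D with g, seen through a global orthogonal frame F that is orthonormal
  at p. Differentiating \<open>ctr_weighted\<close> at p gives the derivatives of
  \<alpha>(F_i,F_i,...) minus l_i \<alpha>(F_i,F_i,...), where l_i is the derivative of the squared
  length of F_i. That correction is exactly the contribution of \<open>D X (F i)\<close> in the two
  contracted slots.\<close>

lemma cov_ctr:
  assumes X: "X \<in> VF" and \<alpha>: "tens (Suc (Suc k)) \<alpha>" and Ys: "Ys \<in> field_lists A k"
  shows "cov_deriv D X (ctr \<alpha>) Ys p = ctr (cov_deriv D X \<alpha>) Ys p"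
proof -
  obtain F where F: "ofr F" and Fp: "\<And>i X. i < 8 \<Longrightarrow> X \<in> VF \<Longrightarrow> g [F i, X] p = g [orthonormal_choice A g p ! i, X] p"
    using gram_schmidt[OF orthonormal_choice, of p] by blast
  have FV: "F i \<in> VF" if "i < 8" for i using ofr_in[OF F that] .
  have Fd: "g [F i, F j] p = (if i = j then 1 else 0)" if "i < 8" "j < 8" for i j
    using ofr_at[OF orthonormal_choice F Fp that] .
  have len: "length Ys = k" using field_lists_length[OF Ys] .
  define E where "E = map F [0..<8]"
  have EF: "E ! i = F i" if "i < 8" for i using that by (simp add: E_def del: upt_rec_numeral)
  have E: "orthonormal_at A g p E"
    using FV Fd EF unfolding orthonormal_at_def E_def field_lists_def by (auto simp del: upt_rec_numeral)
  have c: "ctr \<beta> Zs p = (\<Sum>i<8. \<beta> (F i # F i # Zs) p)"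
    if "tens (Suc (Suc k)) \<beta>" "Zs \<in> field_lists A k" for \<beta> Zs
    unfolding ctr_eq[OF E that] by (intro sum.cong) (auto simp: EF)
  define u where "u i j = \<alpha> (F i # F j # Ys) p" for i j
  define l where "l i = X (g [F i, F i]) p" for i
  have in_l: "F i # F j # Ys \<in> field_lists A (Suc (Suc k))" if "i < 8" "j < 8" for i j
    using FV that Ys by simp
  have sm: "smooth_fun A (\<alpha> (F i # F j # Ys))" if "i < 8" "j < 8" for i j
    using tens_smooth[OF \<alpha> in_l[OF that]] .
  have unit: "wt F j p = 1" "vol2 F p = 1" for j using Fd by (intro unit_weights; simp)+
  have Xvol: "X (vol2 F) p = (\<Sum>i<8. l i)"
    unfolding vol2_def l_def using X FV Fd by (intro vf_prod_unit) auto
  have Xwt: "X (wt F i) p = (\<Sum>i<8. l i) - l i" if "i < 8" for i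
  proof -
    have "X (wt F i) p = (\<Sum>i\<in>{..<8} - {i}. l i)"
      unfolding wt_def l_def using X FV Fd by (intro vf_prod_unit) auto
    then show ?thesis using sum.remove[of "{..<8}" i l] that by simp
  qed
  have "X (\<lambda>q. vol2 F q * ctr \<alpha> Ys q) p = X (vol2 F) p * ctr \<alpha> Ys p + X (ctr \<alpha> Ys) p"
    using vf_mult[OF X ofr_smooth(2)[OF F] tens_smooth[OF tens_ctr[OF \<alpha>] Ys]] unit by (simp add: algebra_simps)
  moreover have "X (\<lambda>q. vol2 F q * ctr \<alpha> Ys q) p
     = (\<Sum>i<8. X (wt F i) p * u i i + X (\<alpha> (F i # F i # Ys)) p)"
  proof -
    have "X (\<lambda>q. vol2 F q * ctr \<alpha> Ys q) p = (\<Sum>i<8. X (\<lambda>q. wt F i q * \<alpha> (F i # F i # Ys) q) p)"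
      unfolding ctr_weighted[OF F \<alpha> Ys]
      by (subst vf_sum[OF X]) (auto intro!: smooth_mult sm ofr_smooth(1)[OF F])
    also have "\<dots> = (\<Sum>i<8. X (wt F i) p * u i i + X (\<alpha> (F i # F i # Ys)) p)"
    proof (rule sum.cong[OF refl])
      fix i :: nat assume "i \<in> {..<8}"
      then show "X (\<lambda>q. wt F i q * \<alpha> (F i # F i # Ys) q) p = X (wt F i) p * u i i + X (\<alpha> (F i # F i # Ys)) p"
        using vf_mult[OF X ofr_smooth(1)[OF F, of i] sm[of i i]] unit by (simp add: u_def)
    qed
    finally show ?thesis .
  qed
  ultimately have Xc: "X (ctr \<alpha> Ys) p = (\<Sum>i<8. X (\<alpha> (F i # F i # Ys)) p) - (\<Sum>i<8. l i * u i i)"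
    unfolding Xvol c[OF \<alpha> Ys] u_def[symmetric]
    by (simp add: Xwt sum.distrib sum_subtractf left_diff_distrib sum_distrib_left)
  define w where "w i j = g [D X (F i), F j] p" for i j
  \<comment> \<open>The coefficients of D in F are skew off the diagonal, and the diagonal records
    the change of length.\<close>
  have w: "w i j + w j i = (if i = j then l i else 0)" if "i < 8" "j < 8" for i j
  proof -
    have "X (g [F i, F j]) p = w i j + w j i"
      unfolding w_def using g_parallel[OF X FV[OF that(1)] FV[OF that(2)]]
        g_sym[OF FV[OF that(1)] D_in[OF X FV[OF that(2)]]] by simp
    moreover have "X (g [F i, F j]) p = (if i = j then l i else 0)"
      using F that vf_const[OF X, of 0] by (auto simp: l_def ofr_def)
    ultimately show ?thesis by simp
  qed
  have exp1: "\<alpha> (D X (F i) # F i # Ys) p = (\<Sum>j<8. w i j * u j i)" if i: "i < 8" for i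
    using tens_expand[OF E \<alpha>, of "D X (F i) # F i # Ys" 0] X FV[OF i] Ys
    by (simp add: w_def u_def EF cong: sum.cong_simp)
  have exp2: "\<alpha> (F i # D X (F i) # Ys) p = (\<Sum>j<8. w i j * u i j)" if i: "i < 8" for i
    using tens_expand[OF E \<alpha>, of "F i # D X (F i) # Ys" 1] X FV[OF i] Ys
    by (simp add: w_def u_def EF cong: sum.cong_simp)
  \<comment> \<open>The factor formed from u is symmetric in i and j, so only the symmetric part of
    w contributes, and by \<open>w\<close> that part is diagonal.\<close>
  have sw: "(\<Sum>i<8. \<Sum>j<8. w i j * (u j i + u i j)) = (\<Sum>i<8. \<Sum>j<8. w j i * (u j i + u i j))"
    by (subst sum.swap) (simp add: add.commute)
  have "2 * (\<Sum>i<8. \<Sum>j<8. w i j * (u j i + u i j)) = (\<Sum>i<8. \<Sum>j<8. (w i j + w j i) * (u j i + u i j))"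
    unfolding mult_2 by (subst (2) sw) (simp add: sum.distrib[symmetric] algebra_simps)
  also have "\<dots> = (\<Sum>i<8. \<Sum>j<8. if j = i then 2 * (l i * u i i) else 0)"
    using w by (intro sum.cong) auto
  finally have key: "(\<Sum>i<8. \<alpha> (D X (F i) # F i # Ys) p + \<alpha> (F i # D X (F i) # Ys) p) = (\<Sum>i<8. l i * u i i)"
    by (simp add: exp1 exp2 sum.distrib[symmetric] distrib_left[symmetric] sum_distrib_left[symmetric])
  have "ctr (cov_deriv D X \<alpha>) Ys p = (\<Sum>i<8. X (\<alpha> (F i # F i # Ys)) p)
      - (\<Sum>i<8. \<alpha> (D X (F i) # F i # Ys) p + \<alpha> (F i # D X (F i) # Ys) p)
      - (\<Sum>i<8. \<Sum>j<k. \<alpha> (F i # F i # Ys[j := D X (Ys ! j)]) p)"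
    unfolding c[OF tens_cov[OF X \<alpha>] Ys] cov_Cons2 len by (simp add: sum_subtractf sum.distrib)
  also have "(\<Sum>i<8. \<Sum>j<k. \<alpha> (F i # F i # Ys[j := D X (Ys ! j)]) p) = (\<Sum>j<k. ctr \<alpha> (Ys[j := D X (Ys ! j)]) p)"
    by (subst sum.swap, intro sum.cong[OF refl] c[OF \<alpha>, symmetric] field_lists_update[OF Ys])
      (use X field_lists_nth[OF Ys] in auto)
  finally show ?thesis unfolding key cov_deriv_def[of D X "ctr \<alpha>"] len using Xc by simp
qed

end

section \<open>Skewness of forms and identities for Lie brackets\<close>

context smooth_manifold
begin

lemma tens3_diff:
  assumes "tens 3 \<alpha>" "X \<in> VF" "Y \<in> VF" "Z \<in> VF" "W \<in> VF"
  shows "\<alpha> [vf_diff X Y, Z, W] p = \<alpha> [X, Z, W] p - \<alpha> [Y, Z, W] p"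
    "\<alpha> [Z, vf_diff X Y, W] p = \<alpha> [Z, X, W] p - \<alpha> [Z, Y, W] p"
    "\<alpha> [Z, W, vf_diff X Y] p = \<alpha> [Z, W, X] p - \<alpha> [Z, W, Y] p"
  using tens_diff[OF assms(1), of "[X, Z, W]" 0 X Y p] tens_diff[OF assms(1), of "[Z, X, W]" 1 X Y p]
    tens_diff[OF assms(1), of "[Z, W, X]" 2 X Y p] assms by (simp_all add: eval_nat_numeral)

lemma tens4_diff:
  assumes "tens 4 \<alpha>" "X \<in> VF" "Y \<in> VF" "Z \<in> VF" "W \<in> VF" "V \<in> VF"
  shows "\<alpha> [vf_diff X Y, Z, W, V] p = \<alpha> [X, Z, W, V] p - \<alpha> [Y, Z, W, V] p"
    "\<alpha> [Z, vf_diff X Y, W, V] p = \<alpha> [Z, X, W, V] p - \<alpha> [Z, Y, W, V] p"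
    "\<alpha> [Z, W, vf_diff X Y, V] p = \<alpha> [Z, W, X, V] p - \<alpha> [Z, W, Y, V] p"
    "\<alpha> [Z, W, V, vf_diff X Y] p = \<alpha> [Z, W, V, X] p - \<alpha> [Z, W, V, Y] p"
  using tens_diff[OF assms(1), of "[X, Z, W, V]" 0 X Y p] tens_diff[OF assms(1), of "[Z, X, W, V]" 1 X Y p]
    tens_diff[OF assms(1), of "[Z, W, X, V]" 2 X Y p] tens_diff[OF assms(1), of "[Z, W, V, X]" 3 X Y p] assms
  by (simp_all add: eval_nat_numeral)

text \<open>Polarisation: expand the vanishing value at the sum of the two fields, placed in both
  slots.\<close>

lemma form_swap:
  assumes \<alpha>: "form_on A UNIV k \<alpha>" and Xs: "Xs \<in> field_lists A k" and ij: "i < j" "j < k"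
  shows "\<alpha> (Xs[i := Xs ! j, j := Xs ! i]) p = - \<alpha> Xs p"
proof -
  have t: "tens k \<alpha>" using \<alpha> by (simp add: form_on_def)
  have len: "length Xs = k" using field_lists_length[OF Xs] .
  have V: "Xs ! i \<in> VF" "Xs ! j \<in> VF" using field_lists_nth[OF Xs] ij by auto
  let ?S = "vf_add (Xs ! i) (Xs ! j)"
  have z: "\<alpha> (Xs[i := X, j := X]) p = 0" if "X \<in> VF" for X
  proof -
    have "Xs[i := X, j := X] \<in> field_lists A k" by (intro field_lists_update Xs that)
    then show ?thesis using \<alpha> ij len unfolding form_on_def
      by (elim conjE) (drule (1) bspec, drule spec[of _ i], drule spec[of _ j], simp)
  qed
  have add: "\<alpha> (Xs[i := ?S, j := X]) p = \<alpha> (Xs[i := Xs ! i, j := X]) p + \<alpha> (Xs[i := Xs ! j, j := X]) p"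
    if "X \<in> VF" for X
  proof -
    have sw: "Xs[i := W, j := X] = Xs[j := X, i := W]" for W
      using ij by (intro list_update_swap) simp
    show ?thesis
      unfolding sw using ij by (intro tens_add[OF t field_lists_update[OF Xs that] _ V]) simp
  qed
  have "0 = \<alpha> (Xs[i := ?S, j := ?S]) p" using z[of ?S] V by simp
  also have "\<dots> = \<alpha> (Xs[i := ?S, j := Xs ! i]) p + \<alpha> (Xs[i := ?S, j := Xs ! j]) p"
    using tens_add[OF t field_lists_update[OF Xs, of ?S i] ij(2) V, of p] V by simp
  also have "\<dots> = \<alpha> (Xs[i := Xs ! j, j := Xs ! i]) p + \<alpha> Xs p"
    unfolding add[OF V(1)] add[OF V(2)] z[OF V(1)] z[OF V(2)] by simp
  finally show ?thesis by simp
qed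

lemma form3_skew:
  assumes "form_on A UNIV 3 \<alpha>" "X \<in> VF" "Y \<in> VF" "Z \<in> VF"
  shows "\<alpha> [Y, X, Z] p = - \<alpha> [X, Y, Z] p" "\<alpha> [X, Z, Y] p = - \<alpha> [X, Y, Z] p"
  using form_swap[OF assms(1), of "[X, Y, Z]" 0 1 p] form_swap[OF assms(1), of "[X, Y, Z]" 1 2 p] assms
  by (simp_all add: eval_nat_numeral)

lemma form4_skew:
  assumes "form_on A UNIV 4 \<alpha>" "X \<in> VF" "Y \<in> VF" "Z \<in> VF" "W \<in> VF"
  shows "\<alpha> [Y, X, Z, W] p = - \<alpha> [X, Y, Z, W] p" "\<alpha> [X, Z, Y, W] p = - \<alpha> [X, Y, Z, W] p"
    "\<alpha> [X, Y, W, Z] p = - \<alpha> [X, Y, Z, W] p"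
  using form_swap[OF assms(1), of "[X, Y, Z, W]" 0 1 p] form_swap[OF assms(1), of "[X, Y, Z, W]" 1 2 p]
    form_swap[OF assms(1), of "[X, Y, Z, W]" 2 3 p] assms
  by (simp_all add: eval_nat_numeral)

lemma lie_bracket_apply: "lie_bracket X Y f p = X (Y f) p - Y (X f) p"
  by (simp add: lie_bracket_def)

lemma vf_apply: "vf_add X Y f p = X f p + Y f p" "vf_diff X Y f p = X f p - Y f p"
  "vf_scale h X f p = h p * X f p"
  by (simp_all add: vf_add_def vf_diff_def vf_scale_def)

lemma vf_fun: "vf_add X Y f = (\<lambda>p. X f p + Y f p)" "vf_scale h X f = (\<lambda>p. h p * X f p)"
  by (simp_all add: vf_add_def vf_scale_def)

lemma jacobi:
  assumes "X \<in> VF" "Y \<in> VF" "Z \<in> VF"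
  shows "vf_add (vf_add (lie_bracket X (lie_bracket Y Z)) (lie_bracket Y (lie_bracket Z X)))
    (lie_bracket Z (lie_bracket X Y)) = vf_scale (\<lambda>p. 0) X"
proof (rule vf_eqI)
  fix f p assume f: "smooth_fun A f"
  have "U (lie_bracket V W f) p = U (V (W f)) p - U (W (V f)) p" if "U \<in> VF" "V \<in> VF" "W \<in> VF" for U V W
    using vf_minus[OF that(1), of "V (W f)" "W (V f)"] that f by (simp add: lie_bracket_def vf_smooth)
  from this[OF assms] this[OF assms(2,3,1)] this[OF assms(3,1,2)]
  show "vf_add (vf_add (lie_bracket X (lie_bracket Y Z)) (lie_bracket Y (lie_bracket Z X)))
    (lie_bracket Z (lie_bracket X Y)) f p = vf_scale (\<lambda>p. 0) X f p"
    by (simp add: vf_apply lie_bracket_apply)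
qed (use assms in simp_all)

lemma lie_bracket_skew: "lie_bracket Y X = vf_scale (\<lambda>p. - 1) (lie_bracket X Y)"
  by (simp add: fun_eq_iff lie_bracket_def vf_scale_def)

lemma lie_bracket_add:
  "X \<in> VF \<Longrightarrow> Y \<in> VF \<Longrightarrow> Z \<in> VF \<Longrightarrow> lie_bracket (vf_add X Y) Z = vf_add (lie_bracket X Z) (lie_bracket Y Z)"
  by (rule vf_eqI) (simp_all add: lie_bracket_apply vf_fun vf_plus[of Z] vf_smooth)

lemma lie_bracket_scale:
  "X \<in> VF \<Longrightarrow> Z \<in> VF \<Longrightarrow> smooth_fun A h \<Longrightarrow>
    lie_bracket (vf_scale h X) Z = vf_diff (vf_scale h (lie_bracket X Z)) (vf_scale (Z h) X)"
  by (rule vf_eqI)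
    (simp_all add: lie_bracket_apply vf_apply vf_fun vf_mult[of Z] vf_smooth algebra_simps)

end

section \<open>Torsion and curvature\<close>

context spin7_torsion
begin

abbreviation "T \<equiv> torsion_form g D"
abbreviation "R \<equiv> curvature g D"

definition tor :: "'m vfield \<Rightarrow> 'm vfield \<Rightarrow> 'm vfield" where
  "tor X Y = vf_diff (vf_diff (D X Y) (D Y X)) (lie_bracket X Y)"

lemma tor_in [simp]: "X \<in> VF \<Longrightarrow> Y \<in> VF \<Longrightarrow> tor X Y \<in> VF"
  by (simp add: tor_def)

lemma T_eq: "T [X, Y, Z] = g [tor X Y, Z]"
  by (simp add: torsion_form_def tor_def)

lemma T_form: "form_on A UNIV 3 T"
  using connection by (simp add: torsion_connection_def)

lemma T_tens: "tens 3 T"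
  using T_form by (simp add: form_on_def)

lemmas T_skew = form3_skew[OF T_form]

lemma T_smooth [simp]: "X \<in> VF \<Longrightarrow> Y \<in> VF \<Longrightarrow> Z \<in> VF \<Longrightarrow> smooth_fun A (T [X, Y, Z])"
  by (simp add: T_eq)

lemma Psi_form: "form_on A UNIV 4 \<Psi>"
  using spin7 by (simp add: spin7_structure_def)

lemma Psi_tens: "tens 4 \<Psi>"
  using Psi_form by (simp add: form_on_def)

lemmas Psi_skew = form4_skew[OF Psi_form]

lemma Psi_smooth [simp]:
  "X \<in> VF \<Longrightarrow> Y \<in> VF \<Longrightarrow> Z \<in> VF \<Longrightarrow> W \<in> VF \<Longrightarrow> smooth_fun A (\<Psi> [X, Y, Z, W])"
  by (rule tens_smooth[OF Psi_tens]) (simp add: eval_nat_numeral)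

lemma cov3: "cov_deriv D X \<alpha> [Y, Z, W] p =
    X (\<alpha> [Y, Z, W]) p - \<alpha> [D X Y, Z, W] p - \<alpha> [Y, D X Z, W] p - \<alpha> [Y, Z, D X W] p"
  by (simp add: cov_deriv_def eval_nat_numeral)

lemma cov4: "cov_deriv D X \<alpha> [Y, Z, W, V] p =
    X (\<alpha> [Y, Z, W, V]) p - \<alpha> [D X Y, Z, W, V] p - \<alpha> [Y, D X Z, W, V] p - \<alpha> [Y, Z, D X W, V] p
     - \<alpha> [Y, Z, W, D X V] p"
  by (simp add: cov_deriv_def eval_nat_numeral)

lemma Psi_cov: "X \<in> VF \<Longrightarrow> Xs \<in> field_lists A 4 \<Longrightarrow> cov_deriv D X \<Psi> Xs = (\<lambda>p. 0)"
  using connection by (simp add: torsion_connection_def parallel_def tensor_eq_def)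

lemma Psi_parallel:
  assumes "X \<in> VF" "Y \<in> VF" "Z \<in> VF" "W \<in> VF" "V \<in> VF"
  shows "X (\<Psi> [Y, Z, W, V]) = (\<lambda>p. \<Psi> [D X Y, Z, W, V] p + \<Psi> [Y, D X Z, W, V] p
     + \<Psi> [Y, Z, D X W, V] p + \<Psi> [Y, Z, W, D X V] p)"
proof
  fix p
  show "X (\<Psi> [Y, Z, W, V]) p = \<Psi> [D X Y, Z, W, V] p + \<Psi> [Y, D X Z, W, V] p
     + \<Psi> [Y, Z, D X W, V] p + \<Psi> [Y, Z, W, D X V] p"
    using fun_cong[OF Psi_cov[OF assms(1), of "[Y, Z, W, V]"], of p] assms
    by (simp add: cov4 eval_nat_numeral)
qed

abbreviation "Rop \<equiv> curvature_op D"

lemma R_eq: "R [X, Y, Z, V] = g [Rop X Y Z, V]"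
  by (simp add: curvature_def)

lemma Rop_in [simp]: "X \<in> VF \<Longrightarrow> Y \<in> VF \<Longrightarrow> Z \<in> VF \<Longrightarrow> Rop X Y Z \<in> VF"
  by (simp add: curvature_op_def)

lemma Rop_apply: "Rop X Y Z f p = D X (D Y Z) f p - D Y (D X Z) f p - D (lie_bracket X Y) Z f p"
  by (simp add: curvature_op_def vf_apply)

lemma Rop_skew:
  assumes "X \<in> VF" "Y \<in> VF" "Z \<in> VF"
  shows "Rop Y X Z = vf_scale (\<lambda>p. - 1) (Rop X Y Z)"
  unfolding fun_eq_iff
  using assms by (simp add: Rop_apply vf_apply lie_bracket_skew[of Y X] D_scale)

lemma Rop_add1:
  assumes "X \<in> VF" "Y \<in> VF" "Z \<in> VF" "W \<in> VF"
  shows "Rop (vf_add X W) Y Z = vf_add (Rop X Y Z) (Rop W Y Z)"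
  unfolding fun_eq_iff using assms
  by (simp add: Rop_apply vf_apply D_add lie_bracket_add)

lemma Rop_scale1:
  assumes "X \<in> VF" "Y \<in> VF" "Z \<in> VF" "smooth_fun A h"
  shows "Rop (vf_scale h X) Y Z = vf_scale h (Rop X Y Z)"
  unfolding fun_eq_iff using assms
  by (simp add: Rop_apply vf_apply D_scale D_diff lie_bracket_scale vf_smooth algebra_simps)

lemma Rop_add2:
  assumes "X \<in> VF" "Y \<in> VF" "Z \<in> VF" "W \<in> VF"
  shows "Rop Y (vf_add X W) Z = vf_add (Rop Y X Z) (Rop Y W Z)"
  unfolding Rop_skew[OF vf_add_in[OF assms(1,4)] assms(2,3)]
    Rop_skew[OF assms(1,2,3)] Rop_skew[OF assms(4,2,3)] Rop_add1[OF assms]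
  by (simp add: fun_eq_iff vf_apply)

lemma Rop_scale2:
  assumes "X \<in> VF" "Y \<in> VF" "Z \<in> VF" "smooth_fun A h"
  shows "Rop Y (vf_scale h X) Z = vf_scale h (Rop Y X Z)"
  unfolding Rop_skew[OF vf_scale_in[OF assms(1,4)] assms(2,3)]
    Rop_skew[OF assms(1,2,3)] Rop_scale1[OF assms]
  by (simp add: fun_eq_iff vf_apply)

lemma Rop_diff2:
  assumes "X \<in> VF" "Y \<in> VF" "Z \<in> VF" "W \<in> VF"
  shows "Rop Y (vf_diff X W) Z = vf_diff (Rop Y X Z) (Rop Y W Z)"
  using assms by (simp add: vf_diff_conv Rop_add2 Rop_scale2)

lemma Rop_add3:
  assumes "X \<in> VF" "Y \<in> VF" "Z \<in> VF" "W \<in> VF"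
  shows "Rop X Y (vf_add Z W) = vf_add (Rop X Y Z) (Rop X Y W)"
  unfolding fun_eq_iff using assms by (simp add: Rop_apply vf_apply D_add)

lemma Rop_scale3:
  assumes "X \<in> VF" "Y \<in> VF" "Z \<in> VF" "smooth_fun A h"
  shows "Rop X Y (vf_scale h Z) = vf_scale h (Rop X Y Z)"
  unfolding fun_eq_iff using assms
  by (simp add: Rop_apply vf_apply D_add D_scale vf_smooth lie_bracket_apply algebra_simps)

lemma R_tens: "tens 4 R"
proof (rule tensI)
  fix Xs assume "Xs \<in> field_lists A 4"
  then obtain X Y Z W where Xs: "Xs = [X, Y, Z, W]" and V: "X \<in> VF" "Y \<in> VF" "Z \<in> VF" "W \<in> VF"
    by (auto simp: field_lists_def eval_nat_numeral length_Suc_conv)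
  show "smooth_fun A (R Xs)" unfolding Xs R_eq using V by simp
  fix i :: nat and U U' f h p
  assume i: "i < 4" and U: "U \<in> VF" "U' \<in> VF" "smooth_fun A f" "smooth_fun A h"
  then consider "i = 0" | "i = 1" | "i = 2" | "i = 3" by linarith
  then show "R (Xs[i := vf_add (vf_scale f U) (vf_scale h U')]) p = f p * R (Xs[i := U]) p + h p * R (Xs[i := U']) p"
    using V U
    by cases (simp_all add: Xs R_eq Rop_add1 Rop_scale1 Rop_add2 Rop_scale2 Rop_add3 Rop_scale3 g_add g_scale
        eval_nat_numeral)
qed

lemma R_skew1:
  assumes "X \<in> VF" "Y \<in> VF" "Z \<in> VF" "V \<in> VF"
  shows "R [Y, X, Z, V] p = - R [X, Y, Z, V] p"
  using assms by (simp add: R_eq Rop_skew[of X Y] g_scale)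

lemma R_skew2:
  assumes "X \<in> VF" "Y \<in> VF" "Z \<in> VF" "V \<in> VF"
  shows "R [X, Y, V, Z] p = - R [X, Y, Z, V] p"
proof -
  have XY: "U (W (g [Z, V])) p = g [D U (D W Z), V] p + g [D W Z, D U V] p + g [D U Z, D W V] p + g [Z, D U (D W V)] p"
    if "U \<in> VF" "W \<in> VF" for U W
    using that assms by (simp add: g_parallel vf_plus[of U])
  have "lie_bracket X Y (g [Z, V]) p = g [D (lie_bracket X Y) Z, V] p + g [Z, D (lie_bracket X Y) V] p"
    using assms by (simp add: g_parallel)
  then have "g [Rop X Y Z, V] p + g [Z, Rop X Y V] p = 0"
    using XY[of X Y] XY[of Y X] assms by (simp add: lie_bracket_apply curvature_op_def g_diff)
  then show ?thesis using g_sym[of Z "Rop X Y V"] assms by (simp add: R_eq)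
qed

text \<open>The curvature acts on tensors as a derivation and kills the parallel form \<Psi>. This
  is the infinitesimal holonomy condition to which \<open>stabilizer_eigen\<close> is
  applied.\<close>

lemma R_Psi:
  assumes "X \<in> VF" "Y \<in> VF" and abcd: "a \<in> VF" "b \<in> VF" "c \<in> VF" "d \<in> VF"
  shows "\<Psi> [Rop X Y a, b, c, d] p + \<Psi> [a, Rop X Y b, c, d] p + \<Psi> [a, b, Rop X Y c, d] p
    + \<Psi> [a, b, c, Rop X Y d] p = 0"
proof -
  have XY: "U (W (\<Psi> [a, b, c, d])) p =
      U (\<Psi> [D W a, b, c, d]) p + U (\<Psi> [a, D W b, c, d]) p + U (\<Psi> [a, b, D W c, d]) p + U (\<Psi> [a, b, c, D W d]) p"
    if "U \<in> VF" "W \<in> VF" for U W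
    using that abcd by (simp add: Psi_parallel[of W] vf_plus[of U] smooth_add)
  have "X (Y (\<Psi> [a, b, c, d])) p - Y (X (\<Psi> [a, b, c, d])) p - lie_bracket X Y (\<Psi> [a, b, c, d]) p = 0"
    by (simp add: lie_bracket_apply)
  then show ?thesis
    unfolding XY[OF assms(1,2)] XY[OF assms(2,1)] curvature_op_def using assms
    by (simp add: Psi_parallel tens4_diff[OF Psi_tens])
qed

text \<open>The cyclic sum of the curvature is the cyclic sum of \<open>D X (tor Y Z)\<close> and
  \<open>tor X (lie_bracket Y Z)\<close>, up to double brackets that cancel by the Jacobi identity.
  Rewriting the remaining bracket through D and \<open>tor\<close> turns this into covariant
  derivatives of T and the terms quadratic in T.\<close>

lemma bianchi1:
  assumes "X \<in> VF" "Y \<in> VF" "Z \<in> VF" "V \<in> VF"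
  shows "R [X, Y, Z, V] p + R [Y, Z, X, V] p + R [Z, X, Y, V] p =
    cov_deriv D X T [Y, Z, V] p + cov_deriv D Y T [Z, X, V] p + cov_deriv D Z T [X, Y, V] p
    + T [tor X Y, Z, V] p + T [tor Y Z, X, V] p + T [tor Z X, Y, V] p"
proof -
  have op: "vf_add (vf_add (Rop X Y Z) (Rop Y Z X)) (Rop Z X Y) =
    vf_add (vf_add (vf_add (D X (tor Y Z)) (tor X (lie_bracket Y Z)))
      (vf_add (D Y (tor Z X)) (tor Y (lie_bracket Z X)))) (vf_add (D Z (tor X Y)) (tor Z (lie_bracket X Y)))"
  proof (rule vf_eqI)
    fix f p
    show "vf_add (vf_add (Rop X Y Z) (Rop Y Z X)) (Rop Z X Y) f p =
      vf_add (vf_add (vf_add (D X (tor Y Z)) (tor X (lie_bracket Y Z)))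
        (vf_add (D Y (tor Z X)) (tor Y (lie_bracket Z X)))) (vf_add (D Z (tor X Y)) (tor Z (lie_bracket X Y))) f p"
      using fun_cong[OF fun_cong[OF jacobi[OF assms(1-3)]], of f p] assms
      unfolding tor_def by (simp add: D_diff vf_apply Rop_apply)
  qed (use assms in simp_all)
  have gD: "g [D U (tor W S), V] p = U (T [W, S, V]) p - T [W, S, D U V] p" if "U \<in> VF" "W \<in> VF" "S \<in> VF" for U W S
    using that assms by (simp add: T_eq g_parallel)
  have br: "lie_bracket W S = vf_diff (vf_diff (D W S) (D S W)) (tor W S)" for W S
    by (simp add: tor_def fun_eq_iff vf_apply)
  have gt: "g [tor U (lie_bracket W S), V] p = T [U, D W S, V] p - T [U, D S W, V] p - T [U, tor W S, V] p"
    if "U \<in> VF" "W \<in> VF" "S \<in> VF" for U W S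
    unfolding T_eq[symmetric] br[of W S] using that assms by (simp add: tens3_diff[OF T_tens])
  have "R [X, Y, Z, V] p + R [Y, Z, X, V] p + R [Z, X, Y, V] p
     = g [vf_add (vf_add (Rop X Y Z) (Rop Y Z X)) (Rop Z X Y), V] p"
    using assms by (simp add: R_eq g_add)
  also have "\<dots> = g [D X (tor Y Z), V] p + g [tor X (lie_bracket Y Z), V] p
     + g [D Y (tor Z X), V] p + g [tor Y (lie_bracket Z X), V] p
     + g [D Z (tor X Y), V] p + g [tor Z (lie_bracket X Y), V] p"
    unfolding op using assms by (simp add: g_add)
  finally show ?thesis
    using assms T_skew(1)[of X "tor Y Z" V p] T_skew(1)[of Y "tor Z X" V p] T_skew(1)[of Z "tor X Y" V p]
      T_skew(1)[of X "D Y Z" V p] T_skew(1)[of Y "D Z X" V p] T_skew(1)[of Z "D X Y" V p]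
    by (simp add: gD gt cov3)
qed

lemma cov_R:
  assumes "X \<in> VF" "Y \<in> VF" "Z \<in> VF" "U \<in> VF" "V \<in> VF"
  shows "cov_deriv D X R [Y, Z, U, V] p = g [D X (Rop Y Z U), V] p - g [Rop (D X Y) Z U, V] p
    - g [Rop Y (D X Z) U, V] p - g [Rop Y Z (D X U), V] p"
  using assms by (simp add: cov4 R_eq g_parallel)

lemma bianchi2:
  assumes "X \<in> VF" "Y \<in> VF" "Z \<in> VF" "U \<in> VF" "V \<in> VF"
  shows "cov_deriv D X R [Y, Z, U, V] p + cov_deriv D Y R [Z, X, U, V] p + cov_deriv D Z R [X, Y, U, V] p
    + R [tor X Y, Z, U, V] p + R [tor Y Z, X, U, V] p + R [tor Z X, Y, U, V] p = 0"
proof -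
  have dj: "D (lie_bracket X (lie_bracket Y Z)) U f p + D (lie_bracket Y (lie_bracket Z X)) U f p
      + D (lie_bracket Z (lie_bracket X Y)) U f p = 0" for f p
  proof -
    have "D (vf_add (vf_add (lie_bracket X (lie_bracket Y Z)) (lie_bracket Y (lie_bracket Z X)))
      (lie_bracket Z (lie_bracket X Y))) U f p = 0"
      unfolding jacobi[OF assms(1-3)] using assms by (simp add: D_scale vf_apply)
    then show ?thesis using assms by (simp add: D_add vf_apply)
  qed
  have br: "lie_bracket W S = vf_diff (vf_diff (D W S) (D S W)) (tor W S)" for W S
    by (simp add: tor_def fun_eq_iff vf_apply)
  have Rbr: "Rop Q (lie_bracket W S) U f p = Rop Q (D W S) U f p - Rop Q (D S W) U f p - Rop Q (tor W S) U f p"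
    if "Q \<in> VF" "W \<in> VF" "S \<in> VF" for Q W S f p
    unfolding br[of W S] using that assms by (simp add: Rop_diff2 vf_apply)
  have sk: "Rop W S U f p = - Rop S W U f p" if "W \<in> VF" "S \<in> VF" for W S f p
    using Rop_skew[OF that(2,1) assms(4)] by (simp add: vf_apply)
  \<comment> \<open>The covariant derivative in direction X of the curvature operator, applied to U;
    the identity is first proved for these fields and then paired with V.\<close>
  define W where "W X Y Z = vf_diff (vf_diff (vf_diff (D X (Rop Y Z U)) (Rop (D X Y) Z U)) (Rop Y (D X Z) U))
     (Rop Y Z (D X U))" for X Y Z
  have W_in: "W X Y Z \<in> VF" if "X \<in> VF" "Y \<in> VF" "Z \<in> VF" for X Y Z
    using that assms unfolding W_def by simp
  have cov: "cov_deriv D X R [Y, Z, U, V] p = g [W X Y Z, V] p" if "X \<in> VF" "Y \<in> VF" "Z \<in> VF" for X Y Z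
    using that assms unfolding W_def by (simp add: cov_R g_diff)
  let ?S = "vf_add (vf_add (vf_add (W X Y Z) (W Y Z X)) (W Z X Y))
    (vf_add (vf_add (Rop (tor X Y) Z U) (Rop (tor Y Z) X U)) (Rop (tor Z X) Y U))"
  have "?S = vf_scale (\<lambda>p. 0) X"
  proof (rule vf_eqI)
    fix f p
    have exp: "D X (Rop Y Z U) f p = D X (D Y (D Z U)) f p - D X (D Z (D Y U)) f p - D X (D (lie_bracket Y Z) U) f p"
      if "X \<in> VF" "Y \<in> VF" "Z \<in> VF" for X Y Z
      using that assms unfolding curvature_op_def by (simp add: D_diff vf_apply)
    have b: "D P (D (lie_bracket Q S) U) f p - D (lie_bracket Q S) (D P U) f p =
      Rop P (D Q S) U f p - Rop P (D S Q) U f p - Rop P (tor Q S) U f p + D (lie_bracket P (lie_bracket Q S)) U f p"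
      if "P \<in> VF" "Q \<in> VF" "S \<in> VF" for P Q S
      using Rbr[OF that, of f p] Rop_apply[of P "lie_bracket Q S" U f p] by simp
    show "?S f p = vf_scale (\<lambda>p. 0) X f p"
      unfolding W_def vf_apply exp[OF assms(1-3)] exp[OF assms(2,3,1)] exp[OF assms(3,1,2)]
        Rop_apply[of Y Z "D X U"] Rop_apply[of Z X "D Y U"] Rop_apply[of X Y "D Z U"]
      using b[OF assms(1-3)] b[OF assms(2,3,1)] b[OF assms(3,1,2)] dj[of f p]
        sk[of "tor Y Z" X f p] sk[of "tor Z X" Y f p] sk[of "tor X Y" Z f p]
        sk[of "D X Y" Z f p] sk[of "D Y Z" X f p] sk[of "D Z X" Y f p] assms by simp
  qed (use assms W_in in simp_all)
  then have "g [?S, V] p = 0" using assms by (simp add: g_scale)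
  then show ?thesis using assms W_in by (simp add: cov R_eq g_add)
qed

end

section \<open>Algebra of the Spin(7) form\<close>

lemma sum_rot3: "(\<Sum>a\<in>I. \<Sum>b\<in>I. \<Sum>c\<in>I. f a b c) = (\<Sum>c\<in>I. \<Sum>a\<in>I. \<Sum>b\<in>I. f a b c :: 'a::comm_monoid_add)"
proof -
  have "(\<Sum>a\<in>I. \<Sum>b\<in>I. \<Sum>c\<in>I. f a b c) = (\<Sum>a\<in>I. \<Sum>c\<in>I. \<Sum>b\<in>I. f a b c)"
    by (rule sum.cong[OF refl], rule sum.swap)
  also note sum.swap
  finally show ?thesis .
qed

lemma sum_rot4: "(\<Sum>a\<in>I. \<Sum>b\<in>I. \<Sum>c\<in>I. \<Sum>d\<in>I. f a b c d)
    = (\<Sum>d\<in>I. \<Sum>a\<in>I. \<Sum>b\<in>I. \<Sum>c\<in>I. f a b c d :: 'a::comm_monoid_add)"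
proof -
  have "(\<Sum>a\<in>I. \<Sum>b\<in>I. \<Sum>c\<in>I. \<Sum>d\<in>I. f a b c d) = (\<Sum>a\<in>I. \<Sum>d\<in>I. \<Sum>b\<in>I. \<Sum>c\<in>I. f a b c d)"
    by (rule sum.cong[OF refl], rule sum_rot3)
  also note sum.swap
  finally show ?thesis .
qed

lemma sum_rot5: "(\<Sum>a\<in>I. \<Sum>b\<in>I. \<Sum>c\<in>I. \<Sum>d\<in>I. \<Sum>e\<in>I. f a b c d e)
    = (\<Sum>e\<in>I. \<Sum>a\<in>I. \<Sum>b\<in>I. \<Sum>c\<in>I. \<Sum>d\<in>I. f a b c d e :: 'a::comm_monoid_add)"
proof -
  have "(\<Sum>a\<in>I. \<Sum>b\<in>I. \<Sum>c\<in>I. \<Sum>d\<in>I. \<Sum>e\<in>I. f a b c d e)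
      = (\<Sum>a\<in>I. \<Sum>e\<in>I. \<Sum>b\<in>I. \<Sum>c\<in>I. \<Sum>d\<in>I. f a b c d e)"
    by (rule sum.cong[OF refl], rule sum_rot4)
  also note sum.swap
  finally show ?thesis .
qed

lemma sum_cyc3: "(\<Sum>a\<in>I. \<Sum>b\<in>I. \<Sum>c\<in>I. f b c a) = (\<Sum>a\<in>I. \<Sum>b\<in>I. \<Sum>c\<in>I. f a b c :: 'a::comm_monoid_add)"
  by (rule sum_rot3[of "\<lambda>b c a. f b c a", symmetric])

lemma sum_skew_sym:
  fixes B :: "nat \<Rightarrow> nat \<Rightarrow> real"
  assumes "\<And>i j. B j i = - B i j" "\<And>i j. M j i = M i j"
  shows "(\<Sum>i\<in>I. \<Sum>j\<in>I. B i j * M i j) = 0"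
proof -
  have "(\<Sum>i\<in>I. \<Sum>j\<in>I. B i j * M i j) = (\<Sum>j\<in>I. \<Sum>i\<in>I. B i j * M i j)" by (rule sum.swap)
  also have "\<dots> = (\<Sum>j\<in>I. \<Sum>i\<in>I. - (B j i * M j i))"
  proof (intro sum.cong refl)
    fix i j show "B i j * M i j = - (B j i * M j i)" using assms[of i j] by simp
  qed
  finally show ?thesis by (simp add: sum_negf)
qed

lemma sum_lessThan_8: "(\<Sum>i<8. f i) = f 0 + f 1 + f 2 + f 3 + f 4 + f 5 + f 6 + f (7::nat)"
  by (simp add: eval_nat_numeral)

text \<open>Skewness is required for all natural indices, so that it is an unconditional equation.
  With the values on the 70 increasing quadruples it lets every component with indices below 8 be
  evaluated by rewriting.\<close>

locale spin7_array =
  fixes \<psi> :: "nat \<Rightarrow> nat \<Rightarrow> nat \<Rightarrow> nat \<Rightarrow> real"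
  assumes psi_skew: "\<psi> j i k l = - \<psi> i j k l" "\<psi> i k j l = - \<psi> i j k l" "\<psi> i j l k = - \<psi> i j k l"
    and psi_nonzero:
      "\<psi> 0 1 2 7 = - 1"
      "\<psi> 0 2 3 6 = 1"
      "\<psi> 0 3 4 7 = - 1"
      "\<psi> 0 5 6 7 = - 1"
      "\<psi> 0 1 4 6 = 1"
      "\<psi> 0 2 4 5 = 1"
      "\<psi> 0 1 3 5 = - 1"
      "\<psi> 3 4 5 6 = - 1"
      "\<psi> 1 4 5 7 = - 1"
      "\<psi> 1 2 5 6 = - 1"
      "\<psi> 1 2 3 4 = - 1"
      "\<psi> 2 3 5 7 = - 1"
      "\<psi> 1 3 6 7 = - 1"
      "\<psi> 2 4 6 7 = 1"
    and psi_zero: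
      "\<psi> 0 1 2 3 = 0" "\<psi> 0 1 2 4 = 0" "\<psi> 0 1 2 5 = 0" "\<psi> 0 1 2 6 = 0"
      "\<psi> 0 1 3 4 = 0" "\<psi> 0 1 3 6 = 0" "\<psi> 0 1 3 7 = 0" "\<psi> 0 1 4 5 = 0"
      "\<psi> 0 1 4 7 = 0" "\<psi> 0 1 5 6 = 0" "\<psi> 0 1 5 7 = 0" "\<psi> 0 1 6 7 = 0"
      "\<psi> 0 2 3 4 = 0" "\<psi> 0 2 3 5 = 0" "\<psi> 0 2 3 7 = 0" "\<psi> 0 2 4 6 = 0"
      "\<psi> 0 2 4 7 = 0" "\<psi> 0 2 5 6 = 0" "\<psi> 0 2 5 7 = 0" "\<psi> 0 2 6 7 = 0"
      "\<psi> 0 3 4 5 = 0" "\<psi> 0 3 4 6 = 0" "\<psi> 0 3 5 6 = 0" "\<psi> 0 3 5 7 = 0"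
      "\<psi> 0 3 6 7 = 0" "\<psi> 0 4 5 6 = 0" "\<psi> 0 4 5 7 = 0" "\<psi> 0 4 6 7 = 0"
      "\<psi> 1 2 3 5 = 0" "\<psi> 1 2 3 6 = 0" "\<psi> 1 2 3 7 = 0" "\<psi> 1 2 4 5 = 0"
      "\<psi> 1 2 4 6 = 0" "\<psi> 1 2 4 7 = 0" "\<psi> 1 2 5 7 = 0" "\<psi> 1 2 6 7 = 0"
      "\<psi> 1 3 4 5 = 0" "\<psi> 1 3 4 6 = 0" "\<psi> 1 3 4 7 = 0" "\<psi> 1 3 5 6 = 0"
      "\<psi> 1 3 5 7 = 0" "\<psi> 1 4 5 6 = 0" "\<psi> 1 4 6 7 = 0" "\<psi> 1 5 6 7 = 0"
      "\<psi> 2 3 4 5 = 0" "\<psi> 2 3 4 6 = 0" "\<psi> 2 3 4 7 = 0" "\<psi> 2 3 5 6 = 0"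
      "\<psi> 2 3 6 7 = 0" "\<psi> 2 4 5 6 = 0" "\<psi> 2 4 5 7 = 0" "\<psi> 2 5 6 7 = 0"
      "\<psi> 3 4 5 7 = 0" "\<psi> 3 4 6 7 = 0" "\<psi> 3 5 6 7 = 0" "\<psi> 4 5 6 7 = 0"
begin

lemma psi_eq: "\<psi> i i k l = 0" "\<psi> i j j l = 0" "\<psi> i j k k = 0"
  using psi_skew(1)[of i i k l] psi_skew(2)[of i j j l] psi_skew(3)[of i j k k] by auto

text \<open>The comparisons orient skewness, so that rewriting sorts numeral indices and
  terminates.\<close>

lemma psi_sort:
  "j < i \<Longrightarrow> \<psi> i j k l = - \<psi> j i k l" "k < j \<Longrightarrow> \<psi> i j k l = - \<psi> i k j l" "l < k \<Longrightarrow> \<psi> i j k l = - \<psi> i j l k"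
  by (rule psi_skew)+

lemma psi_pair: "\<psi> k l i j = \<psi> i j k l"
  using psi_skew(2)[of i k l j] psi_skew(1)[of k i l j] psi_skew(3)[of k i j l] psi_skew(2)[of k i l j]
    psi_skew(3)[of i k j l] psi_skew(2)[of i k j l] psi_skew(3)[of k l i j] psi_skew(3)[of i j k l] by linarith

lemma psi_cyc: "\<psi> b c a j = \<psi> a b c j"
  using psi_skew(1)[of a b c j] psi_skew(2)[of b a c j] by linarith

text \<open>On 2-forms this operator has eigenvalue 2 on spin(7) and eigenvalue -6 on its
  7-dimensional complement.\<close>

definition contr :: "(nat \<Rightarrow> nat \<Rightarrow> real) \<Rightarrow> nat \<Rightarrow> nat \<Rightarrow> real" where
  "contr B k l = (\<Sum>a<8. \<Sum>b<8. B a b * \<psi> a b k l)"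

lemmas psi_eval = psi_eq psi_sort psi_nonzero psi_zero

lemma contr_skew: "contr B l k = - contr B k l"
  unfolding contr_def by (subst psi_skew(3)) (simp add: sum_negf)

context fixes B :: "nat \<Rightarrow> nat \<Rightarrow> real" assumes B: "\<And>a b. B b a = - B a b"
begin

lemma skew_diag: "B a a = 0" using B[of a a] by simp

lemma skew_sort: "b < a \<Longrightarrow> B a b = - B b a" by (rule B)

text \<open>Every pair k, l lies in exactly three of the fourteen quadruples. The complementary
  pairs give the three terms, and the two orders of a, b give the factor 2.\<close>

lemma contr_eval:
  shows "contr B 0 1 = 2 * (- B 2 7 - B 3 5 + B 4 6)"
    "contr B 0 2 = 2 * (B 1 7 + B 3 6 + B 4 5)"
    "contr B 0 3 = 2 * (B 1 5 - B 2 6 - B 4 7)"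
    "contr B 0 4 = 2 * (- B 1 6 - B 2 5 + B 3 7)"
    "contr B 0 5 = 2 * (- B 1 3 + B 2 4 - B 6 7)"
    "contr B 0 6 = 2 * (B 1 4 + B 2 3 + B 5 7)"
    "contr B 0 7 = 2 * (- B 1 2 - B 3 4 - B 5 6)"
    "contr B 1 2 = 2 * (- B 0 7 - B 3 4 - B 5 6)"
    "contr B 1 3 = 2 * (- B 0 5 + B 2 4 - B 6 7)"
    "contr B 1 4 = 2 * (B 0 6 - B 2 3 - B 5 7)"
    "contr B 1 5 = 2 * (B 0 3 + B 2 6 + B 4 7)"
    "contr B 1 6 = 2 * (- B 0 4 - B 2 5 + B 3 7)"
    "contr B 1 7 = 2 * (B 0 2 - B 3 6 - B 4 5)"
    "contr B 2 3 = 2 * (B 0 6 - B 1 4 - B 5 7)"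
    "contr B 2 4 = 2 * (B 0 5 + B 1 3 + B 6 7)"
    "contr B 2 5 = 2 * (- B 0 4 - B 1 6 + B 3 7)"
    "contr B 2 6 = 2 * (- B 0 3 + B 1 5 - B 4 7)"
    "contr B 2 7 = 2 * (- B 0 1 - B 3 5 + B 4 6)"
    "contr B 3 4 = 2 * (- B 0 7 - B 1 2 - B 5 6)"
    "contr B 3 5 = 2 * (- B 0 1 - B 2 7 + B 4 6)"
    "contr B 3 6 = 2 * (B 0 2 - B 1 7 - B 4 5)"
    "contr B 3 7 = 2 * (B 0 4 + B 1 6 + B 2 5)"
    "contr B 4 5 = 2 * (B 0 2 - B 1 7 - B 3 6)"
    "contr B 4 6 = 2 * (B 0 1 + B 2 7 + B 3 5)"
    "contr B 4 7 = 2 * (- B 0 3 + B 1 5 - B 2 6)"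
    "contr B 5 6 = 2 * (- B 0 7 - B 1 2 - B 3 4)"
    "contr B 5 7 = 2 * (B 0 6 - B 1 4 - B 2 3)"
    "contr B 6 7 = 2 * (- B 0 5 - B 1 3 + B 2 4)"
  unfolding contr_def by (simp_all add: sum_lessThan_8 psi_eval skew_diag skew_sort del: One_nat_def)

end

lemma contr_sort: "l < k \<Longrightarrow> contr B k l = - contr B l k"
  by (rule contr_skew)

lemma contr_diag: "contr B k k = 0"
  using contr_skew[of B k k] by simp

lemma all_pairs_8:
  "(\<forall>l<8. \<forall>k<l. P k l) \<longleftrightarrow>
    P 6 (7::nat) \<and> P 5 (7::nat) \<and> P 4 (7::nat) \<and> P 3 (7::nat) \<and> P 2 (7::nat) \<and> P 1 (7::nat) \<and> P 0 (7::nat) \<and>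
    P 5 (6::nat) \<and> P 4 (6::nat) \<and> P 3 (6::nat) \<and> P 2 (6::nat) \<and> P 1 (6::nat) \<and> P 0 (6::nat) \<and> P 4 (5::nat) \<and>
    P 3 (5::nat) \<and> P 2 (5::nat) \<and> P 1 (5::nat) \<and> P 0 (5::nat) \<and> P 3 (4::nat) \<and> P 2 (4::nat) \<and> P 1 (4::nat) \<and>
    P 0 (4::nat) \<and> P 2 (3::nat) \<and> P 1 (3::nat) \<and> P 0 (3::nat) \<and> P 1 (2::nat) \<and> P 0 (2::nat) \<and> P 0 (1::nat)"
  by (simp add: eval_nat_numeral All_less_Suc)

lemma all_triples_8:
  "(\<forall>k<8. \<forall>j<k. \<forall>i<j. P i j k) \<longleftrightarrow>
    P 5 6 (7::nat) \<and> P 4 6 (7::nat) \<and> P 3 6 (7::nat) \<and> P 2 6 (7::nat) \<and> P 1 6 (7::nat) \<and> P 0 6 (7::nat) \<and> P 4 5 (7::nat) \<and>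
    P 3 5 (7::nat) \<and> P 2 5 (7::nat) \<and> P 1 5 (7::nat) \<and> P 0 5 (7::nat) \<and> P 3 4 (7::nat) \<and> P 2 4 (7::nat) \<and> P 1 4 (7::nat) \<and>
    P 0 4 (7::nat) \<and> P 2 3 (7::nat) \<and> P 1 3 (7::nat) \<and> P 0 3 (7::nat) \<and> P 1 2 (7::nat) \<and> P 0 2 (7::nat) \<and> P 0 1 (7::nat) \<and>
    P 4 5 (6::nat) \<and> P 3 5 (6::nat) \<and> P 2 5 (6::nat) \<and> P 1 5 (6::nat) \<and> P 0 5 (6::nat) \<and> P 3 4 (6::nat) \<and> P 2 4 (6::nat) \<and>
    P 1 4 (6::nat) \<and> P 0 4 (6::nat) \<and> P 2 3 (6::nat) \<and> P 1 3 (6::nat) \<and> P 0 3 (6::nat) \<and> P 1 2 (6::nat) \<and> P 0 2 (6::nat) \<and>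
    P 0 1 (6::nat) \<and> P 3 4 (5::nat) \<and> P 2 4 (5::nat) \<and> P 1 4 (5::nat) \<and> P 0 4 (5::nat) \<and> P 2 3 (5::nat) \<and> P 1 3 (5::nat) \<and>
    P 0 3 (5::nat) \<and> P 1 2 (5::nat) \<and> P 0 2 (5::nat) \<and> P 0 1 (5::nat) \<and> P 2 3 (4::nat) \<and> P 1 3 (4::nat) \<and> P 0 3 (4::nat) \<and>
    P 1 2 (4::nat) \<and> P 0 2 (4::nat) \<and> P 0 1 (4::nat) \<and> P 1 2 (3::nat) \<and> P 0 2 (3::nat) \<and> P 0 1 (3::nat) \<and> P 0 1 (2::nat)"
  by (simp add: eval_nat_numeral All_less_Suc)

lemma skew3_zeroI:
  fixes L :: "nat \<Rightarrow> nat \<Rightarrow> nat \<Rightarrow> real"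
  assumes skew: "\<And>i j k. L j i k = - L i j k" "\<And>i j k. L i k j = - L i j k"
    and sorted: "\<And>i j k. i < j \<Longrightarrow> j < k \<Longrightarrow> k < 8 \<Longrightarrow> L i j k = 0"
    and "i < 8" "j < 8" "k < 8"
  shows "L i j k = 0"
proof -
  have *: "L i j k = 0" if "i \<le> j" "j \<le> k" "k < 8" for i j k
    using that sorted[of i j k] skew(1)[of i i k] skew(2)[of i j j] by (cases "i = j"; cases "j = k") auto
  have "L i j k = 0 \<or> L j i k = 0 \<or> L i k j = 0 \<or> L k i j = 0 \<or> L j k i = 0 \<or> L k j i = 0"
    using *[of i j k] *[of j i k] *[of i k j] *[of k i j] *[of j k i] *[of k j i] assms(4-6) by linarith
  then show ?thesis
    using skew(1)[of j i k] skew(2)[of i k j] skew(1)[of k i j] skew(2)[of j k i] skew(1)[of k j i]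
    by (elim disjE) linarith+
qed

text \<open>The 3-forms with \<open>t\<^sub>a\<^sub>b\<^sub>c\<psi>\<^sub>a\<^sub>b\<^sub>c\<^sub>d = 0\<close> form the 48-dimensional irreducible component of the 3-forms.\<close>

context
  fixes t :: "nat \<Rightarrow> nat \<Rightarrow> nat \<Rightarrow> real"
  assumes t_skew: "\<And>i j k. t j i k = - t i j k" "\<And>i j k. t i k j = - t i j k"
    and t_psi: "\<And>d. d < 8 \<Longrightarrow> (\<Sum>a<8. \<Sum>b<8. \<Sum>c<8. t a b c * \<psi> a b c d) = 0"
begin

lemma t_sort: "j < i \<Longrightarrow> t i j k = - t j i k" "k < j \<Longrightarrow> t i j k = - t i k j"
  by (rule t_skew)+

lemma t_eq: "t i i k = 0" "t i k k = 0"
  using t_skew(1)[of i i k] t_skew(2)[of i k k] by auto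

lemma t_psi_contr: "d < 8 \<Longrightarrow> (\<Sum>c<8. contr (\<lambda>a b. t a b c) c d) = 0"
  unfolding contr_def by (subst sum_rot3[symmetric]) (rule t_psi)

lemmas t_contr = contr_eval[where B = "\<lambda>a b. t a b c" for c, OF t_skew(1)]

text \<open>One equation for each d from 0 to 7; its seven terms are the triples that complete d to
  a quadruple of \<psi>. These equations cut the 56 components of a 3-form down to 48.\<close>

lemma t_psi_eval:
  "t 1 2 7 + t 1 3 5 - t 1 4 6 - t 2 3 6 - t 2 4 5 + t 3 4 7 + t 5 6 7 = 0"
    "- t 0 2 7 - t 0 3 5 + t 0 4 6 + t 2 3 4 + t 2 5 6 + t 3 6 7 + t 4 5 7 = 0"
    "t 0 1 7 + t 0 3 6 + t 0 4 5 - t 1 3 4 - t 1 5 6 + t 3 5 7 - t 4 6 7 = 0"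
    "t 0 1 5 - t 0 2 6 - t 0 4 7 + t 1 2 4 - t 1 6 7 - t 2 5 7 + t 4 5 6 = 0"
    "- t 0 1 6 - t 0 2 5 + t 0 3 7 - t 1 2 3 - t 1 5 7 + t 2 6 7 - t 3 5 6 = 0"
    "- t 0 1 3 + t 0 2 4 - t 0 6 7 + t 1 2 6 + t 1 4 7 + t 2 3 7 + t 3 4 6 = 0"
    "t 0 1 4 + t 0 2 3 + t 0 5 7 - t 1 2 5 + t 1 3 7 - t 2 4 7 - t 3 4 5 = 0"
    "- t 0 1 2 - t 0 3 4 - t 0 5 6 - t 1 3 6 - t 1 4 5 - t 2 3 5 + t 2 4 6 = 0"
  using t_psi_contr[of 0] t_psi_contr[of 1] t_psi_contr[of 2] t_psi_contr[of 3] t_psi_contr[of 4] t_psi_contr[of 5] t_psi_contr[of 6] t_psi_contr[of 7]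
  by (simp_all add: sum_lessThan_8 contr_sort contr_diag t_contr t_sort t_eq del: One_nat_def)

abbreviation "tdef i m x \<equiv> contr (\<lambda>a b. t a b i) m x + contr (\<lambda>a b. t a b m) x i
    + contr (\<lambda>a b. t a b x) i m - 2 * t i m x"

text \<open>The 56 increasing triples are treated in seven batches of eight. Each component of the
  defect \<open>tdef\<close> is a linear consequence of \<open>t_psi_eval\<close>.\<close>

lemma t_48_eval_0:
  "tdef 0 1 2 = 0" "tdef 0 1 3 = 0" "tdef 0 1 4 = 0" "tdef 0 1 5 = 0"
  "tdef 0 1 6 = 0" "tdef 0 1 7 = 0" "tdef 0 2 3 = 0" "tdef 0 2 4 = 0"
  by (simp_all add: contr_sort t_contr t_sort t_eq del: One_nat_def, (insert t_psi_eval, linarith)+)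

lemma t_48_eval_1:
  "tdef 0 2 5 = 0" "tdef 0 2 6 = 0" "tdef 0 2 7 = 0" "tdef 0 3 4 = 0"
  "tdef 0 3 5 = 0" "tdef 0 3 6 = 0" "tdef 0 3 7 = 0" "tdef 0 4 5 = 0"
  by (simp_all add: contr_sort t_contr t_sort t_eq del: One_nat_def, (insert t_psi_eval, linarith)+)

lemma t_48_eval_2:
  "tdef 0 4 6 = 0" "tdef 0 4 7 = 0" "tdef 0 5 6 = 0" "tdef 0 5 7 = 0"
  "tdef 0 6 7 = 0" "tdef 1 2 3 = 0" "tdef 1 2 4 = 0" "tdef 1 2 5 = 0"
  by (simp_all add: contr_sort t_contr t_sort t_eq del: One_nat_def, (insert t_psi_eval, linarith)+)

lemma t_48_eval_3:
  "tdef 1 2 6 = 0" "tdef 1 2 7 = 0" "tdef 1 3 4 = 0" "tdef 1 3 5 = 0"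
  "tdef 1 3 6 = 0" "tdef 1 3 7 = 0" "tdef 1 4 5 = 0" "tdef 1 4 6 = 0"
  by (simp_all add: contr_sort t_contr t_sort t_eq del: One_nat_def, (insert t_psi_eval, linarith)+)

lemma t_48_eval_4:
  "tdef 1 4 7 = 0" "tdef 1 5 6 = 0" "tdef 1 5 7 = 0" "tdef 1 6 7 = 0"
  "tdef 2 3 4 = 0" "tdef 2 3 5 = 0" "tdef 2 3 6 = 0" "tdef 2 3 7 = 0"
  by (simp_all add: contr_sort t_contr t_sort t_eq del: One_nat_def, (insert t_psi_eval, linarith)+)

lemma t_48_eval_5:
  "tdef 2 4 5 = 0" "tdef 2 4 6 = 0" "tdef 2 4 7 = 0" "tdef 2 5 6 = 0"
  "tdef 2 5 7 = 0" "tdef 2 6 7 = 0" "tdef 3 4 5 = 0" "tdef 3 4 6 = 0"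
  by (simp_all add: contr_sort t_contr t_sort t_eq del: One_nat_def, (insert t_psi_eval, linarith)+)

lemma t_48_eval_6:
  "tdef 3 4 7 = 0" "tdef 3 5 6 = 0" "tdef 3 5 7 = 0" "tdef 3 6 7 = 0"
  "tdef 4 5 6 = 0" "tdef 4 5 7 = 0" "tdef 4 6 7 = 0" "tdef 5 6 7 = 0"
  by (simp_all add: contr_sort t_contr t_sort t_eq del: One_nat_def, (insert t_psi_eval, linarith)+)

lemmas t_48_eval = t_48_eval_0 t_48_eval_1 t_48_eval_2 t_48_eval_3 t_48_eval_4 t_48_eval_5 t_48_eval_6

text \<open>The cyclic sum of contractions is equivariant under Spin(7), hence a scalar on the
  irreducible type 48. The scalar is 2, which is confirmed component by component.\<close>

lemma t_48:
  assumes "i < 8" "m < 8" "x < 8"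
  shows "contr (\<lambda>a b. t a b i) m x + contr (\<lambda>a b. t a b m) x i + contr (\<lambda>a b. t a b x) i m = 2 * t i m x"
proof -
  have "tdef i m x = 0"
  proof (rule skew3_zeroI[of tdef])
    fix i m x :: nat assume "i < m" "m < x" "x < 8"
    moreover have "\<forall>x<8. \<forall>m<x. \<forall>i<m. tdef i m x = 0"
      unfolding all_triples_8 by (intro conjI t_48_eval)
    ultimately show "tdef i m x = 0" by blast
  next
    fix i m x
    show "tdef m i x = - tdef i m x"
      using contr_skew[of _ x i] contr_skew[of _ x m] contr_skew[of _ m i] t_skew(1)[of m i x] by simp
    show "tdef i x m = - tdef i m x"
      using contr_skew[of _ x i] contr_skew[of _ x m] contr_skew[of _ m i] t_skew(2)[of i x m] by simp
  qed (use assms in auto)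
  then show ?thesis by simp
qed

end

text \<open>A skew matrix that annihilates \<open>\<psi>\<close> lies in the Lie algebra spin(7), which is the eigenspace for
  the eigenvalue 2 of the contraction with \<open>\<psi>\<close>.\<close>

lemma stabilizer_eigen:
  assumes B: "\<And>a b. B b a = - B a b"
    and ann: "\<And>p q r s. p < 8 \<Longrightarrow> q < 8 \<Longrightarrow> r < 8 \<Longrightarrow> s < 8 \<Longrightarrow>
      (\<Sum>a<8. B p a * \<psi> a q r s) + (\<Sum>a<8. B q a * \<psi> p a r s)
      + (\<Sum>a<8. B r a * \<psi> p q a s) + (\<Sum>a<8. B s a * \<psi> p q r a) = 0"
    and kl: "k < 8" "l < 8"
  shows "contr B k l = 2 * B k l"
proof -
  note B_ev = skew_diag[of B, OF B] skew_sort[of B, OF B]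
  have ev:
    "contr B 0 1 = 2 * B 0 1"
    "contr B 0 2 = 2 * B 0 2"
    "contr B 0 3 = 2 * B 0 3"
    "contr B 0 4 = 2 * B 0 4"
    "contr B 0 5 = 2 * B 0 5"
    "contr B 0 6 = 2 * B 0 6"
    "contr B 0 7 = 2 * B 0 7"
    "contr B 1 2 = 2 * B 1 2"
    "contr B 1 3 = 2 * B 1 3"
    "contr B 1 4 = 2 * B 1 4"
    "contr B 1 5 = 2 * B 1 5"
    "contr B 1 6 = 2 * B 1 6"
    "contr B 1 7 = 2 * B 1 7"
    "contr B 2 3 = 2 * B 2 3"
    "contr B 2 4 = 2 * B 2 4"
    "contr B 2 5 = 2 * B 2 5"
    "contr B 2 6 = 2 * B 2 6"
    "contr B 2 7 = 2 * B 2 7"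
    "contr B 3 4 = 2 * B 3 4"
    "contr B 3 5 = 2 * B 3 5"
    "contr B 3 6 = 2 * B 3 6"
    "contr B 3 7 = 2 * B 3 7"
    "contr B 4 5 = 2 * B 4 5"
    "contr B 4 6 = 2 * B 4 6"
    "contr B 4 7 = 2 * B 4 7"
    "contr B 5 6 = 2 * B 5 6"
    "contr B 5 7 = 2 * B 5 7"
    "contr B 6 7 = 2 * B 6 7"
    \<comment> \<open>Each of these quadruples has vanishing \<psi>, and the annihilation there is a
      relation among four entries of B, one of them B 0 d. The seven relations belong to the seven
      values of d from 1 to 7 and are the linear equations of spin(7) inside so(8).\<close>
    using ann[of 0 1 2 3]
      ann[of 0 1 2 4]
      ann[of 0 1 2 5]
      ann[of 0 1 2 6]
      ann[of 0 1 3 4]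
      ann[of 0 1 3 6]
      ann[of 0 2 3 4]
    by (simp_all add: sum_lessThan_8 psi_eval B_ev contr_eval[of B, OF B] del: One_nat_def)
  have sorted: "contr B k l = 2 * B k l" if "k < l" "l < 8" for k l
  proof -
    have "\<forall>l<8. \<forall>k<l. contr B k l = 2 * B k l"
      unfolding all_pairs_8 by (intro conjI ev)
    then show ?thesis using that by blast
  qed
  consider "k < l" | "l < k" | "k = l" by linarith
  then show ?thesis
    using sorted[of k l] sorted[of l k] kl contr_skew[of B k l] contr_diag[of B k] B[of k l] B[of k k] by cases auto
qed

end

context spin7_array
begin

text \<open>Hence a form \<open>t\<close> of type 48, contracted over one index with \<open>\<psi>\<close>, is orthogonal to spin(7).\<close>

lemma t_spin7_orthogonal:
  assumes t_skew: "\<And>i j k. t j i k = - t i j k" "\<And>i j k. t i k j = - t i j k"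
    and t_psi: "\<And>d. d < 8 \<Longrightarrow> (\<Sum>a<8. \<Sum>b<8. \<Sum>c<8. t a b c * \<psi> a b c d) = 0"
    and F: "\<And>a b. F b a = - F a b" and F_eig: "\<And>k l. k < 8 \<Longrightarrow> l < 8 \<Longrightarrow> contr F k l = 2 * F k l"
    and x: "x < 8"
  shows "(\<Sum>i<8. \<Sum>m<8. F i m * contr (\<lambda>a b. t a b i) m x) = 0"
proof -
  let ?P = "\<lambda>i m x. contr (\<lambda>a b. t a b i) m x"
  \<comment> \<open>Pair \<open>t_48\<close> with F. The first two terms agree since both F and the
    contraction are skew; in the third, \<open>contr\<close> moves onto F, where it is
    multiplication by 2, and reproduces the right side. So twice the first term is zero.\<close>
  have "(\<Sum>i<8. \<Sum>m<8. F i m * (?P i m x + ?P m x i + ?P x i m)) = (\<Sum>i<8. \<Sum>m<8. F i m * (2 * t i m x))"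
    by (intro sum.cong refl) (subst t_48[OF t_skew t_psi], auto simp: x)
  moreover have "(\<Sum>i<8. \<Sum>m<8. F i m * ?P m x i) = (\<Sum>i<8. \<Sum>m<8. F i m * ?P i m x)"
  proof -
    have "(\<Sum>i<8. \<Sum>m<8. F i m * ?P m x i) = (\<Sum>m<8. \<Sum>i<8. F i m * ?P m x i)" by (rule sum.swap)
    also have "\<dots> = (\<Sum>m<8. \<Sum>i<8. F m i * ?P m i x)"
    proof (intro sum.cong refl)
      fix m i show "F i m * ?P m x i = F m i * ?P m i x" using F[of m i] contr_skew[of _ x i] by simp
    qed
    finally show ?thesis .
  qed
  moreover have "(\<Sum>i<8. \<Sum>m<8. F i m * ?P x i m) = (\<Sum>i<8. \<Sum>m<8. F i m * (2 * t i m x))"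
  proof -
    have "(\<Sum>i<8. \<Sum>m<8. F i m * ?P x i m) = (\<Sum>i<8. \<Sum>m<8. \<Sum>a<8. \<Sum>b<8. F i m * (t a b x * \<psi> a b i m))"
      by (simp add: contr_def sum_distrib_left)
    also have "\<dots> = (\<Sum>b<8. \<Sum>a<8. \<Sum>i<8. \<Sum>m<8. F i m * (t a b x * \<psi> a b i m))"
      by (subst sum_rot4, rule sum.cong[OF refl], rule sum_rot3)
    also have "\<dots> = (\<Sum>a<8. \<Sum>b<8. \<Sum>i<8. \<Sum>m<8. F i m * (t a b x * \<psi> a b i m))" by (rule sum.swap)
    also have "\<dots> = (\<Sum>a<8. \<Sum>b<8. t a b x * contr F a b)"
      unfolding contr_def sum_distrib_left
      by (intro sum.cong refl) (simp add: psi_pair[of _ _ _ _] mult.left_commute)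
    also have "\<dots> = (\<Sum>a<8. \<Sum>b<8. F a b * (2 * t a b x))"
      by (intro sum.cong refl) (simp add: F_eig)
    finally show ?thesis .
  qed
  ultimately show ?thesis by (simp add: distrib_left sum.distrib)
qed

text \<open>Pairing \<open>t_48\<close> with t itself: the three cyclic terms contribute
  equally.\<close>

lemma t_norm:
  assumes t_skew: "\<And>i j k. t j i k = - t i j k" "\<And>i j k. t i k j = - t i j k"
    and t_psi: "\<And>d. d < 8 \<Longrightarrow> (\<Sum>a<8. \<Sum>b<8. \<Sum>c<8. t a b c * \<psi> a b c d) = 0"
  shows "3 * (\<Sum>i<8. \<Sum>m<8. \<Sum>x<8. t i m x * contr (\<lambda>a b. t a b i) m x)
    = 2 * (\<Sum>i<8. \<Sum>m<8. \<Sum>x<8. t i m x * t i m x)"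
proof -
  let ?P = "\<lambda>i m x. contr (\<lambda>a b. t a b i) m x"
  let ?f = "\<lambda>i m x. t i m x * ?P i m x"
  have cyc: "t m x i = t i m x" for i m x using t_skew(1)[of i m x] t_skew(2)[of m i x] by simp
  have "(\<Sum>i<8. \<Sum>m<8. \<Sum>x<8. ?f m x i) = (\<Sum>i<8. \<Sum>m<8. \<Sum>x<8. ?f i m x)"
    by (rule sum_cyc3)
  moreover have "(\<Sum>i<8. \<Sum>m<8. \<Sum>x<8. ?f x i m) = (\<Sum>i<8. \<Sum>m<8. \<Sum>x<8. ?f i m x)"
    using sum_cyc3[of "\<lambda>i m x. ?f x i m" "{..<8}"] by simp
  moreover have "(\<Sum>i<8. \<Sum>m<8. \<Sum>x<8. ?f i m x + ?f m x i + ?f x i m)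
      = (\<Sum>i<8. \<Sum>m<8. \<Sum>x<8. 2 * (t i m x * t i m x))"
  proof (intro sum.cong refl)
    fix i m x :: nat assume "i \<in> {..<8}" "m \<in> {..<8}" "x \<in> {..<8}"
    then have "?P i m x + ?P m x i + ?P x i m = 2 * t i m x" using t_48[OF t_skew t_psi] by simp
    then have "t i m x * (?P i m x + ?P m x i + ?P x i m) = 2 * (t i m x * t i m x)" by simp
    then show "?f i m x + ?f m x i + ?f x i m = 2 * (t i m x * t i m x)"
      using cyc[of m x i] cyc[of i m x] by (simp add: distrib_left)
  qed
  ultimately show ?thesis unfolding sum.distrib sum_distrib_left[symmetric] by simp
qed

end

text \<open>The values, in an adapted frame at a point, of the torsion \<open>t\<close>, its covariant derivative \<open>dt\<close> and
  the curvature \<open>r\<close>, subject to the first Bianchi identity with \<open>d\<^sup>\<nabla>T = 0\<close>.\<close>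

locale instanton_array = spin7_array +
  fixes t :: "nat \<Rightarrow> nat \<Rightarrow> nat \<Rightarrow> real" and dt r :: "nat \<Rightarrow> nat \<Rightarrow> nat \<Rightarrow> nat \<Rightarrow> real"
  assumes t_skew: "\<And>i j k. t j i k = - t i j k" "\<And>i j k. t i k j = - t i j k"
    and t_psi: "\<And>d. d < 8 \<Longrightarrow> (\<Sum>a<8. \<Sum>b<8. \<Sum>c<8. t a b c * \<psi> a b c d) = 0"
    and dt_skew: "\<And>m i j k. dt m j i k = - dt m i j k" "\<And>m i j k. dt m i k j = - dt m i j k"
    and dt_psi: "\<And>m d. d < 8 \<Longrightarrow> (\<Sum>a<8. \<Sum>b<8. \<Sum>c<8. dt m a b c * \<psi> a b c d) = 0"
    and dt_closed: "\<And>i j k l. dt i j k l + dt j k i l + dt k i j l = dt l i j k"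
    and r_skew: "\<And>i j k l. r j i k l = - r i j k l" "\<And>i j k l. r i j l k = - r i j k l"
    and bianchi: "\<And>i j k l. r i j k l + r j k i l + r k i j l = dt l i j k
      + (\<Sum>s<8. t i j s * t s k l + t j k s * t s i l + t k i s * t s j l)"
    and instanton: "\<And>i j k l. k < 8 \<Longrightarrow> l < 8 \<Longrightarrow> contr (\<lambda>a b. r a b i j) k l = 2 * r k l i j"
    and holonomy: "\<And>i j k l. k < 8 \<Longrightarrow> l < 8 \<Longrightarrow> contr (\<lambda>a b. r i j a b) k l = 2 * r i j k l"
begin

text \<open>The components of the 4-form \<sigma>^T in an orthonormal frame.\<close>

definition \<sigma> :: "nat \<Rightarrow> nat \<Rightarrow> nat \<Rightarrow> nat \<Rightarrow> real" where
  "\<sigma> i j k l = (\<Sum>s<8. t i j s * t s k l + t j k s * t s i l + t k i s * t s j l)"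

lemma t_cyc: "t i j k = t j k i"
  using t_skew(1)[of i j k] t_skew(2)[of j i k] by simp

lemma sigma_skew: "\<sigma> l i j k = - \<sigma> i j k l"
  unfolding \<sigma>_def sum_negf[symmetric]
proof (rule sum.cong[OF refl])
  fix s
  show "t l i s * t s j k + t i j s * t s l k + t j l s * t s i k
    = - (t i j s * t s k l + t j k s * t s i l + t k i s * t s j l)"
    unfolding t_cyc[of s, symmetric]
    using t_skew(2)[of s l i] t_skew(2)[of s l k] t_skew(2)[of s k i] by simp
qed

lemma bianchi_first: "r i j k l + r j k i l + r k i j l = dt l i j k + \<sigma> i j k l"
  unfolding \<sigma>_def by (rule bianchi)

text \<open>Write S(i,j,k,l) for the left side of \<open>bianchi_first\<close>. By the skewness of r
  within its pairs, twice the present left side is S(i,j,k,l) + S(j,k,l,i) + S(k,l,i,j) -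
  S(l,i,j,k). The corresponding \<sigma> terms add up to 2 \<open>\<sigma> i j k l\<close>, and
  \<open>dt_closed\<close> reduces the four derivatives to 2 \<open>dt i j k l\<close>.\<close>

lemma bianchi_last: "r i j k l + r i k l j + r i l j k = \<sigma> i j k l + dt i j k l"
  using bianchi_first[of i j k l] bianchi_first[of j k l i] bianchi_first[of k l i j] bianchi_first[of l i j k]
    sigma_skew[of l i j k] sigma_skew[of k l i j] sigma_skew[of j k l i] dt_closed[of i j k l]
    r_skew(1)[of i k j l] r_skew(2)[of i k j l] r_skew(2)[of j k l i] r_skew(2)[of k l j i] r_skew(2)[of l j k i]
    r_skew(1)[of l i k j] r_skew(2)[of i l k j] r_skew(1)[of l i j k] r_skew(2)[of i j l k] r_skew(1)[of j l i k]
    dt_skew(2)[of j k l i] dt_skew(1)[of k l i j] dt_skew(2)[of k i l j]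
  by linarith

text \<open>Contract \<open>bianchi_first\<close> with \<psi>. By \<open>instanton\<close> each of
  the three curvature terms is twice the Ricci trace, and \<open>dt_psi\<close> removes the
  derivative.\<close>

lemma ricci_sigma1:
  assumes j: "j < 8"
  shows "6 * (\<Sum>c<8. r c j c i) = (\<Sum>a<8. \<Sum>b<8. \<Sum>c<8. \<sigma> a b c i * \<psi> a b c j)"
proof -
  let ?f = "\<lambda>a b c. r a b c i * \<psi> a b c j"
  have "(\<Sum>a<8. \<Sum>b<8. \<Sum>c<8. ?f a b c) = (\<Sum>c<8. \<Sum>a<8. \<Sum>b<8. ?f a b c)" by (rule sum_rot3)
  also have "\<dots> = (\<Sum>c<8. 2 * r c j c i)"
    using j by (intro sum.cong refl) (simp add: instanton[symmetric] contr_def)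
  finally have f: "(\<Sum>a<8. \<Sum>b<8. \<Sum>c<8. ?f a b c) = 2 * (\<Sum>c<8. r c j c i)" by (simp add: sum_distrib_left)
  have c1: "(\<Sum>a<8. \<Sum>b<8. \<Sum>c<8. ?f b c a) = (\<Sum>a<8. \<Sum>b<8. \<Sum>c<8. ?f a b c)" by (rule sum_cyc3)
  have c2: "(\<Sum>a<8. \<Sum>b<8. \<Sum>c<8. ?f c a b) = (\<Sum>a<8. \<Sum>b<8. \<Sum>c<8. ?f a b c)"
    using sum_cyc3[of "\<lambda>a b c. ?f c a b" "{..<8}"] by simp
  have "(\<Sum>a<8. \<Sum>b<8. \<Sum>c<8. \<sigma> a b c i * \<psi> a b c j) + (\<Sum>a<8. \<Sum>b<8. \<Sum>c<8. dt i a b c * \<psi> a b c j)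
      = (\<Sum>a<8. \<Sum>b<8. \<Sum>c<8. ?f a b c + ?f b c a + ?f c a b)"
    unfolding sum.distrib[symmetric]
  proof (intro sum.cong refl)
    fix a b c
    have "(r a b c i + r b c a i + r c a b i) * \<psi> a b c j = (dt i a b c + \<sigma> a b c i) * \<psi> a b c j"
      using bianchi_first[of a b c i] by simp
    then show "\<sigma> a b c i * \<psi> a b c j + dt i a b c * \<psi> a b c j = ?f a b c + ?f b c a + ?f c a b"
      by (simp add: psi_cyc[of b c a j] psi_cyc[of c a b j] distrib_right left_diff_distrib)
  qed
  then show ?thesis using dt_psi[OF j, of i] c1 c2 f by (simp add: sum.distrib)
qed

text \<open>The same contraction of \<open>bianchi_last\<close>, now with \<open>holonomy\<close>
  acting on the second pair. It yields the transposed trace with the same right side, hence the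
  symmetry of the Ricci tensor.\<close>

lemma ricci_sigma2:
  assumes j: "j < 8"
  shows "6 * (\<Sum>c<8. r c i c j) = (\<Sum>a<8. \<Sum>b<8. \<Sum>c<8. \<sigma> a b c i * \<psi> a b c j)"
proof -
  let ?f = "\<lambda>a b c. r i a b c * \<psi> a b c j"
  have "(\<Sum>a<8. \<Sum>b<8. \<Sum>c<8. ?f a b c) = (\<Sum>a<8. - (\<Sum>b<8. \<Sum>c<8. r i a b c * \<psi> b c j a))"
  proof -
    have "\<psi> a b c j = - \<psi> b c j a" for a b c
      using psi_cyc[of b c a j] psi_skew(3)[of b c a j] by linarith
    then have "?f a b c = - (r i a b c * \<psi> b c j a)" for a b c
      by (simp only: mult_minus_right)
    then show ?thesis by (simp add: sum_negf)
  qed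
  also have "\<dots> = (\<Sum>a<8. - (2 * r i a j a))"
    using j by (intro sum.cong refl) (simp add: holonomy[symmetric] contr_def)
  also have "\<dots> = - 2 * (\<Sum>a<8. r a i a j)"
  proof -
    have "r i a j a = r a i a j" for a using r_skew(1)[of i a j a] r_skew(2)[of a i j a] by linarith
    then show ?thesis by (simp add: sum_distrib_left sum_negf)
  qed
  finally have f: "(\<Sum>a<8. \<Sum>b<8. \<Sum>c<8. ?f a b c) = - 2 * (\<Sum>c<8. r c i c j)" .
  have c1: "(\<Sum>a<8. \<Sum>b<8. \<Sum>c<8. ?f b c a) = (\<Sum>a<8. \<Sum>b<8. \<Sum>c<8. ?f a b c)" by (rule sum_cyc3)
  have c2: "(\<Sum>a<8. \<Sum>b<8. \<Sum>c<8. ?f c a b) = (\<Sum>a<8. \<Sum>b<8. \<Sum>c<8. ?f a b c)"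
    using sum_cyc3[of "\<lambda>a b c. ?f c a b" "{..<8}"] by simp
  have "(\<Sum>a<8. \<Sum>b<8. \<Sum>c<8. - (\<sigma> a b c i * \<psi> a b c j)) + (\<Sum>a<8. \<Sum>b<8. \<Sum>c<8. dt i a b c * \<psi> a b c j)
      = (\<Sum>a<8. \<Sum>b<8. \<Sum>c<8. ?f a b c + ?f b c a + ?f c a b)"
    unfolding sum.distrib[symmetric]
  proof (intro sum.cong refl)
    fix a b c
    have "(r i a b c + r i b c a + r i c a b) * \<psi> a b c j = (- \<sigma> a b c i + dt i a b c) * \<psi> a b c j"
      using bianchi_last[of i a b c] sigma_skew[of i a b c] by simp
    then show "- (\<sigma> a b c i * \<psi> a b c j) + dt i a b c * \<psi> a b c j = ?f a b c + ?f b c a + ?f c a b"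
      by (simp add: psi_cyc[of b c a j] psi_cyc[of c a b j] distrib_right left_diff_distrib)
  qed
  then show ?thesis using dt_psi[OF j, of i] c1 c2 f by (simp add: sum.distrib sum_negf)
qed

lemma ricci_sym: "j < 8 \<Longrightarrow> (\<Sum>c<8. r c i c j) = (\<Sum>c<8. r c j c i)"
  using ricci_sigma1[of j i] ricci_sigma2[of j i] by simp

text \<open>Trace \<open>ricci_sigma1\<close> over i = j. The three products in \<sigma> contribute
  equally, so six times the double trace is 3 times the sum in \<open>t_norm\<close>, that is 3
  (2/3) |t|^2.\<close>

lemma scalar_curvature:
  "3 * (\<Sum>k<8. \<Sum>l<8. r k l k l) = (\<Sum>i<8. \<Sum>j<8. \<Sum>k<8. t i j k * t i j k)"
proof -
  have s: "(\<Sum>a<8. \<Sum>b<8. \<Sum>c<8. \<sigma> a b c i * \<psi> a b c i)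
      = 3 * (\<Sum>a<8. \<Sum>b<8. \<Sum>c<8. \<Sum>s<8. t a b s * t s c i * \<psi> a b c i)" for i
  proof -
    let ?f = "\<lambda>a b c. \<Sum>s<8. t a b s * t s c i * \<psi> a b c i"
    have c1: "(\<Sum>a<8. \<Sum>b<8. \<Sum>c<8. ?f b c a) = (\<Sum>a<8. \<Sum>b<8. \<Sum>c<8. ?f a b c)" by (rule sum_cyc3)
    have c2: "(\<Sum>a<8. \<Sum>b<8. \<Sum>c<8. ?f c a b) = (\<Sum>a<8. \<Sum>b<8. \<Sum>c<8. ?f a b c)"
      using sum_cyc3[of "\<lambda>a b c. ?f c a b" "{..<8}"] by simp
    have "\<sigma> a b c i * \<psi> a b c i = ?f a b c + ?f b c a + ?f c a b" for a b c
      unfolding \<sigma>_def sum_distrib_right sum.distrib[symmetric]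
      by (intro sum.cong refl) (simp add: psi_cyc[of b c a i] psi_cyc[of c a b i] distrib_right)
    then show ?thesis using c1 c2 by (simp add: sum.distrib)
  qed
  have "6 * (\<Sum>i<8. \<Sum>c<8. r c i c i) = (\<Sum>i<8. \<Sum>a<8. \<Sum>b<8. \<Sum>c<8. \<sigma> a b c i * \<psi> a b c i)"
    unfolding sum_distrib_left[of 6 "\<lambda>i. \<Sum>c<8. r c i c i"] by (intro sum.cong refl ricci_sigma1) simp
  also have "\<dots> = 3 * (\<Sum>i<8. \<Sum>a<8. \<Sum>b<8. \<Sum>c<8. \<Sum>s<8. t a b s * t s c i * \<psi> a b c i)"
    by (simp only: s sum_distrib_left)
  also have "(\<Sum>i<8. \<Sum>a<8. \<Sum>b<8. \<Sum>c<8. \<Sum>s<8. t a b s * t s c i * \<psi> a b c i)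
      = (\<Sum>c<8. \<Sum>s<8. \<Sum>i<8. \<Sum>a<8. \<Sum>b<8. t a b s * t s c i * \<psi> a b c i)"
    by (subst sum_rot5, subst sum_rot5, rule refl)
  also have "\<dots> = (\<Sum>s<8. \<Sum>c<8. \<Sum>i<8. \<Sum>a<8. \<Sum>b<8. t a b s * t s c i * \<psi> a b c i)"
    by (rule sum.swap)
  also have "\<dots> = (\<Sum>s<8. \<Sum>c<8. \<Sum>i<8. t s c i * contr (\<lambda>a b. t a b s) c i)"
    unfolding contr_def sum_distrib_left by (intro sum.cong refl) simp
  finally have "6 * (\<Sum>i<8. \<Sum>c<8. r c i c i) = 2 * (\<Sum>i<8. \<Sum>j<8. \<Sum>k<8. t i j k * t i j k)"
    using t_norm[OF t_skew t_psi] by simp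
  moreover have "(\<Sum>i<8. \<Sum>c<8. r c i c i) = (\<Sum>k<8. \<Sum>l<8. r k l k l)" by (rule sum.swap)
  ultimately show ?thesis by simp
qed

text \<open>The Gram matrix M of t is symmetric, and each of the three products in \<sigma> pairs it
  with a skew pair of indices of t.\<close>

lemma t_sigma: "(\<Sum>s<8. \<Sum>j<8. \<Sum>k<8. t s j k * \<sigma> i s j k) = 0"
proof -
  define M where "M s u = (\<Sum>j<8. \<Sum>k<8. t s j k * t u j k)" for s u
  have M: "M u s = M s u" for s u unfolding M_def by (intro sum.cong refl mult.commute)
  have M': "(\<Sum>s<8. \<Sum>j<8. t s j k * t s j u) = M k u" for k u
    unfolding M_def by (intro sum.cong refl) (simp only: t_cyc[of k] t_cyc[of u])
  have "(\<Sum>s<8. \<Sum>j<8. \<Sum>k<8. \<Sum>u<8. t s j k * (t i s u * t u j k)) = (\<Sum>s<8. \<Sum>u<8. t i s u * M s u)"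
    unfolding M_def sum_distrib_left
    by (rule sum.cong[OF refl], subst sum_rot3, intro sum.cong refl mult.left_commute)
  also have "\<dots> = 0" by (rule sum_skew_sym) (rule t_skew(2), rule M)
  finally have 1: "(\<Sum>s<8. \<Sum>j<8. \<Sum>k<8. \<Sum>u<8. t s j k * (t i s u * t u j k)) = 0" .
  have "(\<Sum>s<8. \<Sum>j<8. \<Sum>k<8. \<Sum>u<8. t s j k * (t s j u * t u i k)) = (\<Sum>k<8. \<Sum>u<8. \<Sum>s<8. \<Sum>j<8. t s j k * (t s j u * t u i k))"
    by (subst sum_rot4, subst sum_rot4, rule refl)
  also have "\<dots> = (\<Sum>k<8. \<Sum>u<8. t u i k * M k u)"
    unfolding M'[symmetric] sum_distrib_left by (intro sum.cong refl) simp
  also have "\<dots> = 0"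
  proof (rule sum_skew_sym)
    fix k u show "t k i u = - t u i k" using t_cyc[of k i u] t_skew(1)[of u i k] t_skew(2)[of u i k] t_cyc[of u k i] t_skew(1)[of i k u] t_skew(2)[of i u k] t_cyc[of u i k] by simp
  qed (rule M)
  finally have 2: "(\<Sum>s<8. \<Sum>j<8. \<Sum>k<8. \<Sum>u<8. t s j k * (t s j u * t u i k)) = 0" .
  have "(\<Sum>s<8. \<Sum>j<8. \<Sum>k<8. \<Sum>u<8. t s j k * (t j i u * t u s k)) = (\<Sum>j<8. \<Sum>s<8. \<Sum>k<8. \<Sum>u<8. t s j k * (t j i u * t u s k))"
    by (rule sum.swap)
  also have "\<dots> = (\<Sum>j<8. \<Sum>u<8. t i j u * M j u)"
    unfolding M_def sum_distrib_left
  proof (rule sum.cong[OF refl], subst sum_rot3, intro sum.cong refl)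
    fix j u s k
    have "t s j k = - t j s k" "t j i u = - t i j u" by (rule t_skew(1))+
    then show "t s j k * (t j i u * t u s k) = t i j u * (t j s k * t u s k)" by simp
  qed
  also have "\<dots> = 0" by (rule sum_skew_sym) (rule t_skew(2), rule M)
  finally have 3: "(\<Sum>s<8. \<Sum>j<8. \<Sum>k<8. \<Sum>u<8. t s j k * (t j i u * t u s k)) = 0" .
  have "(\<Sum>s<8. \<Sum>j<8. \<Sum>k<8. t s j k * \<sigma> i s j k)
      = (\<Sum>s<8. \<Sum>j<8. \<Sum>k<8. \<Sum>u<8. t s j k * (t i s u * t u j k) + t s j k * (t s j u * t u i k) + t s j k * (t j i u * t u s k))"
    unfolding \<sigma>_def sum_distrib_left by (simp add: distrib_left)
  then show ?thesis using 1 2 3 by (simp add: sum.distrib)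
qed

text \<open>Contraction of \<open>bianchi_last\<close> with t: its three curvature terms become
  equal and the \<sigma> term vanishes by \<open>t_sigma\<close>.\<close>

lemma t_r: "3 * (\<Sum>s<8. \<Sum>j<8. \<Sum>k<8. t s j k * r i s j k) = (\<Sum>s<8. \<Sum>j<8. \<Sum>k<8. t s j k * dt i s j k)"
proof -
  let ?f = "\<lambda>s j k. t s j k * r i s j k"
  have c1: "(\<Sum>a<8. \<Sum>b<8. \<Sum>c<8. ?f b c a) = (\<Sum>a<8. \<Sum>b<8. \<Sum>c<8. ?f a b c)" by (rule sum_cyc3)
  have c2: "(\<Sum>a<8. \<Sum>b<8. \<Sum>c<8. ?f c a b) = (\<Sum>a<8. \<Sum>b<8. \<Sum>c<8. ?f a b c)"
    using sum_cyc3[of "\<lambda>a b c. ?f c a b" "{..<8}"] by simp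
  have "t a b c * \<sigma> i a b c + t a b c * dt i a b c = ?f a b c + ?f b c a + ?f c a b" for a b c
    using arg_cong[OF bianchi_last[of i a b c], of "(*) (t a b c)"] t_cyc[of a b c] t_cyc[of c a b]
    by (simp add: distrib_left)
  then have "(\<Sum>a<8. \<Sum>b<8. \<Sum>c<8. t a b c * \<sigma> i a b c) + (\<Sum>a<8. \<Sum>b<8. \<Sum>c<8. t a b c * dt i a b c)
      = (\<Sum>a<8. \<Sum>b<8. \<Sum>c<8. ?f a b c + ?f b c a + ?f c a b)"
    unfolding sum.distrib[symmetric] by simp
  then show ?thesis using t_sigma[of i] c1 c2 by (simp add: sum.distrib)
qed

text \<open>Contracting \<open>bianchi_last\<close> with dt expresses three times the assumed sum as
  |dt|^2 plus the pairing of dt with \<sigma>. That pairing vanishes, which leaves a sum of squares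
  equal to zero.\<close>

lemma dt_zero:
  assumes "(\<Sum>m<8. \<Sum>s<8. \<Sum>j<8. \<Sum>k<8. dt m s j k * r m s j k) = 0" "m < 8" "s < 8" "j < 8" "k < 8"
  shows "dt m s j k = 0"
proof -
  let ?f = "\<lambda>m s j k. dt m s j k * r m s j k"
  have dcyc: "dt m j k i = dt m i j k" for m i j k
    using dt_skew(1)[of m i j k] dt_skew(2)[of m j i k] by simp
  have c: "(\<Sum>a<8. \<Sum>b<8. \<Sum>c<8. ?f m a b c + ?f m b c a + ?f m c a b) = 3 * (\<Sum>a<8. \<Sum>b<8. \<Sum>c<8. ?f m a b c)" for m
    using sum_cyc3[of "?f m" "{..<8}"] sum_cyc3[of "\<lambda>a b c. ?f m c a b" "{..<8}"] by (simp add: sum.distrib)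
  have e: "dt m a b c * \<sigma> m a b c + dt m a b c * dt m a b c = ?f m a b c + ?f m b c a + ?f m c a b" for m a b c
    using arg_cong[OF bianchi_last[of m a b c], of "(*) (dt m a b c)"] dcyc[of m a b c] dcyc[of m c a b]
    by (simp add: distrib_left)
  let ?Y = "\<Sum>m<8. \<Sum>a<8. \<Sum>b<8. \<Sum>c<8. dt m a b c * \<sigma> m a b c"
  have "?Y + (\<Sum>m<8. \<Sum>a<8. \<Sum>b<8. \<Sum>c<8. dt m a b c * dt m a b c)
      = 3 * (\<Sum>m<8. \<Sum>s<8. \<Sum>j<8. \<Sum>k<8. dt m s j k * r m s j k)"
    unfolding sum.distrib[symmetric] e c sum_distrib_left[symmetric] ..
  \<comment> \<open>Multiply \<open>dt_closed\<close> by \<sigma> and sum. Because \<sigma> only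
    changes by a sign under rotation, relabelling turns the equation into 3 Y = - Y.\<close>
  moreover have "?Y = 0"
  proof -
    let ?h = "\<lambda>m a b c. dt m a b c * \<sigma> m a b c"
    have y1: "(\<Sum>m<8. \<Sum>a<8. \<Sum>b<8. \<Sum>c<8. ?h a b m c) = ?Y"
    proof -
      have "(\<Sum>m<8. \<Sum>a<8. \<Sum>b<8. \<Sum>c<8. ?h a b m c) = (\<Sum>m<8. \<Sum>a<8. \<Sum>b<8. \<Sum>c<8. ?h m a b c)"
        by (rule sum_cyc3[of "\<lambda>a b m. \<Sum>c<8. ?h a b m c"])
      then show ?thesis .
    qed
    have y2: "(\<Sum>m<8. \<Sum>a<8. \<Sum>b<8. \<Sum>c<8. ?h b m a c) = ?Y"
      using sum_cyc3[of "\<lambda>m a b. \<Sum>c<8. ?h b m a c" "{..<8}"] by simp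
    have y3: "(\<Sum>m<8. \<Sum>a<8. \<Sum>b<8. \<Sum>c<8. ?h c m a b) = ?Y"
      by (rule sum_rot4[of "\<lambda>m a b c. ?h c m a b"])
    have scyc: "\<sigma> j k i l = \<sigma> i j k l" for i j k l
      unfolding \<sigma>_def by (intro sum.cong refl) simp
    have "?h m a b c + ?h a b m c + ?h b m a c = - ?h c m a b" for m a b c
      using arg_cong[OF dt_closed[of m a b c], of "\<lambda>x. x * \<sigma> m a b c"] scyc[of m a b c] scyc[of b m a c]
        sigma_skew[of c m a b] by (simp add: distrib_right)
    then have "(\<Sum>m<8. \<Sum>a<8. \<Sum>b<8. \<Sum>c<8. ?h m a b c + ?h a b m c + ?h b m a c)
        = (\<Sum>m<8. \<Sum>a<8. \<Sum>b<8. \<Sum>c<8. - ?h c m a b)" by simp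
    then have "?Y + ?Y + ?Y = - ?Y"
      unfolding sum.distrib sum_negf y1 y2 y3 .
    then show ?thesis by simp
  qed
  ultimately have "(\<Sum>m<8. \<Sum>a<8. \<Sum>b<8. \<Sum>c<8. dt m a b c * dt m a b c) = 0" using assms(1) by simp
  then have "\<forall>m\<in>{..<8}. (\<Sum>a<8. \<Sum>b<8. \<Sum>c<8. dt m a b c * dt m a b c) = 0"
    by (subst (asm) sum_nonneg_eq_0_iff) (auto intro!: sum_nonneg)
  then have "(\<Sum>a<8. \<Sum>b<8. \<Sum>c<8. dt m a b c * dt m a b c) = 0" using assms(2) by simp
  then have "\<forall>a\<in>{..<8}. (\<Sum>b<8. \<Sum>c<8. dt m a b c * dt m a b c) = 0"
    by (subst (asm) sum_nonneg_eq_0_iff) (auto intro!: sum_nonneg)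
  then have "(\<Sum>b<8. \<Sum>c<8. dt m s b c * dt m s b c) = 0" using assms(3) by simp
  then have "\<forall>b\<in>{..<8}. (\<Sum>c<8. dt m s b c * dt m s b c) = 0"
    by (subst (asm) sum_nonneg_eq_0_iff) (auto intro!: sum_nonneg)
  then have "(\<Sum>c<8. dt m s j c * dt m s j c) = 0" using assms(4) by simp
  then have "\<forall>c\<in>{..<8}. dt m s j c * dt m s j c = 0"
    by (subst (asm) sum_nonneg_eq_0_iff) auto
  then show ?thesis using assms(5) by simp
qed

text \<open>\<open>dr m\<close> stands for the covariant derivative of the curvature in direction \<open>m\<close>.\<close>

context
  fixes dr :: "nat \<Rightarrow> nat \<Rightarrow> nat \<Rightarrow> nat \<Rightarrow> nat \<Rightarrow> real"
  assumes dr_skew: "\<And>m i j k l. dr m j i k l = - dr m i j k l" "\<And>m i j k l. dr m i j l k = - dr m i j k l"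
    and dr_instanton: "\<And>m i j k l. k < 8 \<Longrightarrow> l < 8 \<Longrightarrow> contr (\<lambda>a b. dr m a b i j) k l = 2 * dr m k l i j"
    and dr_bianchi: "\<And>x y z u v. dr x y z u v + dr y z x u v + dr z x y u v
      + (\<Sum>s<8. t x y s * r s z u v + t y z s * r s x u v + t z x s * r s y u v) = 0"
    and dr_scalar: "\<And>m. 3 * (\<Sum>j<8. \<Sum>k<8. dr m j k j k) = 2 * (\<Sum>s<8. \<Sum>j<8. \<Sum>k<8. t s j k * dt m s j k)"
    and dr_ricci: "\<And>m i j. i < 8 \<Longrightarrow> j < 8 \<Longrightarrow> (\<Sum>c<8. dr m c i c j) = (\<Sum>c<8. dr m c j c i)"
begin

lemma dr_divergence: assumes m: "m < 8" shows "(\<Sum>i<8. dr i i m u v) = 0"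
proof -
  let ?f = "\<lambda>i a b. dr i a b u v * \<psi> a b i m"
  let ?h = "\<lambda>i a b. (\<Sum>s<8. t a b s * r s i u v) * \<psi> a b i m"
  have "2 * (\<Sum>i<8. dr i i m u v) = (\<Sum>i<8. \<Sum>a<8. \<Sum>b<8. ?f i a b)"
    unfolding sum_distrib_left using m by (intro sum.cong refl) (simp add: dr_instanton[symmetric] contr_def)
  then have "6 * (\<Sum>i<8. dr i i m u v) = 3 * (\<Sum>i<8. \<Sum>a<8. \<Sum>b<8. ?f i a b)" by simp
  also have "\<dots> = (\<Sum>i<8. \<Sum>a<8. \<Sum>b<8. ?f i a b + ?f a b i + ?f b i a)"
    using sum_cyc3[of ?f "{..<8}"] sum_cyc3[of "\<lambda>i a b. ?f b i a" "{..<8}"] by (simp add: sum.distrib)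
  also have "\<dots> = (\<Sum>i<8. \<Sum>a<8. \<Sum>b<8. - (?h i a b + ?h a b i + ?h b i a))"
  proof (intro sum.cong refl)
    fix i a b
    have p: "\<psi> b i a m = \<psi> a b i m" "\<psi> i a b m = \<psi> a b i m"
      using psi_cyc[of b i a m] psi_cyc[of i a b m] by linarith+
    have "dr i a b u v + dr a b i u v + dr b i a u v
      = - (\<Sum>s<8. t i a s * r s b u v + t a b s * r s i u v + t b i s * r s a u v)"
      using dr_bianchi[of i a b u v] by linarith
    then have "(dr i a b u v + dr a b i u v + dr b i a u v) * \<psi> a b i m
      = - ((\<Sum>s<8. t i a s * r s b u v + t a b s * r s i u v + t b i s * r s a u v) * \<psi> a b i m)"
      by (simp only: mult_minus_left)
    then show "?f i a b + ?f a b i + ?f b i a = - (?h i a b + ?h a b i + ?h b i a)"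
      unfolding p by (simp add: distrib_right sum.distrib)
  qed
  also have "\<dots> = - 3 * (\<Sum>i<8. \<Sum>a<8. \<Sum>b<8. ?h i a b)"
    unfolding sum_negf sum.distrib
    using sum_cyc3[of ?h "{..<8}"] sum_cyc3[of "\<lambda>i a b. ?h b i a" "{..<8}"] by linarith
  finally have main: "6 * (\<Sum>i<8. dr i i m u v) = - 3 * (\<Sum>i<8. \<Sum>a<8. \<Sum>b<8. ?h i a b)" .
  have "(\<Sum>i<8. \<Sum>a<8. \<Sum>b<8. ?h i a b) = (\<Sum>i<8. \<Sum>a<8. \<Sum>b<8. \<Sum>s<8. r s i u v * (t a b s * \<psi> a b i m))"
    unfolding sum_distrib_right by (intro sum.cong refl) simp
  also have "\<dots> = (\<Sum>s<8. \<Sum>i<8. \<Sum>a<8. \<Sum>b<8. r s i u v * (t a b s * \<psi> a b i m))" by (rule sum_rot4)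
  also have "\<dots> = (\<Sum>s<8. \<Sum>i<8. r s i u v * contr (\<lambda>a b. t a b s) i m)"
    by (simp add: contr_def sum_distrib_left)
  \<comment> \<open>For fixed u and v the instanton condition places the skew matrix
    \<open>r s i u v\<close> in spin(7), so it is orthogonal to the contraction of t with
    \<psi>.\<close>
  also have "\<dots> = 0"
    by (rule t_spin7_orthogonal[OF t_skew t_psi _ _ m, of "\<lambda>s i. r s i u v"])
      (simp_all only: instanton, rule r_skew(1))
  finally show ?thesis using main by simp
qed

lemma t_dt: assumes i: "i < 8" shows "(\<Sum>s<8. \<Sum>j<8. \<Sum>k<8. t s j k * dt i s j k) = 0"
proof -
  let ?X = "\<Sum>s<8. \<Sum>j<8. \<Sum>k<8. t s j k * dt i s j k"
  \<comment> \<open>The divergence of the Ricci tensor: its symmetry moves the differentiated index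
    into the first pair, where \<open>dr_divergence\<close> applies.\<close>
  have ric0: "(\<Sum>c<8. \<Sum>k<8. dr c k i k c) = 0"
  proof -
    have "(\<Sum>c<8. \<Sum>k<8. dr c k i k c) = (\<Sum>c<8. \<Sum>k<8. dr c k c k i)"
      using i by (intro sum.cong refl dr_ricci) auto
    also have "\<dots> = (\<Sum>k<8. - (\<Sum>c<8. dr c c k k i))"
      unfolding sum_negf[symmetric] by (subst sum.swap) (intro sum.cong refl dr_skew(1))
    also have "\<dots> = 0" by (simp add: dr_divergence)
    finally show ?thesis .
  qed
  have T2: "(\<Sum>j<8. \<Sum>k<8. dr j k i j k) = 0"
  proof -
    have "(\<Sum>j<8. \<Sum>k<8. dr j k i j k) = - (\<Sum>j<8. \<Sum>k<8. dr j k i k j)"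
      unfolding sum_negf[symmetric] by (intro sum.cong refl dr_skew(2))
    then show ?thesis using ric0 by simp
  qed
  have T3: "(\<Sum>j<8. \<Sum>k<8. dr k i j j k) = 0"
  proof -
    have "(\<Sum>j<8. \<Sum>k<8. dr k i j j k) = (\<Sum>k<8. \<Sum>j<8. dr k i j j k)" by (rule sum.swap)
    also have "\<dots> = - (\<Sum>k<8. \<Sum>j<8. dr k j i j k)"
      unfolding sum_negf[symmetric] by (intro sum.cong refl dr_skew(1))
    finally show ?thesis using ric0 by simp
  qed
  define q where "q a b = (\<Sum>c<8. r c a c b)" for a b
  have q: "q b a = q a b" if "a < 8" "b < 8" for a b unfolding q_def using ricci_sym that by simp
  \<comment> \<open>Symmetry of the Ricci trace q is known for indices below 8 only, while
    \<open>sum_skew_sym\<close> asks for it everywhere; truncation supplies it.\<close>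
  define q' where "q' a b = (if a < 8 \<and> b < 8 then q a b else 0)" for a b
  have q': "q' b a = q' a b" for a b unfolding q'_def using q by auto
  have T4: "(\<Sum>j<8. \<Sum>k<8. \<Sum>s<8. t i j s * r s k j k) = 0"
  proof -
    have "(\<Sum>j<8. \<Sum>k<8. \<Sum>s<8. t i j s * r s k j k) = (\<Sum>j<8. \<Sum>s<8. t i j s * (\<Sum>k<8. r s k j k))"
      unfolding sum_distrib_left by (rule sum.cong[OF refl], rule sum.swap)
    also have "\<dots> = (\<Sum>j<8. \<Sum>s<8. t i j s * q' j s)"
    proof (intro sum.cong refl)
      fix j s :: nat assume js: "j \<in> {..<8}" "s \<in> {..<8}"
      have "(\<Sum>k<8. r s k j k) = q s j"
        unfolding q_def
      proof (intro sum.cong refl)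
        fix k show "r s k j k = r k s k j" using r_skew(1)[of s k j k] r_skew(2)[of k s j k] by linarith
      qed
      then show "t i j s * (\<Sum>k<8. r s k j k) = t i j s * q' j s" using js q by (simp add: q'_def)
    qed
    also have "\<dots> = 0" by (rule sum_skew_sym) (rule t_skew(2), rule q')
    finally show ?thesis .
  qed
  have T6: "(\<Sum>j<8. \<Sum>k<8. \<Sum>s<8. t k i s * r s j j k) = 0"
  proof -
    have "(\<Sum>j<8. \<Sum>k<8. \<Sum>s<8. t k i s * r s j j k) = (\<Sum>k<8. \<Sum>s<8. t k i s * (\<Sum>j<8. r s j j k))"
      unfolding sum_distrib_left by (rule sum_rot3[symmetric, of "\<lambda>k s j. t k i s * r s j j k"])
    also have "\<dots> = (\<Sum>k<8. \<Sum>s<8. - t k i s * q' k s)"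
    proof (intro sum.cong refl)
      fix k s :: nat assume ks: "k \<in> {..<8}" "s \<in> {..<8}"
      have "(\<Sum>j<8. r s j j k) = - q s k"
        unfolding q_def sum_negf[symmetric] by (intro sum.cong refl r_skew(1))
      then show "t k i s * (\<Sum>j<8. r s j j k) = - t k i s * q' k s" using ks q by (simp add: q'_def)
    qed
    also have "\<dots> = 0"
    proof (rule sum_skew_sym)
      fix k s show "- t s i k = - (- t k i s)"
        using t_cyc[of k i s] t_skew(2)[of i s k] t_cyc[of s i k] t_cyc[of k s i] t_skew(1)[of i s k] t_cyc[of i k s] t_cyc[of i s k] by linarith
    qed (rule q')
    finally show ?thesis .
  qed
  have T5: "(\<Sum>j<8. \<Sum>k<8. \<Sum>s<8. t j k s * r s i j k) = - (\<Sum>s<8. \<Sum>j<8. \<Sum>k<8. t s j k * r i s j k)"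
    unfolding sum_negf[symmetric]
  proof (subst sum_rot3, intro sum.cong refl)
    fix s j k show "t j k s * r s i j k = - (t s j k * r i s j k)"
      unfolding t_cyc[of s j k] r_skew(1)[of s i j k] by simp
  qed
  \<comment> \<open>The double trace of the second Bianchi identity. Only its first term and the
    contraction T5 survive; \<open>dr_scalar\<close> and \<open>t_r\<close> express both through the
    sum that is to vanish, with different constants.\<close>
  have "(\<Sum>j<8. \<Sum>k<8. dr i j k j k + dr j k i j k + dr k i j j k
      + (\<Sum>s<8. t i j s * r s k j k + t j k s * r s i j k + t k i s * r s j j k)) = 0"
    by (simp only: dr_bianchi sum.neutral_const)
  then have "(\<Sum>j<8. \<Sum>k<8. dr i j k j k) - (\<Sum>s<8. \<Sum>j<8. \<Sum>k<8. t s j k * r i s j k) = 0"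
    unfolding sum.distrib T2 T3 T4 T5 T6 by simp
  then show ?thesis using dr_scalar[of i] t_r[of i] by simp
qed

lemma t_r_zero: "i < 8 \<Longrightarrow> (\<Sum>s<8. \<Sum>j<8. \<Sum>k<8. t s j k * r i s j k) = 0"
  using t_r[of i] t_dt[of i] by simp

text \<open>The hypothesis \<open>eta\<close> is a diagonal entry of the covariant derivative of the
  1-form in \<open>t_r_zero\<close>. After summation over n its second half is a divergence of the
  curvature and drops out, which leaves the hypothesis of \<open>dt_zero\<close>.\<close>

lemma dt_vanishes:
  assumes eta: "\<And>n. n < 8 \<Longrightarrow>
      (\<Sum>s<8. \<Sum>j<8. \<Sum>k<8. dt n s j k * r n s j k + t s j k * dr n n s j k) = 0"
    and "m < 8" "s < 8" "j < 8" "k < 8"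
  shows "dt m s j k = 0"
proof (rule dt_zero)
  have "(\<Sum>n<8. \<Sum>s<8. \<Sum>j<8. \<Sum>k<8. t s j k * dr n n s j k) = (\<Sum>s<8. \<Sum>j<8. \<Sum>k<8. \<Sum>n<8. t s j k * dr n n s j k)"
    by (rule sum_rot4[symmetric, of "\<lambda>s j k n. t s j k * dr n n s j k"])
  also have "\<dots> = 0" unfolding sum_distrib_left[symmetric] by (simp add: dr_divergence)
  finally have "(\<Sum>n<8. \<Sum>s<8. \<Sum>j<8. \<Sum>k<8. t s j k * dr n n s j k) = 0" .
  moreover have "(\<Sum>n<8. \<Sum>s<8. \<Sum>j<8. \<Sum>k<8. dt n s j k * r n s j k + t s j k * dr n n s j k) = 0"
    using eta by simp
  ultimately show "(\<Sum>m<8. \<Sum>s<8. \<Sum>j<8. \<Sum>k<8. dt m s j k * r m s j k) = 0"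
    by (simp add: sum.distrib)
qed (use assms in auto)

end

end

section \<open>Alternating functions of lists\<close>

text \<open>Only adjacent transpositions are mentioned; blocks and shuffles are then handled by
  moving one entry at a time.\<close>

definition alternating :: "'a set \<Rightarrow> nat \<Rightarrow> ('a list \<Rightarrow> real) \<Rightarrow> bool" where
  "alternating V k f \<longleftrightarrow> (\<forall>us x y vs. set (us @ x # y # vs) \<subseteq> V \<longrightarrow> length (us @ x # y # vs) = k \<longrightarrow>
     f (us @ y # x # vs) = - f (us @ x # y # vs))"

text \<open>The behaviour of a product of two alternating functions, such as the summands of the
  Hodge star, in which the signs cancel.\<close>

definition swap_invariant :: "'a set \<Rightarrow> nat \<Rightarrow> ('a list \<Rightarrow> real) \<Rightarrow> bool" where
  "swap_invariant V k f \<longleftrightarrow> (\<forall>us x y vs. set (us @ x # y # vs) \<subseteq> V \<longrightarrow> length (us @ x # y # vs) = k \<longrightarrow>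
     f (us @ y # x # vs) = f (us @ x # y # vs))"

lemma alternatingD:
  "alternating V k f \<Longrightarrow> set (us @ x # y # vs) \<subseteq> V \<Longrightarrow> length (us @ x # y # vs) = k \<Longrightarrow>
     f (us @ y # x # vs) = - f (us @ x # y # vs)"
  unfolding alternating_def by blast

lemma alternating_mult:
  assumes "alternating V k f" "alternating V k h"
  shows "swap_invariant V k (\<lambda>xs. f xs * h xs)"
  unfolding swap_invariant_def
proof (intro allI impI)
  fix us x y vs assume *: "set (us @ x # y # vs) \<subseteq> V" "length (us @ x # y # vs) = k"
  show "f (us @ y # x # vs) * h (us @ y # x # vs) = f (us @ x # y # vs) * h (us @ x # y # vs)"
    using alternatingD[OF assms(1) *] alternatingD[OF assms(2) *] by simp
qed

lemma alternating_move:
  assumes f: "alternating V k f"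
  shows "set (us @ xs @ y # vs) \<subseteq> V \<Longrightarrow> length (us @ xs @ y # vs) = k \<Longrightarrow>
    f (us @ xs @ y # vs) = (- 1) ^ length xs * f (us @ y # xs @ vs)"
proof (induction xs arbitrary: us)
  case (Cons x xs)
  have "f (us @ (x # xs) @ y # vs) = (- 1) ^ length xs * f (us @ x # y # xs @ vs)"
    using Cons.IH[of "us @ [x]"] Cons.prems by simp
  also have "f (us @ x # y # xs @ vs) = - f (us @ y # x # xs @ vs)"
    using Cons.prems by (intro alternatingD[OF f]) auto
  finally show ?case by simp
qed simp

lemma alternating_swap_blocks:
  assumes f: "alternating V k f"
  shows "set (us @ xs @ ys @ vs) \<subseteq> V \<Longrightarrow> length (us @ xs @ ys @ vs) = k \<Longrightarrow>
    f (us @ xs @ ys @ vs) = (- 1) ^ (length xs * length ys) * f (us @ ys @ xs @ vs)"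
proof (induction ys arbitrary: us)
  case (Cons y ys)
  have "f (us @ xs @ (y # ys) @ vs) = (- 1) ^ length xs * f (us @ y # xs @ ys @ vs)"
    using alternating_move[OF f, of us xs y "ys @ vs"] Cons.prems by simp
  also have "f (us @ y # xs @ ys @ vs) = (- 1) ^ (length xs * length ys) * f (us @ y # ys @ xs @ vs)"
    using Cons.IH[of "us @ [y]"] Cons.prems by simp
  finally show ?case by (simp add: power_add)
qed simp

lemma alternating_not_distinct:
  assumes f: "alternating V k f" and "set zs \<subseteq> V" "length zs = k" "\<not> distinct zs"
  shows "f zs = 0"
proof -
  obtain us x xs vs where zs: "zs = us @ [x] @ xs @ [x] @ vs"
    using not_distinct_decomp[OF assms(4)] by blast
  have "f zs = (- 1) ^ length xs * f (us @ x # x # xs @ vs)"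
    using alternating_move[OF f, of "us @ [x]" xs x vs] assms zs by simp
  moreover have "f (us @ x # x # xs @ vs) = - f (us @ x # x # xs @ vs)"
    using assms zs by (intro alternatingD[OF f]) auto
  ultimately show ?thesis by simp
qed

lemma swap_invariant_move:
  assumes f: "swap_invariant V k f"
  shows "set (us @ xs @ y # vs) \<subseteq> V \<Longrightarrow> length (us @ xs @ y # vs) = k \<Longrightarrow>
    f (us @ xs @ y # vs) = f (us @ y # xs @ vs)"
proof (induction xs arbitrary: us)
  case (Cons x xs)
  have "f (us @ (x # xs) @ y # vs) = f (us @ x # y # xs @ vs)"
    using Cons.IH[of "us @ [x]"] Cons.prems by simp
  also have "\<dots> = f (us @ y # x # xs @ vs)"
  proof -
    have "set (us @ y # x # xs @ vs) \<subseteq> V" "length (us @ y # x # xs @ vs) = k" using Cons.prems by auto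
    then show ?thesis using f unfolding swap_invariant_def by blast
  qed
  finally show ?case by simp
qed simp

lemma swap_invariant_perm:
  assumes f: "swap_invariant V k f"
  shows "mset xs = mset ys \<Longrightarrow> set (us @ xs) \<subseteq> V \<Longrightarrow> length (us @ xs) = k \<Longrightarrow> f (us @ xs) = f (us @ ys)"
proof (induction xs arbitrary: us ys)
  case (Cons x xs)
  then have "x \<in> set ys" by (metis list.set_intros(1) set_mset_mset)
  then obtain as bs where ys: "ys = as @ x # bs" by (auto simp: in_set_conv_decomp)
  have m: "mset xs = mset (as @ bs)" using Cons.prems(1) ys by simp
  have st: "set ys = set (x # xs)" "length ys = length (x # xs)"
    using Cons.prems(1) by (metis set_mset_mset, metis size_mset)
  have "set (us @ ys) \<subseteq> V" "length (us @ ys) = k" using st Cons.prems(2,3) by auto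
  then have "f (us @ ys) = f (us @ x # as @ bs)"
    unfolding ys by (intro swap_invariant_move[OF f])
  also have "\<dots> = f (us @ x # xs)"
    using Cons.IH[OF m, of "us @ [x]"] Cons.prems by simp
  finally show ?case by simp
qed simp

text \<open>Passes from increasing multi-indices, used by \<open>hodge\<close> and
  \<open>wedge\<close>, to arbitrary tuples. Tuples with a repetition contribute nothing, and the
  others are grouped by their set of entries, k! equal values for each. As the right side depends
  only on the set of E, the left side does not change when a frame is reordered.\<close>

lemma sum_subsets_tuples:
  assumes f: "swap_invariant V k f" and z: "\<And>xs. set xs \<subseteq> V \<Longrightarrow> length xs = k \<Longrightarrow> \<not> distinct xs \<Longrightarrow> f xs = 0"
    and E: "distinct E" "set E \<subseteq> V"
  shows "(\<Sum>S | S \<subseteq> {..<length E} \<and> card S = k. f (nths E S)) * fact k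
    = (\<Sum>xs | set xs \<subseteq> set E \<and> length xs = k. f xs)"
proof -
  let ?G = "{xs. set xs \<subseteq> set E \<and> length xs = k}"
  let ?D = "{xs. set xs \<subseteq> set E \<and> length xs = k \<and> distinct xs}"
  let ?B = "{B. B \<subseteq> set E \<and> card B = k}"
  have fin: "finite ?G" by (rule finite_lists_length_eq) simp
  have "(\<Sum>xs\<in>?G. f xs) = (\<Sum>xs\<in>?D. f xs)"
    using fin z E by (intro sum.mono_neutral_right) auto
  also have "\<dots> = (\<Sum>B\<in>?B. \<Sum>xs\<in>{xs. xs \<in> ?D \<and> set xs = B}. f xs)"
    using fin by (intro sum.group[symmetric]) (auto simp: distinct_card intro: finite_subset[OF _ fin])
  also have "\<dots> = (\<Sum>S | S \<subseteq> {..<length E} \<and> card S = k. \<Sum>xs\<in>{xs. xs \<in> ?D \<and> set xs = set (nths E S)}. f xs)"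
  proof (rule sum.reindex_bij_betw[symmetric, of "\<lambda>S. set (nths E S)"])
    have inj: "inj_on ((!) E) {..<length E}" using E by (simp add: inj_on_nth)
    have s: "set (nths E S) = (!) E ` S" if "S \<subseteq> {..<length E}" for S
      using that by (auto simp: set_nths)
    have "bij_betw (\<lambda>S. (!) E ` S) {S. S \<subseteq> {..<length E} \<and> card S = k} ?B"
      unfolding bij_betw_def
    proof
      show "inj_on (\<lambda>S. (!) E ` S) {S. S \<subseteq> {..<length E} \<and> card S = k}"
        using inj_on_image_eq_iff[OF inj] by (auto simp: inj_on_def)
      show "(\<lambda>S. (!) E ` S) ` {S. S \<subseteq> {..<length E} \<and> card S = k} = ?B"
      proof (intro equalityI subsetI)
        fix B assume B: "B \<in> ?B"
        define S where "S = {i. i < length E \<and> E ! i \<in> B}"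
        have ES: "(!) E ` S = B"
        proof (intro equalityI subsetI)
          fix x assume x: "x \<in> B"
          then have "x \<in> set E" using B by auto
          then obtain i where "i < length E" "x = E ! i" by (auto simp: in_set_conv_nth)
          then show "x \<in> (!) E ` S" using x unfolding S_def by auto
        qed (auto simp: S_def)
        moreover have "card S = k"
        proof -
          have "inj_on ((!) E) S" by (rule inj_on_subset[OF inj]) (auto simp: S_def)
          from card_image[OF this] show ?thesis using ES B by simp
        qed
        ultimately show "B \<in> (\<lambda>S. (!) E ` S) ` {S. S \<subseteq> {..<length E} \<and> card S = k}"
          by (auto simp: S_def intro!: image_eqI[of _ _ S])
      qed (auto simp: card_image[OF inj_on_subset[OF inj]])
    qed
    then show "bij_betw (\<lambda>S. set (nths E S)) {S. S \<subseteq> {..<length E} \<and> card S = k} ?B"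
      by (subst bij_betw_cong[of _ _ "\<lambda>S. (!) E ` S"]) (auto simp: s)
  qed
  also have "\<dots> = (\<Sum>S | S \<subseteq> {..<length E} \<and> card S = k. fact k * f (nths E S))"
  proof (rule sum.cong[OF refl])
    fix S assume "S \<in> {S. S \<subseteq> {..<length E} \<and> card S = k}"
    then have S: "S \<subseteq> {..<length E}" "card S = k" by auto
    have d: "distinct (nths E S)" using E by simp
    have l: "length (nths E S) = k"
      using S by (subst length_nths) (metis (mono_tags, lifting) Collect_mem_eq Collect_cong lessThan_iff subsetD)
    have sE: "set (nths E S) \<subseteq> set E" by (rule set_nths_subset)
    have "{xs. xs \<in> ?D \<and> set xs = set (nths E S)} = permutations_of_set (set (nths E S))"
      using d l sE distinct_card[OF d] by (auto simp: permutations_of_set_def dest: distinct_card)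
    moreover have "f xs = f (nths E S)" if "xs \<in> permutations_of_set (set (nths E S))" for xs
    proof -
      have "mset (nths E S) = mset xs"
        using that d by (simp add: permutations_of_set_def set_eq_iff_mset_eq_distinct[symmetric])
      from swap_invariant_perm[OF f this, of "[]"] show ?thesis using l sE E by simp
    qed
    ultimately show "(\<Sum>xs\<in>{xs. xs \<in> ?D \<and> set xs = set (nths E S)}. f xs) = fact k * f (nths E S)"
      using distinct_card[OF d] l by simp
  qed
  finally show ?thesis by (simp add: sum_distrib_left mult.commute)
qed

lemma sum_lists_Suc:
  "finite B \<Longrightarrow> (\<Sum>xs | set xs \<subseteq> B \<and> length xs = Suc k. f xs) = (\<Sum>x\<in>B. \<Sum>xs | set xs \<subseteq> B \<and> length xs = k. f (x # xs))"
proof -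
  assume B: "finite B"
  have "(\<Sum>x\<in>B. \<Sum>xs | set xs \<subseteq> B \<and> length xs = k. f (x # xs))
    = (\<Sum>(x, xs)\<in>B \<times> {xs. set xs \<subseteq> B \<and> length xs = k}. f (x # xs))"
    using B finite_lists_length_eq[OF B] by (subst sum.cartesian_product) simp
  also have "\<dots> = (\<Sum>xs | set xs \<subseteq> B \<and> length xs = Suc k. f xs)"
    by (rule sum.reindex_bij_witness[of _ "\<lambda>xs. (hd xs, tl xs)" "\<lambda>(x, xs). x # xs"])
      (auto simp: length_Suc_conv)
  finally show ?thesis by simp
qed

text \<open>If position 0 is not selected, it lies below every selected position and accounts for
  one inversion with each.\<close>

lemma shuffle_sign_Cons:
  assumes "finite S"
  shows "shuffle_sign S = (if 0 \<in> S then 1 else (- 1) ^ card {j. Suc j \<in> S}) * shuffle_sign {j. Suc j \<in> S}"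
proof -
  let ?S = "{j. Suc j \<in> S}"
  let ?P = "\<lambda>S. {(i, j). i \<in> S \<and> j \<notin> S \<and> j < (i::nat)}"
  have fS: "finite ?S" using finite_vimageI[OF assms, of Suc] by (simp add: vimage_def)
  have fP: "finite (?P ?S)" by (rule finite_subset[of _ "?S \<times> (\<Union>i\<in>?S. {..<i})"]) (use fS in auto)
  have cI: "card (map_prod Suc Suc ` ?P ?S) = card (?P ?S)"
    by (rule card_image) (auto simp: inj_on_def)
  show ?thesis
  proof (cases "0 \<in> S")
    case True
    have "?P S = map_prod Suc Suc ` ?P ?S"
    proof (intro equalityI subsetI)
      fix z assume "z \<in> ?P S"
      then obtain i j where z: "z = (i, j)" "i \<in> S" "j \<notin> S" "j < i" by auto
      then have "j \<noteq> 0" using True by metis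
      with z show "z \<in> map_prod Suc Suc ` ?P ?S"
        by (intro image_eqI[of _ _ "(i - 1, j - 1)"]) auto
    qed auto
    then show ?thesis using True cI by (simp add: shuffle_sign_def)
  next
    case False
    have "?P S = map_prod Suc Suc ` ?P ?S \<union> (\<lambda>i. (Suc i, 0)) ` ?S"
    proof (intro equalityI subsetI)
      fix z assume "z \<in> ?P S"
      then obtain i j where z: "z = (i, j)" "i \<in> S" "j \<notin> S" "j < i" by auto
      show "z \<in> map_prod Suc Suc ` ?P ?S \<union> (\<lambda>i. (Suc i, 0)) ` ?S"
      proof (cases j)
        case 0
        then show ?thesis using z by (intro UnI2 image_eqI[of _ _ "i - 1"]) auto
      next
        case (Suc j')
        then show ?thesis using z by (intro UnI1 image_eqI[of _ _ "(i - 1, j')"]) auto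
      qed
    qed (use False in auto)
    moreover have "card ((\<lambda>i. (Suc i, 0::nat)) ` ?S) = card ?S" by (rule card_image) (auto simp: inj_on_def)
    moreover have "card (map_prod Suc Suc ` ?P ?S \<union> (\<lambda>i. (Suc i, 0)) ` ?S)
        = card (map_prod Suc Suc ` ?P ?S) + card ((\<lambda>i. (Suc i, 0::nat)) ` ?S)"
      by (rule card_Un_disjoint) (use fS fP in auto)
    ultimately have "card (?P S) = card (?P ?S) + card ?S" using cI by simp
    then show ?thesis using False by (simp add: shuffle_sign_def power_add mult.commute)
  qed
qed

text \<open>Induction on L: an unselected head has to pass all selected entries, which is the sign
  in \<open>shuffle_sign_Cons\<close>.\<close>

lemma alternating_shuffle:
  assumes f: "alternating V k f"
  shows "set (us @ L) \<subseteq> V \<Longrightarrow> length (us @ L) = k \<Longrightarrow> S \<subseteq> {..<length L} \<Longrightarrow>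
    f (us @ nths L S @ nths L (- S)) = shuffle_sign S * f (us @ L)"
proof (induction L arbitrary: us S)
  case Nil
  then show ?case by (simp add: shuffle_sign_def)
next
  case (Cons x L)
  let ?S = "{j. Suc j \<in> S}"
  have S': "?S \<subseteq> {..<length L}" using Cons.prems(3) by auto
  have len: "length (nths L ?S) = card ?S"
    using S' by (subst length_nths) (metis (mono_tags, lifting) Collect_mem_eq Collect_cong lessThan_iff subsetD)
  have IH: "f ((us @ [x]) @ nths L ?S @ nths L (- ?S)) = shuffle_sign ?S * f ((us @ [x]) @ L)"
    using Cons.prems S' by (intro Cons.IH) auto
  have sg: "shuffle_sign S = (if 0 \<in> S then 1 else (- 1) ^ card ?S) * shuffle_sign ?S"
    using Cons.prems(3) by (intro shuffle_sign_Cons finite_subset[OF Cons.prems(3)]) simp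
  show ?case
  proof (cases "0 \<in> S")
    case True
    then show ?thesis using IH sg by (simp add: nths_Cons Collect_neg_eq)
  next
    case False
    have l2: "length (nths L ?S) + length (nths L (- ?S)) = length L"
    proof -
      have "length (nths L ?S) + length (nths L (- ?S)) = card {i. i < length L \<and> i \<in> ?S} + card {i. i < length L \<and> i \<in> - ?S}"
        by (simp only: length_nths)
      also have "\<dots> = card ({i. i < length L \<and> i \<in> ?S} \<union> {i. i < length L \<and> i \<in> - ?S})"
        by (subst card_Un_disjoint) auto
      also have "{i. i < length L \<and> i \<in> ?S} \<union> {i. i < length L \<and> i \<in> - ?S} = {..<length L}" by auto
      finally show ?thesis by simp
    qed
    have "f (us @ nths L ?S @ x # nths L (- ?S)) = (- 1) ^ length (nths L ?S) * f (us @ x # nths L ?S @ nths L (- ?S))"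
      using Cons.prems l2 set_nths_subset[of L ?S] set_nths_subset[of L "- ?S"]
      by (intro alternating_move[OF f]) auto
    then show ?thesis using IH sg False by (simp add: nths_Cons Collect_neg_eq len)
  qed
qed

lemma nths_Compl_single: "i < length xs \<Longrightarrow> nths xs (- {i}) = take i xs @ drop (Suc i) xs"
proof (induction xs arbitrary: i)
  case (Cons x xs)
  have "{j. Suc j \<in> - {i}} = (if i = 0 then UNIV else - {i - 1})" by auto
  then show ?case using Cons by (cases i) (auto simp: nths_Cons nths_all)
qed simp

lemma nths_single: "i < length xs \<Longrightarrow> nths xs {i} = [xs ! i]"
proof (induction xs arbitrary: i)
  case (Cons x xs)
  have "{j. Suc j \<in> {i}} = (if i = 0 then {} else {i - 1})" by auto
  then show ?case using Cons by (cases i) (auto simp: nths_Cons)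
qed simp

lemma nths_restrict: "nths xs S = nths xs (S \<inter> {..<length xs})"
  unfolding nths_def by (intro arg_cong[of _ _ "map fst"] filter_cong) (auto simp: set_zip)

lemma length_nths_subset: "S \<subseteq> {..<length xs} \<Longrightarrow> length (nths xs S) = card S"
  by (simp add: length_nths) (metis (mono_tags, lifting) Collect_mem_eq Collect_cong lessThan_iff subsetD)

section \<open>Wedge products of coframes\<close>

lemma wedge_1:
  "wedge 1 \<alpha> \<beta> Xs p = (\<Sum>i<length Xs. (- 1) ^ i * \<alpha> [Xs ! i] p * \<beta> (take i Xs @ drop (Suc i) Xs) p)"
proof -
  have "wedge 1 \<alpha> \<beta> Xs p = (\<Sum>i<length Xs. shuffle_sign {i} * \<alpha> (nths Xs {i}) p * \<beta> (nths Xs (- {i})) p)"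
    unfolding wedge_def
    by (rule sum.reindex_bij_witness[of _ "\<lambda>i. {i}" the_elem]) (auto simp: card_1_singleton_iff)
  moreover have "shuffle_sign {i} = (- 1) ^ i" for i
  proof -
    have "{(i', j). i' \<in> {i} \<and> j \<notin> {i} \<and> j < i'} = Pair i ` {..<i}" by auto
    then show ?thesis by (simp add: shuffle_sign_def card_image inj_on_def)
  qed
  ultimately show ?thesis by (simp add: nths_single nths_Compl_single cong: sum.cong_simp)
qed

lemma wedges_dual:
  assumes dual: "\<And>i j. i < 8 \<Longrightarrow> j < 8 \<Longrightarrow> e i [F ! j] p = (if i = j then 1 else 0)"
  shows "sorted_wrt (<) as \<Longrightarrow> sorted_wrt (<) bs \<Longrightarrow> set as \<subseteq> {..<8} \<Longrightarrow> set bs \<subseteq> {..<8} \<Longrightarrow>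
    length as = length bs \<Longrightarrow> wedges e as (map ((!) F) bs) p = (if as = bs then 1 else (0::real))"
proof (induction as arbitrary: bs)
  case Nil
  then show ?case by (simp add: wedges_def)
next
  case (Cons a as)
  define h where "h i = (- 1) ^ i * e a [F ! (bs ! i)] p * wedges e as (map ((!) F) (take i bs @ drop (Suc i) bs)) p" for i
  have "wedges e (a # as) (map ((!) F) bs) p = (\<Sum>i<length bs. h i)"
    unfolding h_def wedges_def foldr.simps o_def wedge_1 by (intro sum.cong) (auto simp: take_map drop_map)
  also have "\<dots> = (if a # as = bs then 1 else 0)"
  proof -
    have lt: "bs ! i < 8" if "i < length bs" for i using Cons.prems(4) that nth_mem by fastforce
    have h: "h i = (if i = 0 \<and> a # as = bs then 1 else 0)" if i: "i < length bs" for i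
    proof (cases "bs ! i = a")
      case True
      have bs: "bs = take i bs @ a # drop (Suc i) bs" using id_take_nth_drop[OF i] True by simp
      have sr: "sorted_wrt (<) (take i bs @ a # drop (Suc i) bs)" using Cons.prems(2) bs by simp
      have "wedges e as (map ((!) F) (take i bs @ drop (Suc i) bs)) p
          = (if as = take i bs @ drop (Suc i) bs then 1 else 0)"
      proof (rule Cons.IH)
        show "sorted_wrt (<) (take i bs @ drop (Suc i) bs)" using sr by (auto simp: sorted_wrt_append)
        show "set (take i bs @ drop (Suc i) bs) \<subseteq> {..<8}"
          using Cons.prems(4) set_take_subset[of i bs] set_drop_subset[of "Suc i" bs] by auto
        show "length as = length (take i bs @ drop (Suc i) bs)" using Cons.prems(5) i by simp
      qed (use Cons.prems in auto)
      \<comment> \<open>A match at a later position would make the first entry of bs smaller than a,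
        yet also the head of as and hence larger than a.\<close>
      moreover have "as \<noteq> take i bs @ drop (Suc i) bs" if i0: "i > 0"
      proof
        assume eq: "as = take i bs @ drop (Suc i) bs"
        obtain b ts where ts: "take i bs = b # ts" using i0 i by (cases bs; cases i) auto
        then have "a < b" using Cons.prems(1) eq by simp
        moreover have "b < a" using sr ts by simp
        ultimately show False by simp
      qed
      moreover have "a # as = bs \<longleftrightarrow> as = drop 1 bs" if "i = 0" using True that i by (cases bs) auto
      ultimately show ?thesis using True dual[of a a] lt[OF i] by (cases "i = 0") (auto simp: h_def)
    next
      case False
      then have "h i = 0" using dual[of a "bs ! i"] lt[OF i] Cons.prems(3) by (simp add: h_def)
      moreover have "\<not> (i = 0 \<and> a # as = bs)" using False by auto
      ultimately show ?thesis by simp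
    qed
    show ?thesis
    proof (cases bs)
      case Nil
      then show ?thesis using Cons.prems by simp
    next
      case (Cons b bs')
      have "(\<Sum>i<length bs. h i) = (\<Sum>i<length bs. if i = 0 then (if a # as = bs then 1 else 0) else 0)"
        using h by (intro sum.cong) auto
      then show ?thesis using Cons by simp
    qed
  qed
  finally show ?case .
qed

section \<open>The Lee form\<close>

lemma sum4_swap:
  "(\<Sum>a\<in>I. \<Sum>b\<in>I. \<Sum>c\<in>I. \<Sum>d\<in>I. f b a c d) = (\<Sum>a\<in>I. \<Sum>b\<in>I. \<Sum>c\<in>I. \<Sum>d\<in>I. f a b c d :: 'b::comm_monoid_add)"
  "(\<Sum>a\<in>I. \<Sum>b\<in>I. \<Sum>c\<in>I. \<Sum>d\<in>I. f a c b d) = (\<Sum>a\<in>I. \<Sum>b\<in>I. \<Sum>c\<in>I. \<Sum>d\<in>I. f a b c d)"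
  "(\<Sum>a\<in>I. \<Sum>b\<in>I. \<Sum>c\<in>I. \<Sum>d\<in>I. f a b d c) = (\<Sum>a\<in>I. \<Sum>b\<in>I. \<Sum>c\<in>I. \<Sum>d\<in>I. f a b c d)"
  by (rule sum.swap, (rule sum.cong[OF refl], rule sum.swap), (rule sum.cong[OF refl], rule sum.cong[OF refl], rule sum.swap))

context smooth_manifold
begin

lemma form_alternating:
  assumes "form_on A UNIV k \<alpha>"
  shows "alternating VF k (\<lambda>xs. \<alpha> xs p)"
  unfolding alternating_def
proof (intro allI impI)
  fix us x y vs assume *: "set (us @ x # y # vs) \<subseteq> VF" "length (us @ x # y # vs) = k"
  then have "us @ x # y # vs \<in> field_lists A k" by (simp add: field_lists_def)
  from form_swap[OF assms this, of "length us" "Suc (length us)" p] *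
  show "\<alpha> (us @ y # x # vs) p = - \<alpha> (us @ x # y # vs) p"
    by (simp add: nth_append list_update_append)
qed

end

context spin7_torsion
begin

lemma Psi_front:
  assumes "X \<in> VF" "Y \<in> VF" "Z \<in> VF" "W \<in> VF"
  shows "\<Psi> [Y, X, Z, W] p = - \<Psi> [X, Y, Z, W] p" "\<Psi> [Y, Z, X, W] p = \<Psi> [X, Y, Z, W] p"
    "\<Psi> [Y, Z, W, X] p = - \<Psi> [X, Y, Z, W] p"
  using Psi_skew(1)[OF assms, of p] Psi_skew(2)[OF assms(2,1,3,4), of p] Psi_skew(3)[OF assms(2,3,1,4), of p] by auto

lemma Psi_derivative:
  assumes "X \<in> VF" "Y \<in> VF" "Z \<in> VF" "W \<in> VF" "V \<in> VF"
  shows "X (\<Psi> [Y, Z, W, V]) p = \<Psi> [D X Y, Z, W, V] p - \<Psi> [D X Z, Y, W, V] p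
     + \<Psi> [D X W, Y, Z, V] p - \<Psi> [D X V, Y, Z, W] p"
  using assms Psi_front(1)[of "D X Z" Y W V p] Psi_front(2)[of "D X W" Y Z V p] Psi_front(3)[of "D X V" Y Z W p]
  by (simp add: Psi_parallel)

lemma Psi_tor:
  assumes "X \<in> VF" "Y \<in> VF" "Z \<in> VF" "W \<in> VF" "V \<in> VF"
  shows "\<Psi> [tor X Y, Z, W, V] p = \<Psi> [D X Y, Z, W, V] p - \<Psi> [D Y X, Z, W, V] p - \<Psi> [lie_bracket X Y, Z, W, V] p"
  using assms by (simp add: tor_def tens4_diff[OF Psi_tens])

text \<open>Since \<Psi> is parallel, its derivatives are values of \<Psi> on covariant derivatives
  of the arguments. Together with the bracket terms these assemble to \<open>tor\<close>, so d\<Psi>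
  is algebraic in T and \<Psi>.\<close>

lemma dPsi_eq:
  assumes "a \<in> VF" "b \<in> VF" "c \<in> VF" "d \<in> VF" "e \<in> VF"
  shows "ext_deriv \<Psi> [a, b, c, d, e] p =
    \<Psi> [tor a b, c, d, e] p - \<Psi> [tor a c, b, d, e] p + \<Psi> [tor a d, b, c, e] p - \<Psi> [tor a e, b, c, d] p
    + \<Psi> [tor b c, a, d, e] p - \<Psi> [tor b d, a, c, e] p + \<Psi> [tor b e, a, c, d] p
    + \<Psi> [tor c d, a, b, e] p - \<Psi> [tor c e, a, b, d] p + \<Psi> [tor d e, a, b, c] p"
proof -
  have "ext_deriv \<Psi> [a, b, c, d, e] p =
    a (\<Psi> [b, c, d, e]) p - b (\<Psi> [a, c, d, e]) p + c (\<Psi> [a, b, d, e]) p - d (\<Psi> [a, b, c, e]) p + e (\<Psi> [a, b, c, d]) p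
    - \<Psi> [lie_bracket a b, c, d, e] p + \<Psi> [lie_bracket a c, b, d, e] p - \<Psi> [lie_bracket a d, b, c, e] p
    + \<Psi> [lie_bracket a e, b, c, d] p - \<Psi> [lie_bracket b c, a, d, e] p + \<Psi> [lie_bracket b d, a, c, e] p
    - \<Psi> [lie_bracket b e, a, c, d] p - \<Psi> [lie_bracket c d, a, b, e] p + \<Psi> [lie_bracket c e, a, b, d] p
    - \<Psi> [lie_bracket d e, a, b, c] p"
    unfolding ext_deriv_def by (simp add: eval_nat_numeral nths_Cons)
  then show ?thesis using assms by (simp add: Psi_derivative Psi_tor)
qed

lemma tor_skew: "tor Y X = vf_scale (\<lambda>p. - 1) (tor X Y)"
  by (simp add: tor_def fun_eq_iff vf_apply lie_bracket_apply)

lemma Psi_tor_skew: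
  assumes "X \<in> VF" "Y \<in> VF" "Z \<in> VF" "W \<in> VF" "V \<in> VF"
  shows "\<Psi> [tor Y X, Z, W, V] p = - \<Psi> [tor X Y, Z, W, V] p"
  using tens_scale[OF Psi_tens, of "[tor X Y, Z, W, V]" 0 "tor X Y" "\<lambda>p. - 1" p] assms
  by (simp add: tor_skew[of Y X] eval_nat_numeral)

text \<open>Read off from \<open>dPsi_eq\<close>, one case per position of the transposition: terms
  with both arguments inside \<open>tor\<close>, or both outside it, change sign, and the others are
  exchanged in pairs with opposite sign.\<close>

lemma dPsi_alternating: "alternating VF 5 (\<lambda>xs. ext_deriv \<Psi> xs p)"
  unfolding alternating_def
proof (intro allI impI)
  fix us :: "'m vfield list" and x y vs assume V: "set (us @ x # y # vs) \<subseteq> VF" and len: "length (us @ x # y # vs) = 5"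
  have "length us \<le> 3" using len by simp
  then consider "us = []" | u where "us = [u]" | u v where "us = [u, v]" | u v w where "us = [u, v, w]"
    by (cases us; cases "tl us"; cases "tl (tl us)"; cases "tl (tl (tl us))") auto
  then show "ext_deriv \<Psi> (us @ y # x # vs) p = - ext_deriv \<Psi> (us @ x # y # vs) p"
  proof cases
    case 1
    then obtain b c d where "vs = [b, c, d]" using len by (auto simp: eval_nat_numeral length_Suc_conv)
    then show ?thesis using 1 V Psi_tor_skew[of x y b c d p] Psi_skew(2)[of "tor b c" x y d p]
        Psi_skew(2)[of "tor b d" x y c p] Psi_skew(2)[of "tor c d" x y b p]
        Psi_skew(1)[of "tor b c" x y d p] by (simp add: dPsi_eq)
  next
    case (2 u)
    then obtain c d where "vs = [c, d]" using len by (auto simp: eval_nat_numeral length_Suc_conv)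
    then show ?thesis using 2 V Psi_tor_skew[of x y u c d p] Psi_skew(1)[of "tor u c" x y d p]
        Psi_skew(2)[of "tor u c" x y d p] Psi_skew(2)[of "tor u d" x y c p] Psi_skew(2)[of "tor c d" u x y p]
        Psi_skew(3)[of "tor c d" u x y p]
      by (simp add: dPsi_eq)
  next
    case (3 u v)
    then obtain d where "vs = [d]" using len by (auto simp: eval_nat_numeral length_Suc_conv)
    then show ?thesis using 3 V Psi_tor_skew[of x y u v d p]
        Psi_skew(2)[of "tor u v" x y d p] Psi_skew(3)[of "tor u d" v x y p] Psi_skew(3)[of "tor v d" u x y p]
      by (simp add: dPsi_eq)
  next
    case (4 u v w)
    then have "vs = []" using len by (auto simp: eval_nat_numeral length_Suc_conv)
    then show ?thesis using 4 V Psi_tor_skew[of x y u v w p]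
        Psi_skew(3)[of "tor u v" w x y p] Psi_skew(3)[of "tor u w" v x y p] Psi_skew(3)[of "tor v w" u x y p]
      by (simp add: dPsi_eq)
  qed
qed

subsection \<open>Values in adapted frames\<close>

text \<open>Reading indices mod 8 lets every natural number name a frame field, so that skewness
  holds without index bounds, as the array locales demand.\<close>

definition frm :: "'m vfield list \<Rightarrow> nat \<Rightarrow> 'm vfield" where
  "frm F i = F ! (i mod 8)"

lemma frm_in: "orthonormal_at A g p F \<Longrightarrow> frm F i \<in> VF"
  by (simp add: frm_def orthonormal_in)

lemma frm_nth: "i < 8 \<Longrightarrow> frm F i = F ! i"
  by (simp add: frm_def)

lemma Psi_frame_sorted:
  assumes F: "adapted p e F" and abcd: "a < b" "b < c" "c < d" "d < 8"
  shows "\<Psi> [F ! a, F ! b, F ! c, F ! d] p = (let \<delta> = \<lambda>x. if x = [a, b, c, d] then 1 else 0 in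
     - \<delta> [0,1,2,7] + \<delta> [0,2,3,6] - \<delta> [0,3,4,7] - \<delta> [0,5,6,7] + \<delta> [0,1,4,6] + \<delta> [0,2,4,5]
     - \<delta> [0,1,3,5] - \<delta> [3,4,5,6] - \<delta> [1,4,5,7] - \<delta> [1,2,5,6] - \<delta> [1,2,3,4] - \<delta> [2,3,5,7]
     - \<delta> [1,3,6,7] + \<delta> [2,4,6,7])"
proof -
  obtain U where U: "p \<in> U" "spin7_coframe A \<Psi> U e" using F unfolding adapted_def by blast
  have V: "[F ! a, F ! b, F ! c, F ! d] \<in> field_lists A 4"
    using orthonormal_in[OF adapted_orthonormal[OF F]] abcd by (simp add: eval_nat_numeral)
  have dual: "\<And>i j. i < 8 \<Longrightarrow> j < 8 \<Longrightarrow> e i [F ! j] p = (if i = j then 1 else 0)"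
    using F unfolding adapted_def by blast
  have W: "wedges e as [F ! a, F ! b, F ! c, F ! d] p = (if as = [a, b, c, d] then 1 else 0)"
    if "sorted_wrt (<) as" "set as \<subseteq> {..<8}" "length as = 4" for as
    using wedges_dual[of e F p as "[a, b, c, d]", OF dual] that abcd by simp
  have "\<Psi> [F ! a, F ! b, F ! c, F ! d] p = spin7_model e [F ! a, F ! b, F ! c, F ! d] p"
    using U V unfolding spin7_coframe_def by blast
  then show ?thesis unfolding spin7_model_def Let_def by (simp add: W)
qed

lemma spin7_array_frame:
  assumes F: "adapted p e F"
  shows "spin7_array (\<lambda>i j k l. \<Psi> [frm F i, frm F j, frm F k, frm F l] p)"
proof -
  note V = frm_in[OF adapted_orthonormal[OF F]]
  have sorted: "\<Psi> [frm F a, frm F b, frm F c, frm F d] p = (let \<delta> = \<lambda>x. if x = [a, b, c, d] then 1 else 0 in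
     - \<delta> [0,1,2,7] + \<delta> [0,2,3,6] - \<delta> [0,3,4,7] - \<delta> [0,5,6,7] + \<delta> [0,1,4,6] + \<delta> [0,2,4,5]
     - \<delta> [0,1,3,5] - \<delta> [3,4,5,6] - \<delta> [1,4,5,7] - \<delta> [1,2,5,6] - \<delta> [1,2,3,4] - \<delta> [2,3,5,7]
     - \<delta> [1,3,6,7] + \<delta> [2,4,6,7])" if "a < b" "b < c" "c < d" "d < 8" for a b c d
    using Psi_frame_sorted[OF F that] that by (simp add: frm_nth)
  show ?thesis
    by unfold_locales
      ((rule Psi_skew[OF V V V V])+, (subst sorted, simp, simp, simp, simp, simp add: Let_def)+)
qed

text \<open>If \<open>vol\<close> vanished on one ordering of an orthonormal frame, it would vanish
  on all tuples of frame fields and then, by expansion in the frame, on all fields. In an adapted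
  frame, however, it is 1.\<close>

lemma vol_frame_nonzero:
  assumes vol: "induced_volume_form A \<Psi> vol" and E: "orthonormal_at A g p E" and xs: "mset xs = mset E"
  shows "vol xs p \<noteq> 0"
proof
  assume z: "vol xs p = 0"
  have form: "form_on A UNIV 8 vol" using vol by (simp add: induced_volume_form_def)
  have tv: "tens 8 vol" using form by (simp add: form_on_def)
  note alt = form_alternating[OF form, of p]
  have EV: "set E \<subseteq> VF" "length E = 8" using E by (auto simp: orthonormal_at_def field_lists_def)
  have "set us \<subseteq> VF \<Longrightarrow> set vs \<subseteq> set E \<Longrightarrow> length (us @ vs) = 8 \<Longrightarrow> vol (us @ vs) p = 0" for us vs
  proof (induction us arbitrary: vs rule: rev_induct)
    case Nil
    show ?case
    proof (cases "distinct vs")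
      case False
      then show ?thesis using alternating_not_distinct[OF alt, of vs] Nil EV by simp
    next
      case True
      have "set vs = set E"
        using Nil EV True card_length[of E] by (intro card_seteq) (auto simp: distinct_card)
      moreover have "distinct E"
        using calculation True Nil EV by (intro card_distinct) (metis append_Nil distinct_card)
      ultimately have "mset xs = mset vs" using xs True by (simp add: set_eq_iff_mset_eq_distinct)
      from swap_invariant_perm[OF alternating_mult[OF alt alt] this, of "[]"]
      have "vol xs p * vol xs p = vol vs p * vol vs p"
        using xs EV by simp (metis mset_eq_length mset_eq_setD)
      then show ?thesis using z by simp
    qed
  next
    case (snoc x us)
    have X: "us @ x # vs \<in> field_lists A 8" using snoc.prems EV by (auto simp: field_lists_def)
    have "vol (us @ x # vs) p = (\<Sum>j<8. g [x, E ! j] p * vol (us @ E ! j # vs) p)"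
      using tens_expand[OF E tv X, of "length us"] snoc.prems by (simp add: nth_append list_update_append)
    also have "\<dots> = 0"
      using snoc.IH[of "E ! _ # vs"] snoc.prems EV by (intro sum.neutral) auto
    finally show ?case by simp
  qed
  moreover obtain e F where F: "adapted p e F" using adapted_exists by blast
  moreover have FV: "set F \<subseteq> VF" "length F = 8" using F by (auto simp: adapted_def field_lists_def)
  ultimately have "vol F p = 0" by (metis append_Nil2 empty_set empty_subsetI)
  moreover have "vol F p = 1"
  proof -
    obtain U where U: "p \<in> U" "spin7_coframe A \<Psi> U e" using F unfolding adapted_def by blast
    have dual: "\<And>i j. i < 8 \<Longrightarrow> j < 8 \<Longrightarrow> e i [F ! j] p = (if i = j then 1 else 0)"
      using F unfolding adapted_def by blast
    have "F \<in> field_lists A 8" using F by (simp add: adapted_def)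
    then have "vol F p = wedges e [0,1,2,3,4,5,6,7] F p"
      using vol U unfolding induced_volume_form_def by blast
    also have "\<dots> = wedges e [0,1,2,3,4,5,6,7] (map ((!) F) [0,1,2,3,4,5,6,7]) p"
    proof -
      have "F = map ((!) F) [0,1,2,3,4,5,6,7]"
        using FV(2) by (intro nth_equalityI) (auto simp: less_Suc_eq eval_nat_numeral)
      then show ?thesis by (rule arg_cong)
    qed
    also have "\<dots> = 1"
      by (subst wedges_dual[of e F p, OF dual]) simp_all
    finally show ?thesis .
  qed
  ultimately show False by simp
qed

text \<open>In the expansion of \<open>\<theta>(E\<^sub>l)\<close> every increasing multi-index of the remaining seven frame fields contributes
  with the same sign, by the alternation of \<open>vol\<close>.\<close>

lemma balanced_contraction:
  fixes p :: 'm
  assumes vol: "induced_volume_form A \<Psi> vol" and bal: "balanced A g vol \<Psi>" and l: "l < 8"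
  defines "E \<equiv> orthonormal_choice A g p"
  shows "(\<Sum>a<8. \<Sum>b<8. \<Sum>c<8. \<Sum>d<8.
    ext_deriv \<Psi> [E ! l, E ! a, E ! b, E ! c, E ! d] p * \<Psi> [E ! a, E ! b, E ! c, E ! d] p) = 0"
proof -
  have E: "orthonormal_at A g p E" unfolding E_def by (rule orthonormal_choice)
  have EV: "set E \<subseteq> VF" "length E = 8" using E by (auto simp: orthonormal_at_def field_lists_def)
  have dE: "distinct E"
    unfolding distinct_conv_nth
  proof (intro allI impI)
    fix i j assume "i < length E" "j < length E" "i \<noteq> j"
    then show "E ! i \<noteq> E ! j"
      using orthonormal_g[OF E, of i i] orthonormal_g[OF E, of i j] EV by auto
  qed
  define x where "x = E ! l"
  define L where "L = take l E @ drop (Suc l) E"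
  have E_eq: "E = take l E @ x # drop (Suc l) E" unfolding x_def using l EV by (intro id_take_nth_drop) simp
  have mE: "mset (x # L) = mset E" "mset (L @ [x]) = mset E"
    by (subst E_eq, simp add: L_def)+
  have sE: "set (x # L) = set E" using mE(1) by (rule mset_eq_setD)
  have dL: "distinct (x # L)" using mset_eq_imp_distinct_iff[OF mE(1)] dE by simp
  have lL: "length L = 7" using l EV by (simp add: L_def)
  have LV: "set L \<subseteq> VF" "x \<in> VF" using sE EV by auto
  let ?d = "\<lambda>xs. ext_deriv \<Psi> xs p" and ?P = "\<lambda>xs. \<Psi> xs p" and ?v = "\<lambda>xs. vol xs p"
  have altd: "alternating VF 5 ?d" by (rule dPsi_alternating)
  have altP: "alternating VF 4 ?P" by (rule form_alternating[OF Psi_form])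
  have altv: "alternating VF 8 ?v" using vol by (intro form_alternating) (simp add: induced_volume_form_def)
  have v1: "?v (x # L) \<noteq> 0" by (rule vol_frame_nonzero[OF vol E mE(1)])
  have v2: "?v (L @ [x]) \<noteq> 0" by (rule vol_frame_nonzero[OF vol E mE(2)])
  define \<beta> where "\<beta> = wedge 3 (hodge A g vol 5 (ext_deriv \<Psi>)) \<Psi>"
  have "lee_form A g vol \<Psi> [x] p = 0"
    using bal LV(2) by (simp add: balanced_def tensor_eq_def)
  then have "(\<Sum>S | S \<subseteq> {..<8} \<and> card S = 7. \<beta> (nths E S) p * ?v (nths E S @ [x])) = 0"
    by (simp add: lee_form_def hodge_def \<beta>_def E_def Let_def)
  moreover have "(\<Sum>S | S \<subseteq> {..<8} \<and> card S = 7. \<beta> (nths E S) p * ?v (nths E S @ [x])) = \<beta> L p * ?v (L @ [x])"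
  proof -
    \<comment> \<open>Any other 7-subset contains l, so that \<open>vol\<close> receives x twice and
      vanishes.\<close>
    let ?S0 = "{..<8} - {l}"
    have n0: "nths E ?S0 = L"
      using nths_restrict[of E "- {l}"] nths_Compl_single[of l E] l EV by (simp add: L_def Diff_eq inf_commute)
    have z: "\<beta> (nths E S) p * ?v (nths E S @ [x]) = 0" if S: "S \<subseteq> {..<8}" "card S = 7" "S \<noteq> ?S0" for S
    proof -
      have "l \<in> S"
      proof (rule ccontr)
        assume "l \<notin> S"
        then have "S = ?S0" using S l by (intro card_subset_eq) auto
        then show False using S by simp
      qed
      then have "x \<in> set (nths E S)" unfolding x_def using l EV by (auto simp: set_nths)
      then have "\<not> distinct (nths E S @ [x])" by auto
      then have "?v (nths E S @ [x]) = 0"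
        using set_nths_subset[of E S] EV LV S
        by (intro alternating_not_distinct[OF altv]) (auto simp: length_nths_subset)
      then show ?thesis by simp
    qed
    have "(\<Sum>S | S \<subseteq> {..<8} \<and> card S = 7. \<beta> (nths E S) p * ?v (nths E S @ [x]))
        = (\<Sum>S\<in>{?S0}. \<beta> (nths E S) p * ?v (nths E S @ [x]))"
      using l z by (intro sum.mono_neutral_right) auto
    then show ?thesis by (simp add: n0)
  qed
  ultimately have \<beta>0: "\<beta> L p = 0" using v2 by simp
  \<comment> \<open>On three fields of L the Hodge star keeps a single 5-subset of the frame, x with
    the other four fields of L. Restoring the order of \<open>x # L\<close> in \<open>vol\<close>
    costs the shuffle sign of S, which is the one occurring in the wedge product, so the two
    cancel.\<close>
  have H: "hodge A g vol 5 (ext_deriv \<Psi>) (nths L S) p * shuffle_sign S = ?d (x # nths L (- S)) * ?v (x # L)"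
    if S: "S \<subseteq> {..<7}" "card S = 3" for S
  proof -
    let ?Y = "nths L S"
    have YV: "set ?Y \<subseteq> VF" "length ?Y = 3" using set_nths_subset[of L S] LV S lL by (auto simp: length_nths_subset)
    define h where "h = (\<lambda>xs. ?d xs * ?v (xs @ ?Y))"
    have "alternating VF 5 (\<lambda>xs. ?v (xs @ ?Y))"
      unfolding alternating_def
    proof (intro allI impI)
      fix us a b vs assume "set (us @ a # b # vs) \<subseteq> VF" "length (us @ a # b # vs) = 5"
      then show "?v ((us @ b # a # vs) @ ?Y) = - ?v ((us @ a # b # vs) @ ?Y)"
        using alternatingD[OF altv, of us a b "vs @ ?Y"] YV by simp
    qed
    then have hs: "swap_invariant VF 5 h" unfolding h_def by (rule alternating_mult[OF altd])
    have hz: "h xs = 0" if "set xs \<subseteq> VF" "length xs = 5" "\<not> distinct xs" for xs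
      using alternating_not_distinct[OF altd that] by (simp add: h_def)
    \<comment> \<open>Both sums are tuple sums over the same set of fields. This replaces the chosen
      frame by \<open>x # L\<close>, where position i of L has become position
      \<open>Suc i\<close>.\<close>
    have "(\<Sum>Q | Q \<subseteq> {..<length E} \<and> card Q = 5. h (nths E Q)) * fact 5
        = (\<Sum>xs | set xs \<subseteq> set E \<and> length xs = 5. h xs)"
      by (rule sum_subsets_tuples[OF hs _ dE EV(1)]) (rule hz)
    moreover have "(\<Sum>Q | Q \<subseteq> {..<length (x # L)} \<and> card Q = 5. h (nths (x # L) Q)) * fact 5
        = (\<Sum>xs | set xs \<subseteq> set (x # L) \<and> length xs = 5. h xs)"
      by (rule sum_subsets_tuples[OF hs _ dL]) (use hz EV sE in auto)
    ultimately have "(\<Sum>Q | Q \<subseteq> {..<length E} \<and> card Q = 5. h (nths E Q)) * fact 5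
        = (\<Sum>Q | Q \<subseteq> {..<length (x # L)} \<and> card Q = 5. h (nths (x # L) Q)) * fact 5"
      unfolding sE by (rule trans[OF _ sym])
    then have "(\<Sum>Q | Q \<subseteq> {..<length E} \<and> card Q = 5. h (nths E Q))
        = (\<Sum>Q | Q \<subseteq> {..<length (x # L)} \<and> card Q = 5. h (nths (x # L) Q))"
      unfolding mult_cancel_right by (auto simp: fact_nonzero)
    then have "hodge A g vol 5 (ext_deriv \<Psi>) ?Y p = (\<Sum>Q | Q \<subseteq> {..<8} \<and> card Q = 5. h (nths (x # L) Q))"
      using EV lL by (simp add: hodge_def Let_def h_def E_def[symmetric])
    also have "\<dots> = (\<Sum>Q\<in>{{..<8} - Suc ` S}. h (nths (x # L) Q))"
    proof (rule sum.mono_neutral_right)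
      have cS: "card ({..<8} - Suc ` S) = 5"
        using S by (subst card_Diff_subset) (auto simp: card_image finite_subset)
      then show "{{..<8} - Suc ` S} \<subseteq> {Q. Q \<subseteq> {..<8} \<and> card Q = 5}" by auto
      show "\<forall>Q\<in>{Q. Q \<subseteq> {..<8} \<and> card Q = 5} - {{..<8} - Suc ` S}. h (nths (x # L) Q) = 0"
      proof
        fix Q assume "Q \<in> {Q. Q \<subseteq> {..<8} \<and> card Q = 5} - {{..<8} - Suc ` S}"
        then have Q: "Q \<subseteq> {..<8}" "card Q = 5" "Q \<noteq> {..<8} - Suc ` S" by auto
        have "\<not> Q \<subseteq> {..<8} - Suc ` S" using card_subset_eq[of "{..<8} - Suc ` S" Q] cS Q by auto
        then obtain i where i: "i \<in> S" "Suc i \<in> Q" using Q by auto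
        then have "i < 7" using S by auto
        have "L ! i \<in> set (nths (x # L) Q)"
          unfolding set_nths using i lL \<open>i < 7\<close> by (intro CollectI exI[of _ "Suc i"]) simp
        moreover have "L ! i \<in> set ?Y"
          unfolding set_nths using i lL \<open>i < 7\<close> by (intro CollectI exI[of _ i]) simp
        ultimately have "\<not> distinct (nths (x # L) Q @ ?Y)" by auto
        then have "?v (nths (x # L) Q @ ?Y) = 0"
          using set_nths_subset[of "x # L" Q] LV YV Q lL
          by (intro alternating_not_distinct[OF altv]) (auto simp: length_nths_subset)
        then show "h (nths (x # L) Q) = 0" by (simp add: h_def)
      qed
    qed simp
    also have "\<dots> = h (x # nths L (- S))"
    proof -
      have "{j. Suc j \<in> {..<8} - Suc ` S} = - S \<inter> {..<7}" by auto
      then show ?thesis using nths_restrict[of L "- S"] lL by (simp add: nths_Cons)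
    qed
    finally have "hodge A g vol 5 (ext_deriv \<Psi>) ?Y p = ?d (x # nths L (- S)) * ?v ([x] @ nths L (- S) @ ?Y @ [])"
      by (simp add: h_def)
    moreover have "length (nths L (- S)) = 4"
    proof -
      have "- S \<inter> {..<7} = {..<7} - S" by auto
      then have "card (- S \<inter> {..<7}) = 4"
        using card_Diff_subset[OF finite_subset[OF S(1)] S(1)] S(2) by simp
      then show ?thesis using nths_restrict[of L "- S"] length_nths_subset[of "- S \<inter> {..<7}" L] lL by simp
    qed
    \<comment> \<open>Four fields pass three, an even number of transpositions.\<close>
    moreover have "?v ([x] @ nths L (- S) @ ?Y @ []) = (- 1) ^ (length (nths L (- S)) * length ?Y) * ?v ([x] @ ?Y @ nths L (- S) @ [])"
      using LV YV set_nths_subset[of L "- S"] calculation(2)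
      by (intro alternating_swap_blocks[OF altv]) auto
    moreover have "?v ([x] @ ?Y @ nths L (- S)) = shuffle_sign S * ?v ([x] @ L)"
      using LV lL S by (intro alternating_shuffle[OF altv]) auto
    ultimately have "hodge A g vol 5 (ext_deriv \<Psi>) ?Y p = ?d (x # nths L (- S)) * (shuffle_sign S * ?v (x # L))"
      using YV by simp
    then show ?thesis by (simp add: shuffle_sign_def power_add[symmetric] mult_2[symmetric] mult.left_commute)
  qed
  define \<phi> where "\<phi> = (\<lambda>xs. ?d (x # xs) * ?P xs)"
  have "\<beta> L p = (\<Sum>S | S \<subseteq> {..<7} \<and> card S = 3. \<phi> (nths L (- S)) * ?v (x # L))"
    unfolding \<beta>_def wedge_def lL
  proof (rule sum.cong[OF refl])
    fix S :: "nat set" assume "S \<in> {S. S \<subseteq> {..<7} \<and> card S = 3}"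
    then show "shuffle_sign S * hodge A g vol 5 (ext_deriv \<Psi>) (nths L S) p * ?P (nths L (- S)) = \<phi> (nths L (- S)) * ?v (x # L)"
      using H[of S] by (simp add: \<phi>_def mult.commute mult.left_commute)
  qed
  then have "(\<Sum>S | S \<subseteq> {..<7} \<and> card S = 3. \<phi> (nths L (- S))) = 0"
    using \<beta>0 v1 by (simp add: sum_distrib_right[symmetric])
  \<comment> \<open>Complementation exchanges the 3-subsets of the wedge product with the 4-subsets
    on which \<phi> is evaluated.\<close>
  also have "(\<Sum>S | S \<subseteq> {..<7} \<and> card S = 3. \<phi> (nths L (- S))) = (\<Sum>S | S \<subseteq> {..<7} \<and> card S = 4. \<phi> (nths L S))"
  proof (rule sum.reindex_bij_witness[of _ "\<lambda>S. {..<7} - S" "\<lambda>S. {..<7} - S"])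
    fix S assume "S \<in> {S. S \<subseteq> {..<7::nat} \<and> card S = 3}"
    then show "\<phi> (nths L ({..<7} - S)) = \<phi> (nths L (- S))"
      using nths_restrict[of L "- S"] lL by (simp add: Diff_eq Int_commute)
  qed (auto simp: card_Diff_subset finite_subset double_diff)
  finally have \<phi>0: "(\<Sum>S | S \<subseteq> {..<length L} \<and> card S = 4. \<phi> (nths L S)) = 0" using lL by simp
  have "alternating VF 4 (\<lambda>xs. ?d (x # xs))"
    unfolding alternating_def
  proof (intro allI impI)
    fix us a b vs assume "set (us @ a # b # vs) \<subseteq> VF" "length (us @ a # b # vs) = 4"
    then show "?d (x # us @ b # a # vs) = - ?d (x # us @ a # b # vs)"
      using alternatingD[OF altd, of "x # us" a b vs] LV by simp
  qed
  then have \<phi>s: "swap_invariant VF 4 \<phi>" unfolding \<phi>_def by (rule alternating_mult[OF _ altP])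
  have \<phi>z: "\<phi> xs = 0" if "set xs \<subseteq> VF" "length xs = 4" "\<not> distinct xs" for xs
    using alternating_not_distinct[OF altP that] by (simp add: \<phi>_def)
  have "(\<Sum>xs | set xs \<subseteq> set L \<and> length xs = 4. \<phi> xs) = 0"
    using sum_subsets_tuples[OF \<phi>s \<phi>z _ LV(1)] \<phi>0 dL by simp
  \<comment> \<open>Tuples containing x may be included, since they repeat an argument of d\<Psi>.
    The indices then run over the whole frame.\<close>
  moreover have "(\<Sum>xs | set xs \<subseteq> set E \<and> length xs = 4. \<phi> xs) = (\<Sum>xs | set xs \<subseteq> set L \<and> length xs = 4. \<phi> xs)"
  proof (rule sum.mono_neutral_right)
    show "finite {xs. set xs \<subseteq> set E \<and> length xs = 4}" by (rule finite_lists_length_eq) simp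
    show "{xs. set xs \<subseteq> set L \<and> length xs = 4} \<subseteq> {xs. set xs \<subseteq> set E \<and> length xs = 4}" using sE by auto
    show "\<forall>xs\<in>{xs. set xs \<subseteq> set E \<and> length xs = 4} - {xs. set xs \<subseteq> set L \<and> length xs = 4}. \<phi> xs = 0"
    proof
      fix xs assume "xs \<in> {xs. set xs \<subseteq> set E \<and> length xs = 4} - {xs. set xs \<subseteq> set L \<and> length xs = 4}"
      then have xs: "set xs \<subseteq> set E" "length xs = 4" "x \<in> set xs" using sE by auto
      then have "?d (x # xs) = 0" using EV LV by (intro alternating_not_distinct[OF altd]) auto
      then show "\<phi> xs = 0" by (simp add: \<phi>_def)
    qed
  qed
  ultimately have tup: "(\<Sum>xs | set xs \<subseteq> set E \<and> length xs = 4. \<phi> xs) = 0" by simp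
  have b: "(\<Sum>y\<in>set E. f y) = (\<Sum>i<8. f (E ! i))" for f :: "'m vfield \<Rightarrow> real"
    using sum.reindex_bij_betw[OF bij_betw_nth[OF dE, of "{..<8}" "set E"], of f] EV by simp
  have e0: "{xs. set xs \<subseteq> set E \<and> length xs = 0} = {[]}" by auto
  have "(\<Sum>xs | set xs \<subseteq> set E \<and> length xs = 4. \<phi> xs)
     = (\<Sum>a<8. \<Sum>b<8. \<Sum>c<8. \<Sum>d<8. \<phi> [E ! a, E ! b, E ! c, E ! d])"
  proof -
    have four: "4 = Suc (Suc (Suc (Suc 0)))" by simp
    show ?thesis unfolding four sum_lists_Suc[OF finite_set] b e0 by simp
  qed
  then show ?thesis using tup by (simp add: \<phi>_def x_def)
qed

end

section \<open>The Lee form in index notation\<close>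

context spin7_array
begin

text \<open>The quadratic equation (contr - 2)(contr + 6) = 0 on 2-forms. It reduces the product of
  two copies of \<Psi> in the Lee form to one.\<close>

lemma contr_contr:
  assumes B: "\<And>a b. B b a = - B a b" and kl: "k < 8" "l < 8"
  shows "contr (contr B) k l = 12 * B k l - 4 * contr B k l"
proof -
  have "\<forall>l<8. \<forall>k<l. contr (contr B) k l = 12 * B k l - 4 * contr B k l"
    unfolding all_pairs_8 contr_eval[of "contr B", OF contr_skew] contr_eval[of B, OF B] by simp
  then have sorted: "contr (contr B) k l = 12 * B k l - 4 * contr B k l" if "k < l" "l < 8" for k l
    using that by blast
  consider "k < l" | "l < k" | "k = l" by linarith
  then show ?thesis
    using sorted[of k l] sorted[of l k] kl contr_skew[of B k l] contr_skew[of "contr B" k l]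
      contr_diag[of B k] contr_diag[of "contr B" k] B[of k l] B[of k k] by cases auto
qed

end

text \<open>Of the ten terms of d\<Psi> the four with l on the torsion all relabel to S f, the six
  with l on \<psi> to S h. S f is zero: t is skew in its last two indices, and the product of two
  \<psi> contracted over three indices is symmetric. So the vanishing total gives S h = 0.\<close>

lemma lee_index:
  fixes t :: "nat \<Rightarrow> nat \<Rightarrow> nat \<Rightarrow> real" and \<psi> :: "nat \<Rightarrow> nat \<Rightarrow> nat \<Rightarrow> nat \<Rightarrow> real"
  assumes t: "\<And>i j k. t i k j = - t i j k"
    and psi: "\<And>i j k l. \<psi> j i k l = - \<psi> i j k l" "\<And>i j k l. \<psi> i k j l = - \<psi> i j k l" "\<And>i j k l. \<psi> i j l k = - \<psi> i j k l"
    and z: "(\<Sum>a<8. \<Sum>b<8. \<Sum>c<8. \<Sum>d<8. ((\<Sum>s<8. t l a s * \<psi> s b c d) - (\<Sum>s<8. t l b s * \<psi> s a c d)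
      + (\<Sum>s<8. t l c s * \<psi> s a b d) - (\<Sum>s<8. t l d s * \<psi> s a b c) + (\<Sum>s<8. t a b s * \<psi> s l c d)
      - (\<Sum>s<8. t a c s * \<psi> s l b d) + (\<Sum>s<8. t a d s * \<psi> s l b c) + (\<Sum>s<8. t b c s * \<psi> s l a d)
      - (\<Sum>s<8. t b d s * \<psi> s l a c) + (\<Sum>s<8. t c d s * \<psi> s l a b)) * \<psi> a b c d) = 0"
  shows "(\<Sum>a<8. \<Sum>b<8. \<Sum>c<8. \<Sum>d<8. (\<Sum>s<8. t a b s * \<psi> s l c d) * \<psi> a b c d) = 0"
proof -
  define f where "f a b c d = (\<Sum>s<8. t l a s * \<psi> s b c d) * \<psi> a b c d" for a b c d
  define h where "h a b c d = (\<Sum>s<8. t a b s * \<psi> s l c d) * \<psi> a b c d" for a b c d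
  define S where "S u = (\<Sum>a<8. \<Sum>b<8. \<Sum>c<8. \<Sum>d<8. u a b c d :: real)" for u :: "nat \<Rightarrow> nat \<Rightarrow> nat \<Rightarrow> nat \<Rightarrow> real"
  have sw: "S (\<lambda>a b c d. u b a c d) = S u" "S (\<lambda>a b c d. u a c b d) = S u" "S (\<lambda>a b c d. u a b d c) = S u" for u
    unfolding S_def by (rule sum4_swap)+
  have "((\<Sum>s<8. t l a s * \<psi> s b c d) - (\<Sum>s<8. t l b s * \<psi> s a c d)
      + (\<Sum>s<8. t l c s * \<psi> s a b d) - (\<Sum>s<8. t l d s * \<psi> s a b c) + (\<Sum>s<8. t a b s * \<psi> s l c d)
      - (\<Sum>s<8. t a c s * \<psi> s l b d) + (\<Sum>s<8. t a d s * \<psi> s l b c) + (\<Sum>s<8. t b c s * \<psi> s l a d)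
      - (\<Sum>s<8. t b d s * \<psi> s l a c) + (\<Sum>s<8. t c d s * \<psi> s l a b)) * \<psi> a b c d
    = f a b c d + f b a c d + f c a b d + f d a b c
      + h a b c d + h a c b d + h a d b c + h b c a d + h b d a c + h c d a b" for a b c d
  proof -
    have p: "\<psi> b a c d = - \<psi> a b c d" "\<psi> c a b d = \<psi> a b c d" "\<psi> d a b c = - \<psi> a b c d"
    "\<psi> a c b d = - \<psi> a b c d" "\<psi> a d b c = \<psi> a b c d" "\<psi> b c a d = \<psi> a b c d" "\<psi> b d a c = - \<psi> a b c d"
    "\<psi> c d a b = \<psi> a b c d"
    using psi(1)[of b a c d] psi(2)[of a c b d] psi(1)[of c a b d] psi(3)[of a b d c] psi(2)[of a d b c] psi(1)[of d a b c]
      psi(2)[of b c a d] psi(3)[of b a d c] psi(2)[of b d a c] psi(1)[of a b d c] psi(3)[of b c d a]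
      psi(2)[of c d a b] psi(3)[of c a d b] psi(1)[of c a d b] psi(2)[of a c d b] psi(3)[of a c b d] by linarith+
    show ?thesis unfolding f_def h_def p by (simp add: distrib_right left_diff_distrib)
  qed
  then have "S (\<lambda>a b c d. f a b c d + f b a c d + f c a b d + f d a b c
      + h a b c d + h a c b d + h a d b c + h b c a d + h b d a c + h c d a b) = 0"
    using z unfolding S_def by simp
  then have "S f + S (\<lambda>a b c d. f b a c d) + S (\<lambda>a b c d. f c a b d) + S (\<lambda>a b c d. f d a b c)
      + S h + S (\<lambda>a b c d. h a c b d) + S (\<lambda>a b c d. h a d b c) + S (\<lambda>a b c d. h b c a d)
      + S (\<lambda>a b c d. h b d a c) + S (\<lambda>a b c d. h c d a b) = 0"
    unfolding S_def sum.distrib .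
  moreover have f1: "S (\<lambda>a b c d. f c a b d) = S f"
    using sw(2)[of "\<lambda>a b c d. f b a c d"] sw(1)[of f] by simp
  moreover have "S (\<lambda>a b c d. f d a b c) = S f"
    using sw(3)[of "\<lambda>a b c d. f c a b d"] f1 by simp
  moreover have h1: "S (\<lambda>a b c d. h a d b c) = S h"
    using sw(3)[of "\<lambda>a b c d. h a c b d"] sw(2)[of h] by simp
  moreover have h2: "S (\<lambda>a b c d. h b c a d) = S h"
    using sw(1)[of "\<lambda>a b c d. h a c b d"] sw(2)[of h] by simp
  moreover have h3: "S (\<lambda>a b c d. h b d a c) = S h"
    using sw(3)[of "\<lambda>a b c d. h b c a d"] h2 by simp
  moreover have "S (\<lambda>a b c d. h c d a b) = S h"
    using sw(2)[of "\<lambda>a b c d. h b d a c"] h3 by simp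
  ultimately have "4 * S f + 6 * S h = 0" using sw(1)[of f] sw(2)[of h] by simp
  moreover have "S f = 0"
  proof -
    define M where "M a s = (\<Sum>b<8. \<Sum>c<8. \<Sum>d<8. \<psi> s b c d * \<psi> a b c d)" for a s
    have "S f = (\<Sum>a<8. \<Sum>b<8. \<Sum>c<8. \<Sum>d<8. \<Sum>s<8. t l a s * (\<psi> s b c d * \<psi> a b c d))"
      unfolding S_def f_def sum_distrib_right by (simp add: mult.assoc)
    also have "\<dots> = (\<Sum>a<8. \<Sum>s<8. t l a s * M a s)"
      unfolding M_def sum_distrib_left by (rule sum.cong[OF refl], rule sum_rot4)
    also have "\<dots> = 0"
    proof (rule sum_skew_sym)
      fix i j
      show "t l j i = - t l i j" by (rule t)
      show "M j i = M i j" unfolding M_def by (intro sum.cong refl mult.commute)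
    qed
    finally show ?thesis .
  qed
  ultimately show ?thesis unfolding S_def h_def by simp
qed

context smooth_manifold
begin

text \<open>The derivative looks at neighbouring points and at changed arguments, so vanishing is
  required for all fields and at all points, not in a frame at p alone.\<close>

lemma cov_zero:
  assumes "V \<in> VF" "\<And>Y. Y \<in> VF \<Longrightarrow> D V Y \<in> VF" "Xs \<in> field_lists A k" "\<And>Xs p. Xs \<in> field_lists A k \<Longrightarrow> \<alpha> Xs p = 0"
  shows "cov_deriv D V \<alpha> Xs p = 0"
proof -
  have "\<alpha> Xs = (\<lambda>p. 0)" using assms(4)[OF assms(3)] by auto
  moreover have "\<alpha> (Xs[i := D V (Xs ! i)]) p = 0" if "i < length Xs" for i
    using that assms field_lists_length[OF assms(3)]
    by (intro assms(4) field_lists_update assms(2) field_lists_nth[OF assms(3)]) auto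
  ultimately show ?thesis unfolding cov_deriv_def using vf_const[OF assms(1), of 0] by simp
qed

end

section \<open>Reduction of tensor identities to frames at a point\<close>

context spin7_torsion
begin

text \<open>The arguments are expanded one after the other, beginning with the last;
  \<open>us\<close> holds those still arbitrary, \<open>vs\<close> the frame indices already
  introduced.\<close>

lemma tens_zeroI:
  assumes E: "orthonormal_at A g p E" and \<alpha>: "tens k \<alpha>"
    and z: "\<And>Zs. set Zs \<subseteq> {..<8} \<Longrightarrow> length Zs = k \<Longrightarrow> \<alpha> (map (frm E) Zs) p = 0"
    and Xs: "Xs \<in> field_lists A k"
  shows "\<alpha> Xs p = 0"
proof -
  have "set us \<subseteq> VF \<Longrightarrow> set vs \<subseteq> {..<8} \<Longrightarrow> length us + length vs = k \<Longrightarrow> \<alpha> (us @ map (frm E) vs) p = 0" for us vs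
  proof (induction us arbitrary: vs rule: rev_induct)
    case Nil
    then show ?case using z by simp
  next
    case (snoc x us)
    have X: "us @ x # map (frm E) vs \<in> field_lists A k"
      using snoc.prems frm_in[OF E] by (auto simp: field_lists_def)
    have "\<alpha> (us @ x # map (frm E) vs) p = (\<Sum>j<8. g [x, E ! j] p * \<alpha> (us @ map (frm E) (j # vs)) p)"
      using tens_expand[OF E \<alpha> X, of "length us"] snoc.prems
      by (simp add: nth_append list_update_append frm_nth cong: sum.cong_simp)
    also have "\<dots> = 0"
      using snoc.IH[of "_ # vs"] snoc.prems by (intro sum.neutral) auto
    finally show ?case by simp
  qed
  from this[of Xs "[]"] Xs show ?thesis by (simp add: field_lists_def)
qed

lemma ctr_frame:
  assumes E: "orthonormal_at A g p E" and "tens (Suc (Suc (length Ys))) \<alpha>" "set Ys \<subseteq> VF"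
  shows "ctr \<alpha> Ys p = (\<Sum>i<8. \<alpha> (frm E i # frm E i # Ys) p)"
  using ctr_eq[OF assms(1,2)] assms(3) by (simp add: field_lists_def frm_nth cong: sum.cong_simp)

lemma cov_ctr_frame:
  assumes E: "orthonormal_at A g p E" and "tens (Suc (Suc (length Ys))) \<alpha>" "set Ys \<subseteq> VF" "X \<in> VF"
  shows "cov_deriv D X (ctr \<alpha>) Ys p = (\<Sum>i<8. cov_deriv D X \<alpha> (frm E i # frm E i # Ys) p)"
  using cov_ctr[OF assms(4,2), of Ys p] ctr_frame[OF E tens_cov[OF assms(4,2)] assms(3)] assms(3)
  by (simp add: field_lists_def)

lemma T_tor_expand:
  assumes E: "orthonormal_at A g p E" and "X \<in> VF" "Y \<in> VF" and \<alpha>: "tens (Suc (length Ys)) \<alpha>" and Ys: "set Ys \<subseteq> VF"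
  shows "\<alpha> (tor X Y # Ys) p = (\<Sum>s<8. T [X, Y, frm E s] p * \<alpha> (frm E s # Ys) p)"
  using tens_expand[OF E \<alpha>, of "tor X Y # Ys" 0] assms
  by (simp add: field_lists_def T_eq frm_nth cong: sum.cong_simp)

lemma Psi_tens_Suc: "tens (Suc (Suc (Suc (Suc 0)))) \<Psi>"
  using Psi_tens by (simp add: eval_nat_numeral)

lemma Rop_expand:
  assumes E: "orthonormal_at A g p E" and "X \<in> VF" "Y \<in> VF" and \<alpha>: "tens k \<alpha>" and Zs: "Zs \<in> field_lists A k" "i < k"
  shows "\<alpha> (Zs[i := Rop X Y (Zs ! i)]) p = (\<Sum>s<8. R [X, Y, Zs ! i, frm E s] p * \<alpha> (Zs[i := frm E s]) p)"
  using tens_expand[OF E \<alpha> field_lists_update[OF Zs(1), of "Rop X Y (Zs ! i)" i] Zs(2)] assms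
    field_lists_nth[OF Zs] field_lists_length[OF Zs(1)]
  by (simp add: R_eq frm_nth cong: sum.cong_simp)

lemma holonomy_frame:
  assumes F: "adapted p e F" and XY: "X \<in> VF" "Y \<in> VF" and kl: "k < 8" "l < 8"
  shows "(\<Sum>a<8. \<Sum>b<8. R [X, Y, frm F a, frm F b] p * \<Psi> [frm F a, frm F b, frm F k, frm F l] p)
    = 2 * R [X, Y, frm F k, frm F l] p"
proof -
  note O = adapted_orthonormal[OF F]
  note V = frm_in[OF O]
  interpret spin7_array "\<lambda>i j k l. \<Psi> [frm F i, frm F j, frm F k, frm F l] p"
    by (rule spin7_array_frame[OF F])
  have "contr (\<lambda>a b. R [X, Y, frm F a, frm F b] p) k l = 2 * R [X, Y, frm F k, frm F l] p"
  proof (rule stabilizer_eigen)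
    fix a b show "R [X, Y, frm F b, frm F a] p = - R [X, Y, frm F a, frm F b] p"
      by (rule R_skew2[OF XY V V])
  next
    fix i j m n
    have Zs: "[frm F i, frm F j, frm F m, frm F n] \<in> field_lists A 4" using V by (simp add: eval_nat_numeral)
    show "(\<Sum>a<8. R [X, Y, frm F i, frm F a] p * \<Psi> [frm F a, frm F j, frm F m, frm F n] p)
      + (\<Sum>a<8. R [X, Y, frm F j, frm F a] p * \<Psi> [frm F i, frm F a, frm F m, frm F n] p)
      + (\<Sum>a<8. R [X, Y, frm F m, frm F a] p * \<Psi> [frm F i, frm F j, frm F a, frm F n] p)
      + (\<Sum>a<8. R [X, Y, frm F n, frm F a] p * \<Psi> [frm F i, frm F j, frm F m, frm F a] p) = 0"
      using R_Psi[OF XY V[of i] V[of j] V[of m] V[of n], of p]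
        Rop_expand[OF O XY Psi_tens Zs, of 0] Rop_expand[OF O XY Psi_tens Zs, of 1]
        Rop_expand[OF O XY Psi_tens Zs, of 2] Rop_expand[OF O XY Psi_tens Zs, of 3]
      by (simp add: numeral_2_eq_2 numeral_3_eq_3)
  qed (use kl in auto)
  then show ?thesis by (simp add: contr_def)
qed

text \<open>As \<open>ctr\<close> contracts the two leading arguments, \<open>reslot\<close> moves the slots to be contracted to the front
  in pairs.\<close>

definition lee_tensor :: "'m tensor" where
  "lee_tensor = reslot [8, 6, 4, 5, 10, 2, 0, 9, 7, 3, 1] (tprod 3 T (tprod 4 \<Psi> \<Psi>))"

lemma lee_tensor_tens: "tens (Suc (Suc (Suc (Suc (Suc (Suc (Suc (Suc (Suc (Suc (Suc 0))))))))))) lee_tensor"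
proof -
  have "tens (3 + (4 + 4)) lee_tensor" unfolding lee_tensor_def
    by (intro tens_reslot tens_tprod T_tens Psi_tens) (auto simp: eval_nat_numeral less_Suc_eq)
  then show ?thesis by (simp add: eval_nat_numeral)
qed

lemma lee_contraction:
  assumes E: "orthonormal_at A g p E" and X: "X \<in> VF"
  shows "ctr (ctr (ctr (ctr (ctr lee_tensor)))) [X] p = (\<Sum>a<8. \<Sum>b<8. \<Sum>s<8. \<Sum>c<8. \<Sum>d<8.
    T [frm E a, frm E b, frm E s] p * (\<Psi> [frm E s, X, frm E c, frm E d] p * \<Psi> [frm E a, frm E b, frm E c, frm E d] p))"
proof -
  note t1 = tens_ctr[OF lee_tensor_tens] note t2 = tens_ctr[OF t1] note t3 = tens_ctr[OF t2] note t4 = tens_ctr[OF t3]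
  show ?thesis
    by (simp add: ctr_frame[OF E] lee_tensor_tens t1 t2 t3 t4 frm_in[OF E] X)
      (simp add: lee_tensor_def reslot_def tprod_def)
qed

text \<open>\<open>balanced_contraction\<close> concerns the chosen orthonormal frame, whereas the
  components of \<Psi> are explicit in adapted frames only. As a contraction of
  \<open>lee_tensor\<close>, the identity is carried from one to the other. There
  \<open>contr_contr\<close> yields 12 t_sls, which is zero by skewness, and -4 times the wanted
  contraction.\<close>

lemma torsion_Psi_frame:
  assumes vol: "induced_volume_form A \<Psi> vol" and bal: "balanced A g vol \<Psi>" and F: "adapted p e F" and l: "l < 8"
  shows "(\<Sum>a<8. \<Sum>b<8. \<Sum>c<8. T [frm F a, frm F b, frm F c] p * \<Psi> [frm F a, frm F b, frm F c, frm F l] p) = 0"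
proof -
  let ?L = "ctr (ctr (ctr (ctr (ctr lee_tensor))))"
  have tL: "tens 1 ?L" using lee_tensor_tens by (simp add: tens_ctr)
  define E where "E = orthonormal_choice A g p"
  have E: "orthonormal_at A g p E" unfolding E_def by (rule orthonormal_choice)
  note V = frm_in[OF E]
  have "?L [frm E l] p = 0" if l: "l < 8" for l
  proof -
    have "(\<Sum>a<8. \<Sum>b<8. \<Sum>c<8. \<Sum>d<8.
      (\<Sum>s<8. T [frm E a, frm E b, frm E s] p * \<Psi> [frm E s, frm E l, frm E c, frm E d] p) * \<Psi> [frm E a, frm E b, frm E c, frm E d] p) = 0"
    proof (rule lee_index)
      fix i j k show "T [frm E i, frm E k, frm E j] p = - T [frm E i, frm E j, frm E k] p" by (rule T_skew(2)[OF V V V])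
    next
      have "(\<Sum>a<8. \<Sum>b<8. \<Sum>c<8. \<Sum>d<8.
        ext_deriv \<Psi> [frm E l, frm E a, frm E b, frm E c, frm E d] p * \<Psi> [frm E a, frm E b, frm E c, frm E d] p) = 0"
        using balanced_contraction[OF vol bal l, of p] l unfolding E_def[symmetric]
        by (simp add: frm_nth cong: sum.cong_simp)
      then show "(\<Sum>a<8. \<Sum>b<8. \<Sum>c<8. \<Sum>d<8.
         ((\<Sum>s<8. T [frm E l, frm E a, frm E s] p * \<Psi> [frm E s, frm E b, frm E c, frm E d] p)
        - (\<Sum>s<8. T [frm E l, frm E b, frm E s] p * \<Psi> [frm E s, frm E a, frm E c, frm E d] p)
        + (\<Sum>s<8. T [frm E l, frm E c, frm E s] p * \<Psi> [frm E s, frm E a, frm E b, frm E d] p)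
        - (\<Sum>s<8. T [frm E l, frm E d, frm E s] p * \<Psi> [frm E s, frm E a, frm E b, frm E c] p)
        + (\<Sum>s<8. T [frm E a, frm E b, frm E s] p * \<Psi> [frm E s, frm E l, frm E c, frm E d] p)
        - (\<Sum>s<8. T [frm E a, frm E c, frm E s] p * \<Psi> [frm E s, frm E l, frm E b, frm E d] p)
        + (\<Sum>s<8. T [frm E a, frm E d, frm E s] p * \<Psi> [frm E s, frm E l, frm E b, frm E c] p)
        + (\<Sum>s<8. T [frm E b, frm E c, frm E s] p * \<Psi> [frm E s, frm E l, frm E a, frm E d] p)
        - (\<Sum>s<8. T [frm E b, frm E d, frm E s] p * \<Psi> [frm E s, frm E l, frm E a, frm E c] p)
        + (\<Sum>s<8. T [frm E c, frm E d, frm E s] p * \<Psi> [frm E s, frm E l, frm E a, frm E b] p))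
        * \<Psi> [frm E a, frm E b, frm E c, frm E d] p) = 0"
        by (simp add: dPsi_eq[OF V V V V V] T_tor_expand[OF E V V] V Psi_tens_Suc)
    qed (rule Psi_skew[OF V V V V])+
    moreover have "?L [frm E l] p = (\<Sum>a<8. \<Sum>b<8. \<Sum>c<8. \<Sum>d<8.
      (\<Sum>s<8. T [frm E a, frm E b, frm E s] p * \<Psi> [frm E s, frm E l, frm E c, frm E d] p) * \<Psi> [frm E a, frm E b, frm E c, frm E d] p)"
      unfolding lee_contraction[OF E V] sum_distrib_right
      by (rule sum.cong[OF refl], rule sum.cong[OF refl], subst sum_rot3[symmetric]) (simp only: mult.assoc)
    ultimately show ?thesis by (simp only:)
  qed
  note L1 = this
  have L0: "?L [X] p = 0" if "X \<in> VF" for X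
  proof (rule tens_zeroI[OF E tL])
    fix Zs :: "nat list" assume Zs: "set Zs \<subseteq> {..<8}" "length Zs = 1"
    then obtain l where l: "Zs = [l]" by (cases Zs) auto
    then have "l < 8" using Zs by simp
    then show "?L (map (frm E) Zs) p = 0" unfolding l using L1 by (simp only: list.map)
  next
    show "[X] \<in> field_lists A 1" using that by simp
  qed
  note O = adapted_orthonormal[OF F]
  note W = frm_in[OF O]
  define t where "t a b c = T [frm F a, frm F b, frm F c] p" for a b c
  define ps where "ps = (\<lambda>i j k l. \<Psi> [frm F i, frm F j, frm F k, frm F l] p)"
  interpret spin7_array ps
    unfolding ps_def by (rule spin7_array_frame[OF F])
  have tsk: "t b a c = - t a b c" "t a c b = - t a b c" for a b c
    unfolding t_def by (rule T_skew[OF W W W])+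
  have "0 = (\<Sum>a<8. \<Sum>b<8. \<Sum>s<8. \<Sum>c<8. \<Sum>d<8. t a b s * (ps s l c d * ps a b c d))"
    using lee_contraction[OF O W[of l]] L0[OF W[of l]] unfolding t_def ps_def by simp
  also have "\<dots> = (\<Sum>s<8. \<Sum>a<8. \<Sum>b<8. \<Sum>c<8. \<Sum>d<8. t a b s * (ps s l c d * ps a b c d))"
    by (rule sum_rot3)
  also have "\<dots> = (\<Sum>s<8. contr (contr (\<lambda>a b. t a b s)) s l)"
  proof (rule sum.cong[OF refl])
    fix s
    have "(\<Sum>a<8. \<Sum>b<8. \<Sum>c<8. \<Sum>d<8. t a b s * (ps s l c d * ps a b c d))
        = (\<Sum>c<8. \<Sum>d<8. \<Sum>a<8. \<Sum>b<8. t a b s * (ps s l c d * ps a b c d))"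
      by (subst sum_rot4, subst sum_rot4, rule refl)
    also have "\<dots> = (\<Sum>c<8. \<Sum>d<8. \<Sum>a<8. \<Sum>b<8. t a b s * ps a b c d * ps c d s l)"
    proof (intro sum.cong refl)
      fix a b c d
      have "ps s l c d = ps c d s l" by (rule psi_pair)
      then show "t a b s * (ps s l c d * ps a b c d) = t a b s * ps a b c d * ps c d s l" by simp
    qed
    finally show "(\<Sum>a<8. \<Sum>b<8. \<Sum>c<8. \<Sum>d<8. t a b s * (ps s l c d * ps a b c d)) = contr (contr (\<lambda>a b. t a b s)) s l"
      unfolding contr_def sum_distrib_right .
  qed
  also have "\<dots> = (\<Sum>s<8. 12 * t s l s - 4 * contr (\<lambda>a b. t a b s) s l)"
    using l by (intro sum.cong refl contr_contr tsk(1)) auto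
  also have "\<dots> = - 4 * (\<Sum>s<8. contr (\<lambda>a b. t a b s) s l)"
  proof -
    have "t s l s = 0" for s using tsk(1)[of s l s] tsk(2)[of l s s] by simp
    then show ?thesis by (simp add: sum_distrib_left sum_negf)
  qed
  finally have "(\<Sum>s<8. contr (\<lambda>a b. t a b s) s l) = 0" by simp
  then have "(\<Sum>s<8. \<Sum>a<8. \<Sum>b<8. t a b s * ps a b s l) = 0" unfolding contr_def .
  then show ?thesis unfolding t_def ps_def by (subst sum_rot3)
qed

end

section \<open>Holonomy and the exterior derivative of the torsion\<close>

context spin7_torsion
begin

lemma tens_reslot_tprod:
  assumes "tens k \<alpha>" "tens l \<beta>" "distinct \<pi>" "set \<pi> = {..<k + l}"
  shows "tens (k + l) (reslot \<pi> (tprod k \<alpha> \<beta>))"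
  by (rule tens_reslot[OF tens_tprod[OF assms(1,2)] assms(3,4)])

lemma cov_reslot_tprod:
  assumes "V \<in> VF" "tens k \<alpha>" "tens l \<beta>" "distinct \<pi>" "set \<pi> = {..<k + l}" "Xs \<in> field_lists A (k + l)"
  shows "cov_deriv D V (reslot \<pi> (tprod k \<alpha> \<beta>)) Xs p =
    cov_deriv D V \<alpha> (take k (map ((!) Xs) \<pi>)) p * \<beta> (drop k (map ((!) Xs) \<pi>)) p
    + \<alpha> (take k (map ((!) Xs) \<pi>)) p * cov_deriv D V \<beta> (drop k (map ((!) Xs) \<pi>)) p"
  by (simp only: cov_reslot[OF assms(4-6)] cov_tprod[OF assms(1-3) reslot_in[OF assms(5,4,6)]])

lemma cov_T_skew:
  assumes "V \<in> VF" "X \<in> VF" "Y \<in> VF" "Z \<in> VF"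
  shows "cov_deriv D V T [Y, X, Z] p = - cov_deriv D V T [X, Y, Z] p"
    "cov_deriv D V T [X, Z, Y] p = - cov_deriv D V T [X, Y, Z] p"
proof -
  have "T [Y, X, Z] = (\<lambda>p. - T [X, Y, Z] p)" "T [X, Z, Y] = (\<lambda>p. - T [X, Y, Z] p)"
    using T_skew[OF assms(2-4)] by auto
  then have "V (T [Y, X, Z]) p = - V (T [X, Y, Z]) p" "V (T [X, Z, Y]) p = - V (T [X, Y, Z]) p"
    using vf_uminus[OF assms(1), of "T [X, Y, Z]"] assms by auto
  moreover note D = D_in[OF assms(1)]
  ultimately show "cov_deriv D V T [Y, X, Z] p = - cov_deriv D V T [X, Y, Z] p"
    "cov_deriv D V T [X, Z, Y] p = - cov_deriv D V T [X, Y, Z] p"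
    unfolding cov3 using T_skew[OF D[OF assms(2)] assms(3,4), of p] T_skew[OF assms(2) D[OF assms(3)] assms(4), of p]
      T_skew[OF assms(2,3) D[OF assms(4)], of p]
    by simp_all
qed

lemma cov_R_skew:
  assumes "V \<in> VF" "X \<in> VF" "Y \<in> VF" "Z \<in> VF" "W \<in> VF"
  shows "cov_deriv D V R [Y, X, Z, W] p = - cov_deriv D V R [X, Y, Z, W] p"
    "cov_deriv D V R [X, Y, W, Z] p = - cov_deriv D V R [X, Y, Z, W] p"
proof -
  have sm: "smooth_fun A (R [X, Y, Z, W])" unfolding R_eq using assms by simp
  have "R [Y, X, Z, W] = (\<lambda>p. - R [X, Y, Z, W] p)" "R [X, Y, W, Z] = (\<lambda>p. - R [X, Y, Z, W] p)"
    using R_skew1[OF assms(2-5)] R_skew2[OF assms(2-5)] by auto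
  then have "V (R [Y, X, Z, W]) p = - V (R [X, Y, Z, W]) p" "V (R [X, Y, W, Z]) p = - V (R [X, Y, Z, W]) p"
    using vf_uminus[OF assms(1) sm] by auto
  moreover note D = D_in[OF assms(1)]
  ultimately show "cov_deriv D V R [Y, X, Z, W] p = - cov_deriv D V R [X, Y, Z, W] p"
    "cov_deriv D V R [X, Y, W, Z] p = - cov_deriv D V R [X, Y, Z, W] p"
    unfolding cov4
    using R_skew1[OF D[OF assms(2)] assms(3-5), of p] R_skew1[OF assms(2) D[OF assms(3)] assms(4,5), of p]
      R_skew1[OF assms(2,3) D[OF assms(4)] assms(5), of p] R_skew1[OF assms(2-4) D[OF assms(5)], of p]
      R_skew2[OF D[OF assms(2)] assms(3-5), of p] R_skew2[OF assms(2) D[OF assms(3)] assms(4,5), of p]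
      R_skew2[OF assms(2,3) D[OF assms(4)] assms(5), of p] R_skew2[OF assms(2-4) D[OF assms(5)], of p]
    by simp_all
qed

lemma T_tens_Suc: "tens (Suc (Suc (Suc 0))) T"
  using T_tens by (simp add: numeral_3_eq_3)

lemma R_tens_Suc: "tens (Suc (Suc (Suc (Suc 0)))) R"
  using R_tens by (simp add: eval_nat_numeral)

lemma tens_zero_adapted:
  assumes \<alpha>: "tens k \<alpha>"
    and z: "\<And>e F Zs. adapted p e F \<Longrightarrow> set Zs \<subseteq> {..<8} \<Longrightarrow> length Zs = k \<Longrightarrow> \<alpha> (map (frm F) Zs) p = 0"
    and Xs: "Xs \<in> field_lists A k"
  shows "\<alpha> Xs p = 0"
proof -
  obtain e F where F: "adapted p e F" using adapted_exists by blast
  show ?thesis by (rule tens_zeroI[OF adapted_orthonormal[OF F] \<alpha> z[OF F] Xs])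
qed

lemma T_derivative:
  assumes "V \<in> VF" "X \<in> VF" "Y \<in> VF" "Z \<in> VF"
  shows "V (T [X, Y, Z]) p = cov_deriv D V T [X, Y, Z] p
    + T [D V X, Y, Z] p - T [D V Y, X, Z] p + T [D V Z, X, Y] p"
proof -
  note DV = D_in[OF assms(1)]
  show ?thesis
    using T_skew(1)[OF DV[OF assms(3)] assms(2,4), of p] T_skew(1)[OF DV[OF assms(4)] assms(2,3), of p]
      T_skew(2)[OF assms(2) DV[OF assms(4)] assms(3), of p]
    by (simp add: cov3)
qed

lemma T_tor:
  assumes "X \<in> VF" "Y \<in> VF" "Z \<in> VF" "W \<in> VF"
  shows "T [lie_bracket X Y, Z, W] p = T [D X Y, Z, W] p - T [D Y X, Z, W] p - T [tor X Y, Z, W] p"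
  using assms by (simp add: tor_def tens3_diff[OF T_tens])

lemma T_tor_g:
  assumes "X \<in> VF" "Y \<in> VF" "Z \<in> VF" "W \<in> VF"
  shows "T [tor X Y, Z, W] p = g [tor X Y, tor Z W] p"
proof -
  have t: "tor X Y \<in> VF" using assms by simp
  have "T [tor X Y, Z, W] p = T [Z, W, tor X Y] p"
    using T_skew(1)[OF t assms(3,4), of p] T_skew(2)[OF assms(3) t assms(4), of p] by simp
  then show ?thesis using g_sym[of "tor Z W" "tor X Y"] assms by (simp add: T_eq)
qed

lemma g_tor_skew: "X \<in> VF \<Longrightarrow> Y \<in> VF \<Longrightarrow> W \<in> VF \<Longrightarrow> g [tor Y X, W] p = - g [tor X Y, W] p"
  by (simp add: tor_skew[of Y X] g_scale)

text \<open>Replacing each bracket by derivatives and \<open>tor\<close> leaves six torsion terms.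
  By the symmetry of g they agree in pairs, which is the source of the factor 2.\<close>

lemma dT_eq:
  assumes "a \<in> VF" "b \<in> VF" "c \<in> VF" "d \<in> VF"
  shows "ext_deriv T [a, b, c, d] p = cov_ext_deriv D T [a, b, c, d] p
    + 2 * (g [tor a b, tor c d] p - g [tor a c, tor b d] p + g [tor a d, tor b c] p)"
proof -
  have "ext_deriv T [a, b, c, d] p =
    a (T [b, c, d]) p - b (T [a, c, d]) p + c (T [a, b, d]) p - d (T [a, b, c]) p
    - T [lie_bracket a b, c, d] p + T [lie_bracket a c, b, d] p - T [lie_bracket a d, b, c] p
    - T [lie_bracket b c, a, d] p + T [lie_bracket b d, a, c] p - T [lie_bracket c d, a, b] p"
    unfolding ext_deriv_def by (simp add: eval_nat_numeral nths_Cons)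
  moreover have "cov_ext_deriv D T [a, b, c, d] p = cov_deriv D a T [b, c, d] p + cov_deriv D b T [c, a, d] p
      + cov_deriv D c T [a, b, d] p - cov_deriv D d T [a, b, c] p"
    by (simp add: cov_ext_deriv_def Let_def numeral_2_eq_2 numeral_3_eq_3)
  moreover have "cov_deriv D b T [c, a, d] p = - cov_deriv D b T [a, c, d] p"
    by (rule cov_T_skew) (fact assms)+
  moreover have "g [tor c d, tor a b] p = g [tor a b, tor c d] p" "g [tor b d, tor a c] p = g [tor a c, tor b d] p"
    "g [tor b c, tor a d] p = g [tor a d, tor b c] p"
    using assms by (simp_all add: g_sym)
  ultimately show ?thesis using assms by (simp add: T_derivative T_tor T_tor_g)
qed

lemma two_subsets_4: "{S. S \<subseteq> {..<4::nat} \<and> card S = 2} = {{0, 1}, {0, 2}, {0, 3}, {1, 2}, {1, 3}, {2, 3}}"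
  (is "?L = ?M")
proof (rule antisym)
  show "?L \<subseteq> ?M"
  proof
    fix S assume S: "S \<in> ?L"
    then obtain x y where xy: "S = {x, y}" "x \<noteq> y" by (auto simp: card_2_iff)
    have "\<exists>x y. S = {x, y} \<and> x < y"
      using xy by (metis insert_commute linorder_neqE_nat)
    then obtain x y where xy: "S = {x, y}" "x < y" by blast
    then have "y < 4" using S by simp
    then have "x = 0 \<or> x = 1 \<or> x = 2" "y = 1 \<or> y = 2 \<or> y = 3" using xy(2) by linarith+
    then show "S \<in> ?M" using xy by (elim disjE) simp_all
  qed
  show "?M \<subseteq> ?L" by simp
qed

lemma sum_two_subsets_4:
  fixes f :: "nat set \<Rightarrow> real"
  shows "(\<Sum>S | S \<subseteq> {..<4} \<and> card S = 2. f S) = f {0, 1} + f {0, 2} + f {0, 3} + f {1, 2} + f {1, 3} + f {2, 3}"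
  unfolding two_subsets_4 by (simp add: doubleton_eq_iff add.assoc)

lemma shuffle_sign_pair:
  assumes "i < j" shows "shuffle_sign {i, j} = (- 1) ^ (i + j + 1)"
proof -
  have "{(a, b). a \<in> {i, j} \<and> b \<notin> {i, j} \<and> b < a} = {i} \<times> {..<i} \<union> {j} \<times> ({..<j} - {i})"
    using assms by auto
  moreover have "card ({i} \<times> {..<i} \<union> {j} \<times> ({..<j} - {i})) = i + (j - 1)"
    using assms by (subst card_Un_disjoint) (auto simp: card_cartesian_product)
  moreover have "(- 1 :: real) ^ (i + j + 1) = (- 1) ^ (i + (j - 1) + 2)"
    using assms by (intro arg_cong[where f = "(^) (- 1)"]) simp
  ultimately show ?thesis by (simp add: shuffle_sign_def)
qed

lemma wedge_2_2:
  "wedge 2 \<alpha> \<beta> [a, b, c, d] p = \<alpha> [a, b] p * \<beta> [c, d] p - \<alpha> [a, c] p * \<beta> [b, d] p + \<alpha> [a, d] p * \<beta> [b, c] p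
    + \<alpha> [b, c] p * \<beta> [a, d] p - \<alpha> [b, d] p * \<beta> [a, c] p + \<alpha> [c, d] p * \<beta> [a, b] p"
proof -
  have "length [a, b, c, d] = 4" by simp
  moreover have "shuffle_sign {0, 1} = 1" "shuffle_sign {0, 2} = - 1" "shuffle_sign {0, 3} = 1"
    "shuffle_sign {1, 2} = 1" "shuffle_sign {1, 3} = - 1" "shuffle_sign {2, 3} = 1"
    by (subst shuffle_sign_pair; simp)+
  ultimately have "wedge 2 \<alpha> \<beta> [a, b, c, d] p =
      \<alpha> (nths [a, b, c, d] {0, 1}) p * \<beta> (nths [a, b, c, d] (- {0, 1})) p
      - \<alpha> (nths [a, b, c, d] {0, 2}) p * \<beta> (nths [a, b, c, d] (- {0, 2})) p
      + \<alpha> (nths [a, b, c, d] {0, 3}) p * \<beta> (nths [a, b, c, d] (- {0, 3})) p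
      + \<alpha> (nths [a, b, c, d] {1, 2}) p * \<beta> (nths [a, b, c, d] (- {1, 2})) p
      - \<alpha> (nths [a, b, c, d] {1, 3}) p * \<beta> (nths [a, b, c, d] (- {1, 3})) p
      + \<alpha> (nths [a, b, c, d] {2, 3}) p * \<beta> (nths [a, b, c, d] (- {2, 3})) p"
    unfolding wedge_def by (simp only: sum_two_subsets_4 mult_1 mult_minus_left add_uminus_conv_diff)
  also have "\<dots> = \<alpha> [a, b] p * \<beta> [c, d] p - \<alpha> [a, c] p * \<beta> [b, d] p + \<alpha> [a, d] p * \<beta> [b, c] p
    + \<alpha> [b, c] p * \<beta> [a, d] p - \<alpha> [b, d] p * \<beta> [a, c] p + \<alpha> [c, d] p * \<beta> [a, b] p"
    by (simp add: nths_Cons eval_nat_numeral)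
  finally show ?thesis .
qed

lemma sigma_eq:
  assumes "a \<in> VF" "b \<in> VF" "c \<in> VF" "d \<in> VF"
  shows "sigma_form A g T [a, b, c, d] p
    = g [tor a b, tor c d] p - g [tor a c, tor b d] p + g [tor a d, tor b c] p"
proof -
  define E where "E = orthonormal_choice A g p"
  have O: "orthonormal_at A g p E" unfolding E_def by (rule orthonormal_choice)
  have t: "T [E ! j, x, y] p = g [tor x y, E ! j] p" if "j < 8" "x \<in> VF" "y \<in> VF" for j x y
    using T_skew(1)[OF that(2) orthonormal_in[OF O that(1)] that(3), of p]
      T_skew(2)[OF that(2) that(3) orthonormal_in[OF O that(1)], of p] by (simp add: T_eq)
  have s: "(\<Sum>j<8. g [tor x y, E ! j] p * g [tor z w, E ! j] p) = g [tor x y, tor z w] p"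
    if "x \<in> VF" "y \<in> VF" "z \<in> VF" "w \<in> VF" for x y z w
    using g_expand[OF O, of "tor x y" "tor z w"] that by simp
  have "(\<Sum>j<8. wedge 2 (interior_product (E ! j) T) (interior_product (E ! j) T) [a, b, c, d] p)
     = (\<Sum>j<8. 2 * (g [tor a b, E ! j] p * g [tor c d, E ! j] p) - 2 * (g [tor a c, E ! j] p * g [tor b d, E ! j] p)
      + 2 * (g [tor a d, E ! j] p * g [tor b c, E ! j] p))"
    using assms by (intro sum.cong refl) (simp add: wedge_2_2 interior_product_def t)
  also have "\<dots> = 2 * g [tor a b, tor c d] p - 2 * g [tor a c, tor b d] p + 2 * g [tor a d, tor b c] p"
    using assms by (simp add: sum.distrib sum_subtractf sum_distrib_left[symmetric] s)
  finally show ?thesis by (simp add: sigma_form_def Let_def E_def[symmetric])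
qed

lemma dT_sigma:
  assumes "Xs \<in> field_lists A 4"
  shows "ext_deriv T Xs p = cov_ext_deriv D T Xs p + 2 * sigma_form A g T Xs p"
proof -
  obtain a b c d where "Xs = [a, b, c, d]" "a \<in> VF" "b \<in> VF" "c \<in> VF" "d \<in> VF"
    using assms by (auto simp: field_lists_def eval_nat_numeral length_Suc_conv)
  then show ?thesis by (simp add: dT_eq sigma_eq)
qed

lemma closed_iff:
  "tensor_zero A 4 (cov_ext_deriv D T) \<longleftrightarrow> tensor_eq A 4 (ext_deriv T) (\<lambda>Xs p. 2 * sigma_form A g T Xs p)"
  unfolding tensor_eq_def by (intro ball_cong refl) (simp add: fun_eq_iff dT_sigma)

definition hol :: "'m tensor" where
  "hol = reslot [4, 5, 2, 0, 3, 1, 6, 7] (tprod 4 R \<Psi>)"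

lemma hol_tens: "tens (Suc (Suc (Suc (Suc (Suc (Suc (Suc (Suc 0)))))))) hol"
proof -
  have "tens (4 + 4) hol" unfolding hol_def
    by (intro tens_reslot_tprod R_tens Psi_tens) (auto simp: eval_nat_numeral less_Suc_eq)
  then show ?thesis by (simp add: eval_nat_numeral)
qed

lemma hol_frame:
  assumes O: "orthonormal_at A g p E" and "X \<in> VF" "Y \<in> VF" "Z \<in> VF" "W \<in> VF"
  shows "ctr (ctr hol) [X, Y, Z, W] p = (\<Sum>a<8. \<Sum>b<8. R [X, Y, frm E a, frm E b] p * \<Psi> [frm E a, frm E b, Z, W] p)"
  using assms by (simp add: ctr_frame[OF O] hol_tens tens_ctr frm_in[OF O]) (simp add: hol_def reslot_def tprod_def)

text \<open>The instanton condition quantifies over all orthonormal frames. The contraction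
  \<open>hol\<close> extends the identity to them from adapted frames.\<close>

lemma holonomy:
  assumes O: "orthonormal_at A g p E" and V: "X \<in> VF" "Y \<in> VF" "Z \<in> VF" "W \<in> VF"
  shows "(\<Sum>a<8. \<Sum>b<8. R [X, Y, frm E a, frm E b] p * \<Psi> [frm E a, frm E b, Z, W] p) = 2 * R [X, Y, Z, W] p"
proof -
  have "tlin 1 (ctr (ctr hol)) (- 2) R [X, Y, Z, W] p = 0"
  proof (rule tens_zero_adapted)
    have "tens (Suc (Suc (Suc (Suc 0)))) (tlin 1 (ctr (ctr hol)) (- 2) R)"
      by (intro tens_tlin tens_ctr hol_tens R_tens_Suc)
    then show "tens 4 (tlin 1 (ctr (ctr hol)) (- 2) R)" by (simp add: eval_nat_numeral)
    show "[X, Y, Z, W] \<in> field_lists A 4" using V by (simp add: eval_nat_numeral)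
    fix e F and Zs :: "nat list" assume F: "adapted p e F" and Zs: "set Zs \<subseteq> {..<8}" "length Zs = 4"
    then obtain i j k l where ij: "Zs = [i, j, k, l]" "k < 8" "l < 8" by (auto simp: eval_nat_numeral length_Suc_conv)
    note P = adapted_orthonormal[OF F]
    show "tlin 1 (ctr (ctr hol)) (- 2) R (map (frm F) Zs) p = 0"
      using holonomy_frame[OF F frm_in[OF P, of i] frm_in[OF P, of j] ij(2,3)]
      by (simp add: ij(1) tlin_def hol_frame[OF P] frm_in[OF P])
  qed
  then show ?thesis using V by (simp add: tlin_def hol_frame[OF O])
qed

section \<open>Parallel torsion makes the curvature an instanton\<close>

context
  assumes par: "parallel A D 3 T"
begin

lemma T_parallel:
  assumes "X \<in> VF" "Y \<in> VF" "Z \<in> VF" "W \<in> VF"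
  shows "cov_deriv D X T [Y, Z, W] p = 0"
proof -
  have "[Y, Z, W] \<in> field_lists A 3" using assms by (simp add: eval_nat_numeral)
  then have "cov_deriv D X T [Y, Z, W] = (\<lambda>p. 0)"
    using par assms(1) unfolding parallel_def tensor_eq_def by blast
  then show ?thesis by simp
qed

lemma parallel_closed: "tensor_zero A 4 (cov_ext_deriv D T)"
  unfolding tensor_eq_def
proof (intro ballI ext)
  fix Xs p assume "Xs \<in> field_lists A 4"
  then obtain a b c d where "Xs = [a, b, c, d]" "a \<in> VF" "b \<in> VF" "c \<in> VF" "d \<in> VF"
    by (auto simp: field_lists_def eval_nat_numeral length_Suc_conv)
  then show "cov_ext_deriv D T Xs p = 0"
    by (simp add: cov_ext_deriv_def Let_def numeral_2_eq_2 numeral_3_eq_3 T_parallel)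
qed

lemma bianchi1_parallel:
  assumes "X \<in> VF" "Y \<in> VF" "Z \<in> VF" "V \<in> VF"
  shows "R [X, Y, Z, V] p + R [Y, Z, X, V] p + R [Z, X, Y, V] p =
    g [tor X Y, tor Z V] p + g [tor Y Z, tor X V] p + g [tor Z X, tor Y V] p"
  using bianchi1[OF assms, of p] assms by (simp add: T_parallel T_tor_g)

text \<open>Add \<open>bianchi1_parallel\<close> for (X,Y,Z,V) and (Y,Z,V,X) and subtract it for
  (Z,V,X,Y) and (V,X,Y,Z). The left sides give 2 (R(X,Y,Z,V) - R(Z,V,X,Y)). The right sides are
  values of one 4-form that change sign under each rotation, so they cancel.\<close>

lemma R_pair:
  assumes X: "X \<in> VF" and Y: "Y \<in> VF" and Z: "Z \<in> VF" and V: "V \<in> VF"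
  shows "R [X, Y, Z, V] p = R [Z, V, X, Y] p"
proof -
  let ?q = "\<lambda>X Y Z V. g [tor X Y, tor Z V] p"
  have q: "?q b a c d = - ?q a b c d" "?q c d a b = ?q a b c d" "?q a b d c = - ?q a b c d"
    if "a \<in> VF" "b \<in> VF" "c \<in> VF" "d \<in> VF" for a b c d
  proof -
    show s: "?q b a c d = - ?q a b c d" "?q c d a b = ?q a b c d" using that by (simp_all add: g_tor_skew[of a b] g_sym)
    show "?q a b d c = - ?q a b c d"
      using that g_sym[of "tor a b" "tor d c"] g_sym[of "tor a b" "tor c d"] by (simp add: g_tor_skew[of c d])
  qed
  have "?q Y Z V X = - ?q Y Z X V" "?q Z V Y X = - ?q X Y Z V" "?q V Y Z X = - ?q Z X Y V"
    "?q Z V X Y = ?q X Y Z V" "?q V X Z Y = ?q Y Z X V" "?q X Z V Y = ?q Z X Y V"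
    "?q V X Y Z = - ?q Y Z X V" "?q X Y V Z = - ?q X Y Z V" "?q Y V X Z = - ?q Z X Y V"
    using q(2)[OF X Y Z V] q(2)[OF Y Z X V] q(2)[OF Z X Y V] q(3)[OF Y Z X V] q(3)[OF Z V X Y] q(3)[OF X Y Z V]
      q(1)[OF Y V Z X] q(1)[OF X V Y Z] q(3)[OF X V Y Z] q(1)[OF Z X Y V] q(3)[OF Z X Y V] q(3)[OF X Z Y V]
      q(1)[OF X V Z Y] q(3)[OF Y V Z X] q(1)[OF Z X V Y]
    by linarith+
  then show ?thesis
    using bianchi1_parallel[OF X Y Z V, of p] bianchi1_parallel[OF Y Z V X, of p]
      bianchi1_parallel[OF Z V X Y, of p] bianchi1_parallel[OF V X Y Z, of p]
      R_skew1[OF Y Z V X, of p] R_skew2[OF Y Z V X, of p] R_skew1[OF Z V X Y, of p] R_skew2[OF Z V X Y, of p]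
      R_skew1[OF V X Y Z, of p] R_skew2[OF V X Y Z, of p] R_skew1[OF X Y V Z, of p] R_skew2[OF X Y V Z, of p]
      R_skew1[OF Z X Y V, of p] R_skew2[OF Z X Y V, of p] R_skew1[OF V Y Z X, of p] R_skew2[OF V Y Z X, of p]
      R_skew1[OF X Z V Y, of p] R_skew2[OF X Z V Y, of p] R_skew1[OF Y V X Z, of p] R_skew2[OF Y V X Z, of p]
      R_skew2[OF Y Z X V, of p] R_skew1[OF X V Y Z, of p] R_skew2[OF X V Y Z, of p] R_skew2[OF V X Z Y, of p]
      R_skew1[OF X Z Y V, of p] R_skew1[OF Y V Z X, of p] R_skew2[OF X Z Y V, of p] R_skew2[OF Y V Z X, of p]
    by linarith
qed

lemma parallel_instanton: "spin7_instanton A \<Psi> g R"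
  unfolding spin7_instanton_def
proof (intro allI impI)
  fix p E i j k l assume O: "orthonormal_at A g p E" and "i < (8::nat)" "j < (8::nat)" "k < (8::nat)" "l < (8::nat)"
  then have V: "E ! i \<in> VF" "E ! j \<in> VF" "E ! k \<in> VF" "E ! l \<in> VF" by (auto intro: orthonormal_in)
  have "(\<Sum>a<8. \<Sum>b<8. R [E ! a, E ! b, E ! i, E ! j] p * \<Psi> [E ! a, E ! b, E ! k, E ! l] p)
      = (\<Sum>a<8. \<Sum>b<8. R [E ! i, E ! j, frm E a, frm E b] p * \<Psi> [frm E a, frm E b, E ! k, E ! l] p)"
  proof (intro sum.cong[OF refl])
    fix a b assume "a \<in> {..<8::nat}" "b \<in> {..<8::nat}"
    then have ab: "frm E a = E ! a" "frm E b = E ! b" "E ! a \<in> VF" "E ! b \<in> VF"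
      using orthonormal_in[OF O] by (auto simp: frm_nth)
    show "R [E ! a, E ! b, E ! i, E ! j] p * \<Psi> [E ! a, E ! b, E ! k, E ! l] p
        = R [E ! i, E ! j, frm E a, frm E b] p * \<Psi> [frm E a, frm E b, E ! k, E ! l] p"
      by (simp only: ab(1,2) R_pair[OF ab(3,4) V(1,2)])
  qed
  also have "\<dots> = 2 * R [E ! i, E ! j, E ! k, E ! l] p" by (rule holonomy[OF O V])
  finally show "(\<Sum>a<8. \<Sum>b<8. R [E ! a, E ! b, E ! i, E ! j] p * \<Psi> [E ! a, E ! b, E ! k, E ! l] p)
      = 2 * R [E ! k, E ! l, E ! i, E ! j] p"
    by (simp only: R_pair[OF V])
qed

end

end

section \<open>Torsion of a balanced instanton\<close>

locale balanced_spin7 = spin7_torsion +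
  fixes vol
  assumes volume: "induced_volume_form A \<Psi> vol" and balanced: "balanced A g vol \<Psi>"
begin

text \<open>After three contractions this is T_abc \<Psi>_abcX, in the form in which its vanishing
  can be differentiated.\<close>

definition tpsi :: "'a tensor" where
  "tpsi = reslot [4, 2, 0, 5, 3, 1, 6] (tprod 3 T \<Psi>)"

lemma tpsi_tens: "tens (Suc (Suc (Suc (Suc (Suc (Suc (Suc 0))))))) tpsi"
proof -
  have "tens (3 + 4) tpsi" unfolding tpsi_def
    by (intro tens_reslot_tprod T_tens Psi_tens) (auto simp: eval_nat_numeral less_Suc_eq)
  then show ?thesis by (simp add: eval_nat_numeral)
qed

lemma tpsi_zero: "Xs \<in> field_lists A 1 \<Longrightarrow> ctr (ctr (ctr tpsi)) Xs p = 0"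
proof (rule tens_zero_adapted)
  show "tens 1 (ctr (ctr (ctr tpsi)))" using tpsi_tens by (simp add: tens_ctr)
  fix e F and Zs :: "nat list" assume F: "adapted p e F" and Zs: "set Zs \<subseteq> {..<8}" "length Zs = 1"
  then obtain l where l: "Zs = [l]" "l < 8" by (cases Zs) auto
  note O = adapted_orthonormal[OF F]
  show "ctr (ctr (ctr tpsi)) (map (frm F) Zs) p = 0"
    using torsion_Psi_frame[OF volume balanced F l(2)]
    by (simp add: l(1) ctr_frame[OF O] tpsi_tens tens_ctr frm_in[OF O])
      (simp add: tpsi_def reslot_def tprod_def)
qed

text \<open>The derivative of \<open>tpsi_zero\<close>; as \<Psi> is parallel, only the derivative
  of T remains under the contraction. Thus the derivative of the torsion has type 48 as
  well.\<close>

lemma cov_T_Psi_frame: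
  assumes F: "adapted p e F" and V: "V \<in> VF"
  shows "(\<Sum>a<8. \<Sum>b<8. \<Sum>c<8. cov_deriv D V T [frm F a, frm F b, frm F c] p * \<Psi> [frm F a, frm F b, frm F c, frm F l] p) = 0"
proof -
  note O = adapted_orthonormal[OF F]
  note W = frm_in[OF O]
  have e: "cov_deriv D V tpsi [c, c', b, b', a, a', X] p = cov_deriv D V T [a, b, c] p * \<Psi> [a', b', c', X] p"
    if "a \<in> VF" "a' \<in> VF" "b \<in> VF" "b' \<in> VF" "c \<in> VF" "c' \<in> VF" "X \<in> VF" for a a' b b' c c' X
  proof -
    have "cov_deriv D V \<Psi> [a', b', c', X] p = 0"
      using Psi_cov[OF V, of "[a', b', c', X]"] that by (simp add: eval_nat_numeral)
    moreover have "[c, c', b, b', a, a', X] \<in> field_lists A (3 + 4)" using that by (simp add: eval_nat_numeral)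
    moreover have "set [4, 2, 0, 5, 3, 1, 6] = {..<3 + 4 :: nat}" by (auto simp: eval_nat_numeral less_Suc_eq)
    ultimately show ?thesis
      unfolding tpsi_def by (subst cov_reslot_tprod[OF V T_tens Psi_tens]) simp_all
  qed
  have "cov_deriv D V (ctr (ctr (ctr tpsi))) [frm F l] p = 0"
    by (rule cov_zero[of _ D _ 1]) (simp_all add: V W tpsi_zero)
  then show ?thesis
    by (simp add: cov_ctr_frame[OF O] tpsi_tens tens_ctr W V e)
qed

section \<open>The instanton condition and d^nabla T = 0 force the torsion to be parallel\<close>

context
  assumes inst: "spin7_instanton A \<Psi> g R" and closed: "tensor_zero A 4 (cov_ext_deriv D T)"
begin

lemma cov_T_closed:
  assumes "X \<in> VF" "Y \<in> VF" "Z \<in> VF" "V \<in> VF"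
  shows "cov_deriv D X T [Y, Z, V] p + cov_deriv D Y T [Z, X, V] p + cov_deriv D Z T [X, Y, V] p
    = cov_deriv D V T [X, Y, Z] p"
proof -
  have "cov_ext_deriv D T [X, Y, Z, V] = (\<lambda>p. 0)"
    using closed assms by (simp add: tensor_eq_def eval_nat_numeral)
  then have "cov_ext_deriv D T [X, Y, Z, V] p = 0" by simp
  then show ?thesis by (simp add: cov_ext_deriv_def Let_def numeral_2_eq_2 numeral_3_eq_3)
qed

lemma instanton_frame:
  assumes F: "adapted p e F" and "k < 8" "l < 8"
  shows "(\<Sum>a<8. \<Sum>b<8. R [frm F a, frm F b, frm F i, frm F j] p * \<Psi> [frm F a, frm F b, frm F k, frm F l] p)
    = 2 * R [frm F k, frm F l, frm F i, frm F j] p"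
proof -
  have "(\<Sum>a<8. \<Sum>b<8. R [F ! a, F ! b, F ! (i mod 8), F ! (j mod 8)] p * \<Psi> [F ! a, F ! b, F ! k, F ! l] p)
    = 2 * R [F ! k, F ! l, F ! (i mod 8), F ! (j mod 8)] p"
    using inst adapted_orthonormal[OF F] assms(2,3) unfolding spin7_instanton_def by simp
  then show ?thesis using assms(2,3) unfolding frm_def by (simp cong: sum.cong_simp)
qed

lemma instanton_array_frame:
  assumes F: "adapted p e F"
  shows "instanton_array (\<lambda>i j k l. \<Psi> [frm F i, frm F j, frm F k, frm F l] p)
    (\<lambda>i j k. T [frm F i, frm F j, frm F k] p)
    (\<lambda>m i j k. cov_deriv D (frm F m) T [frm F i, frm F j, frm F k] p)
    (\<lambda>i j k l. R [frm F i, frm F j, frm F k, frm F l] p)"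
proof -
  note O = adapted_orthonormal[OF F]
  note W = frm_in[OF O]
  interpret spin7_array "\<lambda>i j k l. \<Psi> [frm F i, frm F j, frm F k, frm F l] p"
    by (rule spin7_array_frame[OF F])
  show ?thesis
  proof unfold_locales
    fix i j k l
    show "T [frm F j, frm F i, frm F k] p = - T [frm F i, frm F j, frm F k] p"
      "T [frm F i, frm F k, frm F j] p = - T [frm F i, frm F j, frm F k] p" by (rule T_skew[OF W W W])+
    show "R [frm F j, frm F i, frm F k, frm F l] p = - R [frm F i, frm F j, frm F k, frm F l] p" by (rule R_skew1[OF W W W W])
    show "R [frm F i, frm F j, frm F l, frm F k] p = - R [frm F i, frm F j, frm F k, frm F l] p" by (rule R_skew2[OF W W W W])
    show "cov_deriv D (frm F i) T [frm F j, frm F k, frm F l] p + cov_deriv D (frm F j) T [frm F k, frm F i, frm F l] p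
      + cov_deriv D (frm F k) T [frm F i, frm F j, frm F l] p = cov_deriv D (frm F l) T [frm F i, frm F j, frm F k] p"
      by (rule cov_T_closed[OF W W W W])
    show "R [frm F i, frm F j, frm F k, frm F l] p + R [frm F j, frm F k, frm F i, frm F l] p + R [frm F k, frm F i, frm F j, frm F l] p
      = cov_deriv D (frm F l) T [frm F i, frm F j, frm F k] p
       + (\<Sum>s<8. T [frm F i, frm F j, frm F s] p * T [frm F s, frm F k, frm F l] p
            + T [frm F j, frm F k, frm F s] p * T [frm F s, frm F i, frm F l] p
            + T [frm F k, frm F i, frm F s] p * T [frm F s, frm F j, frm F l] p)"
      using bianchi1[OF W[of i] W[of j] W[of k] W[of l], of p] cov_T_closed[OF W[of i] W[of j] W[of k] W[of l], of p]
      by (simp add: T_tor_expand[OF O W W] W T_tens_Suc sum.distrib)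
  next
    fix m i j k
    show "cov_deriv D (frm F m) T [frm F j, frm F i, frm F k] p = - cov_deriv D (frm F m) T [frm F i, frm F j, frm F k] p"
      "cov_deriv D (frm F m) T [frm F i, frm F k, frm F j] p = - cov_deriv D (frm F m) T [frm F i, frm F j, frm F k] p"
      by (rule cov_T_skew[OF W W W W])+
  next
    fix d :: nat assume "d < 8"
    then show "(\<Sum>a<8. \<Sum>b<8. \<Sum>c<8. T [frm F a, frm F b, frm F c] p * \<Psi> [frm F a, frm F b, frm F c, frm F d] p) = 0"
      by (rule torsion_Psi_frame[OF volume balanced F])
  next
    fix m d
    show "(\<Sum>a<8. \<Sum>b<8. \<Sum>c<8. cov_deriv D (frm F m) T [frm F a, frm F b, frm F c] p * \<Psi> [frm F a, frm F b, frm F c, frm F d] p) = 0"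
      by (rule cov_T_Psi_frame[OF F W])
  next
    fix i j k l :: nat assume kl: "k < 8" "l < 8"
    show "contr (\<lambda>a b. R [frm F a, frm F b, frm F i, frm F j] p) k l = 2 * R [frm F k, frm F l, frm F i, frm F j] p"
      unfolding contr_def by (rule instanton_frame[OF F kl])
    show "contr (\<lambda>a b. R [frm F i, frm F j, frm F a, frm F b] p) k l = 2 * R [frm F i, frm F j, frm F k, frm F l] p"
      unfolding contr_def by (rule holonomy_frame[OF F W W kl])
  qed
qed

definition rpair :: "'a tensor" where
  "rpair = reslot [2, 0, 3, 1] R"

definition rric :: "'a tensor" where
  "rric = reslot [0, 2, 1, 3] R"

definition rric2 :: "'a tensor" where
  "rric2 = reslot [0, 3, 1, 2] R"

definition rswap :: "'a tensor" where
  "rswap = reslot [2, 3, 0, 1] R"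

definition tt :: "'a tensor" where
  "tt = reslot [4, 2, 0, 5, 3, 1] (tprod 3 T T)"

definition rpsi :: "'a tensor" where
  "rpsi = reslot [2, 0, 4, 5, 3, 1, 6, 7] (tprod 4 R \<Psi>)"

definition tr :: "'a tensor" where
  "tr = reslot [4, 2, 0, 6, 5, 3, 1] (tprod 3 T R)"

text \<open>This and the next three definitions are identities of \<open>instanton_array\<close>
  brought to one side. As tensors that vanish at every point they may be differentiated with
  \<open>cov_zero\<close> and \<open>cov_ctr_frame\<close>.\<close>

definition scal_id :: "'a tensor" where
  "scal_id = tlin 3 (ctr (ctr rpair)) (- 1) (ctr (ctr (ctr tt)))"

definition ricci_id :: "'a tensor" where
  "ricci_id = tlin 1 (ctr rric) (- 1) (ctr rric2)"

definition inst_id :: "'a tensor" where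
  "inst_id = tlin 1 (ctr (ctr rpsi)) (- 2) rswap"

definition tr_id :: "'a tensor" where
  "tr_id = ctr (ctr (ctr tr))"

lemma R_reslot_tens:
  "tens (Suc (Suc (Suc (Suc 0)))) rpair" "tens (Suc (Suc (Suc (Suc 0)))) rric"
  "tens (Suc (Suc (Suc (Suc 0)))) rric2" "tens (Suc (Suc (Suc (Suc 0)))) rswap"
  unfolding rpair_def rric_def rric2_def rswap_def
  by (rule tens_reslot[OF R_tens_Suc]; auto simp: eval_nat_numeral less_Suc_eq)+

lemma TT_tens: "tens (Suc (Suc (Suc (Suc (Suc (Suc 0)))))) tt"
proof -
  have "tens (3 + 3) tt"
    unfolding tt_def by (intro tens_reslot_tprod T_tens) (auto simp: eval_nat_numeral less_Suc_eq)
  then show ?thesis by (simp add: eval_nat_numeral)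
qed

lemma RPsi_tens: "tens (Suc (Suc (Suc (Suc (Suc (Suc (Suc (Suc 0)))))))) rpsi"
proof -
  have "tens (4 + 4) rpsi"
    unfolding rpsi_def by (intro tens_reslot_tprod R_tens Psi_tens) (auto simp: eval_nat_numeral less_Suc_eq)
  then show ?thesis by (simp add: eval_nat_numeral)
qed

lemma TR_tens: "tens (Suc (Suc (Suc (Suc (Suc (Suc (Suc 0))))))) tr"
proof -
  have "tens (3 + 4) tr"
    unfolding tr_def by (intro tens_reslot_tprod T_tens R_tens) (auto simp: eval_nat_numeral less_Suc_eq)
  then show ?thesis by (simp add: eval_nat_numeral)
qed

lemma scal_id_zero: "Xs \<in> field_lists A 0 \<Longrightarrow> scal_id Xs p = 0"
proof (rule tens_zero_adapted)
  show "tens 0 scal_id" unfolding scal_id_def by (intro tens_tlin tens_ctr R_reslot_tens TT_tens)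
  fix e F and Zs :: "nat list" assume F: "adapted p e F" and "length Zs = 0"
  note O = adapted_orthonormal[OF F]
  show "scal_id (map (frm F) Zs) p = 0"
    using instanton_array.scalar_curvature[OF instanton_array_frame[OF F]] \<open>length Zs = 0\<close>
    by (simp add: scal_id_def tlin_def ctr_frame[OF O] R_reslot_tens TT_tens tens_ctr frm_in[OF O])
      (simp add: rpair_def tt_def rpsi_def rswap_def tr_def reslot_def tprod_def)
qed

lemma ricci_id_zero: "Xs \<in> field_lists A 2 \<Longrightarrow> ricci_id Xs p = 0"
proof (rule tens_zero_adapted)
  show "tens 2 ricci_id" unfolding ricci_id_def numeral_2_eq_2 by (intro tens_tlin tens_ctr R_reslot_tens)
  fix e F and Zs :: "nat list" assume F: "adapted p e F" and Zs: "set Zs \<subseteq> {..<8}" "length Zs = 2"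
  then obtain i j where ij: "Zs = [i, j]" "j < 8" by (auto simp: numeral_2_eq_2 length_Suc_conv)
  note O = adapted_orthonormal[OF F]
  show "ricci_id (map (frm F) Zs) p = 0"
    using instanton_array.ricci_sym[OF instanton_array_frame[OF F] ij(2), of i]
    by (simp add: ij(1) ricci_id_def tlin_def ctr_frame[OF O] R_reslot_tens frm_in[OF O])
      (simp add: rric_def rric2_def reslot_def)
qed

lemma inst_id_zero: "Xs \<in> field_lists A 4 \<Longrightarrow> inst_id Xs p = 0"
proof (rule tens_zero_adapted)
  have "tens (Suc (Suc (Suc (Suc 0)))) inst_id"
    unfolding inst_id_def by (intro tens_tlin tens_ctr R_reslot_tens RPsi_tens)
  then show "tens 4 inst_id" by (simp add: eval_nat_numeral)
  fix e F and Zs :: "nat list" assume F: "adapted p e F" and Zs: "set Zs \<subseteq> {..<8}" "length Zs = 4"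
  then obtain i j k l where ij: "Zs = [i, j, k, l]" "k < 8" "l < 8" by (auto simp: eval_nat_numeral length_Suc_conv)
  note O = adapted_orthonormal[OF F]
  show "inst_id (map (frm F) Zs) p = 0"
    using instanton_frame[OF F ij(2,3), of i j]
    by (simp add: ij(1) inst_id_def tlin_def ctr_frame[OF O] RPsi_tens R_reslot_tens tens_ctr frm_in[OF O])
      (simp add: rpair_def tt_def rpsi_def rswap_def tr_def reslot_def tprod_def)
qed

lemma cov_R_reslot:
  assumes "V \<in> VF" "a \<in> VF" "b \<in> VF" "c \<in> VF" "d \<in> VF"
  shows "cov_deriv D V rpair [a, b, c, d] p = cov_deriv D V R [c, a, d, b] p"
    "cov_deriv D V rric [a, b, c, d] p = cov_deriv D V R [a, c, b, d] p"
    "cov_deriv D V rric2 [a, b, c, d] p = cov_deriv D V R [a, d, b, c] p"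
    "cov_deriv D V rswap [a, b, c, d] p = cov_deriv D V R [c, d, a, b] p"
proof -
  have "[a, b, c, d] \<in> field_lists A 4" using assms by (simp add: eval_nat_numeral)
  note c = cov_reslot[OF _ _ this]
  show "cov_deriv D V rpair [a, b, c, d] p = cov_deriv D V R [c, a, d, b] p"
    "cov_deriv D V rric [a, b, c, d] p = cov_deriv D V R [a, c, b, d] p"
    "cov_deriv D V rric2 [a, b, c, d] p = cov_deriv D V R [a, d, b, c] p"
    "cov_deriv D V rswap [a, b, c, d] p = cov_deriv D V R [c, d, a, b] p"
    unfolding rpair_def rric_def rric2_def rswap_def
    by (subst c; auto simp: eval_nat_numeral less_Suc_eq)+
qed

lemma cov_scal_frame:
  assumes F: "adapted p e F" and V: "V \<in> VF"
  shows "3 * (\<Sum>j<8. \<Sum>k<8. cov_deriv D V R [frm F j, frm F k, frm F j, frm F k] p)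
    = 2 * (\<Sum>s<8. \<Sum>j<8. \<Sum>k<8. T [frm F s, frm F j, frm F k] p * cov_deriv D V T [frm F s, frm F j, frm F k] p)"
proof -
  note O = adapted_orthonormal[OF F]
  note W = frm_in[OF O]
  have e: "cov_deriv D V tt [c, c', b, b', a, a'] p
      = cov_deriv D V T [a, b, c] p * T [a', b', c'] p + T [a, b, c] p * cov_deriv D V T [a', b', c'] p"
    if "a \<in> VF" "a' \<in> VF" "b \<in> VF" "b' \<in> VF" "c \<in> VF" "c' \<in> VF" for a a' b b' c c'
  proof -
    have "[c, c', b, b', a, a'] \<in> field_lists A (3 + 3)" using that by (simp add: eval_nat_numeral)
    moreover have "set [4, 2, 0, 5, 3, 1] = {..<3 + 3 :: nat}" by (auto simp: eval_nat_numeral less_Suc_eq)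
    ultimately show ?thesis by (unfold tt_def, subst cov_reslot_tprod[OF V T_tens T_tens]) simp_all
  qed
  have "cov_deriv D V scal_id [] p = 0"
    by (rule cov_zero[of _ D _ 0]) (simp_all add: V W scal_id_zero)
  moreover have "cov_deriv D V scal_id [] p
      = 3 * cov_deriv D V (ctr (ctr rpair)) [] p
        + (- 1) * cov_deriv D V (ctr (ctr (ctr tt))) [] p"
    unfolding scal_id_def by (rule cov_tlin[OF V, of 0]) (simp_all add: tens_ctr R_reslot_tens TT_tens)
  ultimately show ?thesis
    by (simp add: cov_ctr_frame[OF O] R_reslot_tens TT_tens tens_ctr W V e cov_R_reslot sum.distrib sum_distrib_left sum_negf mult.commute mult.left_commute)
qed

lemma cov_ricci_frame:
  assumes F: "adapted p e F" and V: "V \<in> VF"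
  shows "(\<Sum>c<8. cov_deriv D V R [frm F c, frm F i, frm F c, frm F j] p)
    = (\<Sum>c<8. cov_deriv D V R [frm F c, frm F j, frm F c, frm F i] p)"
proof -
  note O = adapted_orthonormal[OF F]
  note W = frm_in[OF O]
  have "cov_deriv D V ricci_id [frm F i, frm F j] p = 0"
    by (rule cov_zero[of _ D _ 2]) (simp_all add: V W ricci_id_zero numeral_2_eq_2)
  moreover have "cov_deriv D V ricci_id [frm F i, frm F j] p
      = 1 * cov_deriv D V (ctr rric) [frm F i, frm F j] p
        + (- 1) * cov_deriv D V (ctr rric2) [frm F i, frm F j] p"
    unfolding ricci_id_def by (rule cov_tlin[OF V, of 2]) (simp_all add: numeral_2_eq_2 tens_ctr R_reslot_tens W)
  ultimately show ?thesis
    by (simp add: cov_ctr_frame[OF O] R_reslot_tens tens_ctr W V cov_R_reslot)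
qed

lemma cov_inst_frame:
  assumes F: "adapted p e F" and V: "V \<in> VF"
  shows "(\<Sum>a<8. \<Sum>b<8. cov_deriv D V R [frm F a, frm F b, frm F i, frm F j] p * \<Psi> [frm F a, frm F b, frm F k, frm F l] p)
    = 2 * cov_deriv D V R [frm F k, frm F l, frm F i, frm F j] p"
proof -
  note O = adapted_orthonormal[OF F]
  note W = frm_in[OF O]
  have e: "cov_deriv D V rpsi [b, b', a, a', X, Y, Z, U] p
      = cov_deriv D V R [a, b, X, Y] p * \<Psi> [a', b', Z, U] p"
    if "a \<in> VF" "a' \<in> VF" "b \<in> VF" "b' \<in> VF" "X \<in> VF" "Y \<in> VF" "Z \<in> VF" "U \<in> VF" for a a' b b' X Y Z U
  proof -
    have "cov_deriv D V \<Psi> [a', b', Z, U] p = 0"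
      using Psi_cov[OF V, of "[a', b', Z, U]"] that by (simp add: eval_nat_numeral)
    moreover have "[b, b', a, a', X, Y, Z, U] \<in> field_lists A (4 + 4)" using that by (simp add: eval_nat_numeral)
    moreover have "set [2, 0, 4, 5, 3, 1, 6, 7] = {..<4 + 4 :: nat}" by (auto simp: eval_nat_numeral less_Suc_eq)
    ultimately show ?thesis by (unfold rpsi_def, subst cov_reslot_tprod[OF V R_tens Psi_tens]) simp_all
  qed
  let ?X = "[frm F i, frm F j, frm F k, frm F l]"
  have X4: "?X \<in> field_lists A 4" by (simp add: W eval_nat_numeral)
  have "cov_deriv D V inst_id ?X p = 0"
    by (rule cov_zero[OF V _ X4]) (simp_all add: V inst_id_zero)
  moreover have "cov_deriv D V inst_id ?X p
      = 1 * cov_deriv D V (ctr (ctr rpsi)) ?X p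
        + (- 2) * cov_deriv D V rswap ?X p"
    unfolding inst_id_def
    by (rule cov_tlin[OF V, of "Suc (Suc (Suc (Suc 0)))"]) (simp_all add: tens_ctr R_reslot_tens RPsi_tens W)
  ultimately show ?thesis
    by (simp add: cov_ctr_frame[OF O] RPsi_tens tens_ctr W V e cov_R_reslot)
qed

lemma bianchi2_frame:
  assumes F: "adapted p e F"
  shows "cov_deriv D (frm F x) R [frm F y, frm F z, frm F u, frm F v] p
    + cov_deriv D (frm F y) R [frm F z, frm F x, frm F u, frm F v] p
    + cov_deriv D (frm F z) R [frm F x, frm F y, frm F u, frm F v] p
    + (\<Sum>s<8. T [frm F x, frm F y, frm F s] p * R [frm F s, frm F z, frm F u, frm F v] p
      + T [frm F y, frm F z, frm F s] p * R [frm F s, frm F x, frm F u, frm F v] p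
      + T [frm F z, frm F x, frm F s] p * R [frm F s, frm F y, frm F u, frm F v] p) = 0"
proof -
  note O = adapted_orthonormal[OF F]
  note W = frm_in[OF O]
  show ?thesis
    using bianchi2[OF W[of x] W[of y] W[of z] W[of u] W[of v], of p]
    by (simp add: T_tor_expand[OF O W W] W R_tens_Suc sum.distrib)
qed

text \<open>A second round: the derivatives of the scalar, Ricci and instanton identities enter as
  hypotheses on the array of derivatives of R. The outcome T_sjk R_isjk = 0 again holds at every
  point and can be differentiated in turn.\<close>

lemma tr_id_zero: "Xs \<in> field_lists A 1 \<Longrightarrow> tr_id Xs p = 0"
proof (rule tens_zero_adapted)
  show "tens 1 tr_id" unfolding tr_id_def One_nat_def by (intro tens_ctr TR_tens)
  fix e F and Zs :: "nat list" assume F: "adapted p e F" and Zs: "set Zs \<subseteq> {..<8}" "length Zs = 1"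
  then obtain i where i: "Zs = [i]" "i < 8" by (cases Zs) auto
  note O = adapted_orthonormal[OF F]
  note W = frm_in[OF O]
  interpret instanton_array "\<lambda>i j k l. \<Psi> [frm F i, frm F j, frm F k, frm F l] p"
    "\<lambda>i j k. T [frm F i, frm F j, frm F k] p"
    "\<lambda>m i j k. cov_deriv D (frm F m) T [frm F i, frm F j, frm F k] p"
    "\<lambda>i j k l. R [frm F i, frm F j, frm F k, frm F l] p"
    by (rule instanton_array_frame[OF F])
  have "(\<Sum>s<8. \<Sum>j<8. \<Sum>k<8. T [frm F s, frm F j, frm F k] p * R [frm F i, frm F s, frm F j, frm F k] p) = 0"
    by (rule t_r_zero[where dr = "\<lambda>m i j k l. cov_deriv D (frm F m) R [frm F i, frm F j, frm F k, frm F l] p"])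
      (rule cov_R_skew[OF W W W W W] bianchi2_frame[OF F] cov_scal_frame[OF F W] cov_ricci_frame[OF F W] i(2)
        | unfold contr_def, rule cov_inst_frame[OF F W])+
  then show "tr_id (map (frm F) Zs) p = 0"
    by (simp add: i(1) tr_id_def ctr_frame[OF O] TR_tens tens_ctr W) (simp add: rpair_def tt_def rpsi_def rswap_def tr_def reslot_def tprod_def)
qed

text \<open>With V the i-th frame field this is the hypothesis \<open>eta\<close> of
  \<open>dt_vanishes\<close>.\<close>

lemma cov_tr_frame:
  assumes F: "adapted p e F" and V: "V \<in> VF"
  shows "(\<Sum>s<8. \<Sum>j<8. \<Sum>k<8. cov_deriv D V T [frm F s, frm F j, frm F k] p * R [frm F i, frm F s, frm F j, frm F k] p
    + T [frm F s, frm F j, frm F k] p * cov_deriv D V R [frm F i, frm F s, frm F j, frm F k] p) = 0"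
proof -
  note O = adapted_orthonormal[OF F]
  note W = frm_in[OF O]
  have e: "cov_deriv D V tr [c, c', b, b', a, a', X] p
      = cov_deriv D V T [a, b, c] p * R [X, a', b', c'] p + T [a, b, c] p * cov_deriv D V R [X, a', b', c'] p"
    if "a \<in> VF" "a' \<in> VF" "b \<in> VF" "b' \<in> VF" "c \<in> VF" "c' \<in> VF" "X \<in> VF" for a a' b b' c c' X
  proof -
    have "[c, c', b, b', a, a', X] \<in> field_lists A (3 + 4)" using that by (simp add: eval_nat_numeral)
    moreover have "set [4, 2, 0, 6, 5, 3, 1] = {..<3 + 4 :: nat}" by (auto simp: eval_nat_numeral less_Suc_eq)
    ultimately show ?thesis by (unfold tr_def, subst cov_reslot_tprod[OF V T_tens R_tens]) simp_all
  qed
  have "cov_deriv D V tr_id [frm F i] p = 0"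
    by (rule cov_zero[of _ D _ 1]) (simp_all add: V W tr_id_zero)
  then show ?thesis
    by (simp add: tr_id_def cov_ctr_frame[OF O] TR_tens tens_ctr W V e)
qed

lemma cov_T_frame_zero:
  assumes F: "adapted p e F" and "m < 8" "s < 8" "j < 8" "k < 8"
  shows "cov_deriv D (frm F m) T [frm F s, frm F j, frm F k] p = 0"
proof -
  note W = frm_in[OF adapted_orthonormal[OF F]]
  interpret instanton_array "\<lambda>i j k l. \<Psi> [frm F i, frm F j, frm F k, frm F l] p"
    "\<lambda>i j k. T [frm F i, frm F j, frm F k] p"
    "\<lambda>m i j k. cov_deriv D (frm F m) T [frm F i, frm F j, frm F k] p"
    "\<lambda>i j k l. R [frm F i, frm F j, frm F k, frm F l] p"
    by (rule instanton_array_frame[OF F])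
  show ?thesis
    by (rule dt_vanishes[where dr = "\<lambda>m i j k l. cov_deriv D (frm F m) R [frm F i, frm F j, frm F k, frm F l] p"])
      (rule cov_R_skew[OF W W W W W] bianchi2_frame[OF F] cov_scal_frame[OF F W] cov_ricci_frame[OF F W]
        cov_tr_frame[OF F W] assms(2-5)
        | unfold contr_def, rule cov_inst_frame[OF F W])+
qed

theorem torsion_parallel: "parallel A D 3 T"
  unfolding parallel_def tensor_eq_def
proof (intro ballI ext)
  fix X Xs p assume X: "X \<in> VF" and Xs: "Xs \<in> field_lists A 3"
  show "cov_deriv D X T Xs p = 0"
  proof (rule tens_zero_adapted[OF tens_cov[OF X T_tens] _ Xs])
    fix e F and Zs :: "nat list" assume F: "adapted p e F" and Zs: "set Zs \<subseteq> {..<8}" "length Zs = 3"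
    then obtain i j k where ijk: "Zs = [i, j, k]" "i < 8" "j < 8" "k < 8"
      by (auto simp: numeral_3_eq_3 length_Suc_conv)
    note O = adapted_orthonormal[OF F]
    note W = frm_in[OF O]
    \<comment> \<open>The direction X is not a tensor slot of \<open>cov_deriv D X T\<close>, so its
      pointwise dependence on X is obtained from \<open>expand_functional\<close>; this reduces X to
      the frame directions covered by \<open>cov_T_frame_zero\<close>.\<close>
    have "cov_deriv D X T [frm F i, frm F j, frm F k] p
        = (\<Sum>m<8. g [X, F ! m] p * cov_deriv D (F ! m) T [frm F i, frm F j, frm F k] p)"
    proof (rule expand_functional[OF O X])
      fix Y Z assume YZ: "Y \<in> VF" "Z \<in> VF"
      show "cov_deriv D (vf_add Y Z) T [frm F i, frm F j, frm F k] p
          = cov_deriv D Y T [frm F i, frm F j, frm F k] p + cov_deriv D Z T [frm F i, frm F j, frm F k] p"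
        using YZ W tens_add[OF T_tens_Suc, of "[D Y (frm F i), frm F j, frm F k]" 0 "D Y (frm F i)" "D Z (frm F i)" p]
          tens_add[OF T_tens_Suc, of "[frm F i, D Y (frm F j), frm F k]" 1 "D Y (frm F j)" "D Z (frm F j)" p]
          tens_add[OF T_tens_Suc, of "[frm F i, frm F j, D Y (frm F k)]" 2 "D Y (frm F k)" "D Z (frm F k)" p]
        by (simp add: cov3 D_add vf_apply)
    next
      fix f Y assume Y: "Y \<in> VF" "smooth_fun A f"
      show "cov_deriv D (vf_scale f Y) T [frm F i, frm F j, frm F k] p
          = f p * cov_deriv D Y T [frm F i, frm F j, frm F k] p"
        using Y W tens_scale[OF T_tens_Suc, of "[D Y (frm F i), frm F j, frm F k]" 0 "D Y (frm F i)" f p]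
          tens_scale[OF T_tens_Suc, of "[frm F i, D Y (frm F j), frm F k]" 1 "D Y (frm F j)" f p]
          tens_scale[OF T_tens_Suc, of "[frm F i, frm F j, D Y (frm F k)]" 2 "D Y (frm F k)" f p]
        by (simp add: cov3 D_scale vf_apply right_diff_distrib)
    qed
    also have "\<dots> = 0"
      using cov_T_frame_zero[OF F] ijk by (intro sum.neutral) (simp add: frm_nth)
    finally show "cov_deriv D X T (map (frm F) Zs) p = 0" by (simp add: ijk(1))
  qed
qed

end

end

theorem corollary1p9:
  fixes A :: "'m::{t2_space,second_countable_topology} chart set"
    and \<Psi> g vol :: "'m tensor"
    and D :: "'m vfield \<Rightarrow> 'm vfield \<Rightarrow> 'm vfield"
  assumes "smooth_atlas A"
    and "spin7_structure A \<Psi>"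
    and "induced_metric A \<Psi> g"
    and "induced_volume_form A \<Psi> vol"
    and "balanced A g vol \<Psi>"
    and "torsion_connection A \<Psi> g D"
  shows "(spin7_instanton A \<Psi> g (curvature g D) \<and> tensor_zero A 4 (cov_ext_deriv D (torsion_form g D))
            \<longleftrightarrow> parallel A D 3 (torsion_form g D))
       \<and> (tensor_zero A 4 (cov_ext_deriv D (torsion_form g D))
            \<longleftrightarrow> tensor_eq A 4 (ext_deriv (torsion_form g D))
                  (\<lambda>Xs p. 2 * sigma_form A g (torsion_form g D) Xs p))"
proof -
  interpret balanced_spin7 A \<Psi> g D vol
    by unfold_locales (fact assms)+
  show ?thesis using torsion_parallel parallel_instanton parallel_closed closed_iff by blast
qed

end
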